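(* Let $p,q,\upsilon,\sigma,\tau,w_1,w_2,\gamma_1,\gamma_2,\gamma_3\in\mathbb{C}$ with $\operatorname{Re}(p)>0$, $\operatorname{Re}(q)>0$, $\operatorname{Re}(\upsilon)>0$, $\operatorname{Re}(\sigma)>0$, $\operatorname{Re}(\tau)>0$, and let $a_1<a_2$, $b_1<b_2$ be real. Then the integral operator $\mathfrak{E}_{\frac{\gamma_{1}+1}{2};\gamma_{2};\gamma_{3};\sigma,\tau,\upsilon,w_{1},w_{2};a_{1}^{+},b_{1}^{+}}^{(\gamma_{1};\gamma_{2};\gamma_{3})}$ has on the space $L((a_1,a_2)\times(b_1,b_2))$ the left inverse operator $\mathbb{D}_{\frac{\gamma_{1}+1}{2};\gamma_{2};\gamma_{3};p,q,\upsilon,w_{1},w_{2};a_{1}^{+},b_{1}^{+}}^{(\gamma_{1};\gamma_{2};\gamma_{3})}$ given by $$\left(\mathbb{D}_{\frac{\gamma_{1}+1}{2};\gamma_{2};\gamma_{3};p,q,\upsilon,w_{1},w_{2};a_{1}^{+},b_{1}^{+}}^{(\gamma_{1};\gamma_{2};\gamma_{3})}\phi\right)(z,t)={}_{t}D_{b_{1}^{+}}^{q+\tau}\,{}_{z}D_{a_{1}^{+}}^{p+\sigma}\left(\mathfrak{E}_{\frac{-\gamma_{1}+1}{2};-\gamma_{2};-\gamma_{3};p,q,\upsilon,w_{1},w_{2};a_{1}^{+},b_{1}^{+}}^{(-\gamma_{1};-\gamma_{2};-\gamma_{3})}\phi\right)(z,t);$$ that is, if $d\in L((a_1,a_2)\times(b_1,b_2))$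 and $\phi=\mathfrak{E}_{\frac{\gamma_{1}+1}{2};\gamma_{2};\gamma_{3};\sigma,\tau,\upsilon,w_{1},w_{2};a_{1}^{+},b_{1}^{+}}^{(\gamma_{1};\gamma_{2};\gamma_{3})}d$, then $\mathbb{D}_{\frac{\gamma_{1}+1}{2};\gamma_{2};\gamma_{3};p,q,\upsilon,w_{1},w_{2};a_{1}^{+},b_{1}^{+}}^{(\gamma_{1};\gamma_{2};\gamma_{3})}\phi=d$.
   Context: $(a)_n$ is the Pochhammer symbol. The integral operator is $$\left(\mathfrak{E}_{\frac{\gamma_{1}+1}{2};\gamma_{2};\gamma_{3};p,q,\upsilon,w_{1},w_{2};a_{1}^{+},b_{1}^{+}}^{(\gamma_1;\gamma_2;\gamma_3)}d\right)(z,t)=\int_{b_1}^{t}\int_{a_1}^{z}(t-y)^{q-1}(z-\xi)^{p-1}E_{\frac{\gamma_{1}+1}{2},\gamma_{2},\gamma_{3};p;q;\upsilon}^{(\gamma_{1};\gamma_{2};\gamma_{3})}(w_{1}(z-\xi),w_{2}(t-y))\,d(\xi,y)\,d\xi\,dy,$$ with kernel the modified I-Konhauser Mittag-Leffler function in which equal parameters are cancelled before substituting values, i.e. for all complex $\gamma_1,\gamma_2,\gamma_3$ $$E_{\frac{\gamma_{1}+1}{2},\gamma_{2},\gamma_{3};p;q;\upsilon}^{(\gamma_{1};\gamma_{2};\gamma_{3})}(z,t)=\sum_{l=0}^{\infty}\sum_{n=0}^{\infty}\frac{(-4)^{l}\left(\frac{\gamma_{1}}{2}\right)_{l}(\gamma_{2}+l)_{n}\,z^{l}t^{\upsilon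 n}}{\Gamma(p+l)\,\Gamma(q+\upsilon n)\,n!\,l!}.$$ For $s>0$, $(w_2s)^{\upsilon n}$ means $(w_2^{\upsilon})^n s^{\upsilon n}$ with a fixed choice of $w_2^\upsilon$ (and $w_2^{\upsilon}=0$ if $w_2=0$). The double fractional integral is $({}_{t}\mathbb{I}_{b_1^{+}}^{\beta}\,{}_{z}\mathbb{I}_{a_1^{+}}^{\alpha}h)(z,t)=\frac{1}{\Gamma(\alpha)\Gamma(\beta)}\int_{b_1}^t\int_{a_1}^z(z-\xi)^{\alpha-1}(t-y)^{\beta-1}h(\xi,y)\,d\xi\,dy$ and the double fractional derivative is ${}_{t}D_{b_1^{+}}^{\beta}\,{}_{z}D_{a_1^{+}}^{\alpha}h=\left(\frac{\partial}{\partial t}\right)^{s}\left(\frac{\partial}{\partial z}\right)^{k}\,{}_{z}\mathbb{I}_{a_1^{+}}^{k-\alpha}\,{}_{t}\mathbb{I}_{b_1^{+}}^{s-\beta}h$ with $s=[\operatorname{Re}\beta]+1$, $k=[\operatorname{Re}\alpha]+1$. $L((a_1,a_2)\times(b_1,b_2))$ is the space of Lebesgue integrable functions on the rectangle; equalities are almost everywhere. *)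

theory Defs
  imports "HOL-Analysis.Analysis"
begin

text \<open>Functions of two real variables are curried. Integrals are Lebesgue integrals with respect
  to the complete measure \<^term>\<open>lebesgue\<close>, so representatives of integrable functions need not be
  Borel.\<close>

text \<open>\<open>W\<close> is one of the values of the complex power \<open>w\<^sup>\<upsilon>\<close>: any branch of the logarithm of \<open>w\<close>
  is allowed.\<close>

definition is_power_value :: "complex \<Rightarrow> complex \<Rightarrow> complex \<Rightarrow> bool" where
  "is_power_value w \<upsilon> W \<longleftrightarrow>
     (if w = 0 then W = 0 else (\<exists>L. exp L = w \<and> W = exp (\<upsilon> * L)))"

text \<open>The value of the modified I-Konhauser Mittag-Leffler function at \<open>(w\<^sub>1 x, w\<^sub>2 y)\<close> for real
  \<open>x, y > 0\<close>, where \<open>W\<close> is the chosen value of \<open>w\<^sub>2\<^sup>\<upsilon>\<close>. The parameter \<open>\<gamma>\<^sub>3\<close> (and the lower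
  parameters \<open>(\<gamma>\<^sub>1 + 1)/2, \<gamma>\<^sub>2, \<gamma>\<^sub>3\<close>) cancel from the series; for instance
  \<open>(\<gamma>\<^sub>1)\<^sub>2\<^sub>l / ((\<gamma>\<^sub>1 + 1)/2)\<^sub>l = 4\<^sup>l (\<gamma>\<^sub>1/2)\<^sub>l\<close>. The power \<open>y\<^sup>\<upsilon>\<^sup>n\<close> uses the real logarithm of \<open>y\<close>.\<close>

definition IK_kernel ::
  "complex \<Rightarrow> complex \<Rightarrow> complex \<Rightarrow> complex \<Rightarrow> complex \<Rightarrow> complex \<Rightarrow> complex \<Rightarrow> complex
     \<Rightarrow> real \<Rightarrow> real \<Rightarrow> complex" where
  "IK_kernel \<gamma>1 \<gamma>2 \<gamma>3 p q \<upsilon> w1 W x y =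
     (\<Sum>l. \<Sum>n. (-4) ^ l * pochhammer (\<gamma>1 / 2) l * pochhammer (\<gamma>2 + of_nat l) n
          * (w1 * of_real x) ^ l * (W ^ n * of_real y powr (\<upsilon> * of_nat n))
          / (Gamma (p + of_nat l) * Gamma (q + \<upsilon> * of_nat n) * fact n * fact l))"

definition IK_operator ::
  "complex \<Rightarrow> complex \<Rightarrow> complex \<Rightarrow> complex \<Rightarrow> complex \<Rightarrow> complex \<Rightarrow> complex \<Rightarrow> complex
     \<Rightarrow> real \<Rightarrow> real \<Rightarrow> (real \<Rightarrow> real \<Rightarrow> complex) \<Rightarrow> real \<Rightarrow> real \<Rightarrow> complex" where
  "IK_operator \<gamma>1 \<gamma>2 \<gamma>3 p q \<upsilon> w1 W a1 b1 d z t =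
     (LINT y:{b1<..<t}|lebesgue. LINT \<xi>:{a1<..<z}|lebesgue.
        of_real (t - y) powr (q - 1) * of_real (z - \<xi>) powr (p - 1)
        * IK_kernel \<gamma>1 \<gamma>2 \<gamma>3 p q \<upsilon> w1 W (z - \<xi>) (t - y) * d \<xi> y)"

definition frac_integral :: "real \<Rightarrow> complex \<Rightarrow> (real \<Rightarrow> complex) \<Rightarrow> real \<Rightarrow> complex" where
  "frac_integral a \<alpha> f x =
     (LINT \<xi>:{a<..<x}|lebesgue. of_real (x - \<xi>) powr (\<alpha> - 1) * f \<xi>) / Gamma \<alpha>"

definition frac_integral_z ::
  "real \<Rightarrow> complex \<Rightarrow> (real \<Rightarrow> real \<Rightarrow> complex) \<Rightarrow> real \<Rightarrow> real \<Rightarrow> complex" where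
  "frac_integral_z a \<alpha> h = (\<lambda>z t. frac_integral a \<alpha> (\<lambda>\<xi>. h \<xi> t) z)"

definition frac_integral_t ::
  "real \<Rightarrow> complex \<Rightarrow> (real \<Rightarrow> real \<Rightarrow> complex) \<Rightarrow> real \<Rightarrow> real \<Rightarrow> complex" where
  "frac_integral_t b \<beta> h = (\<lambda>z t. frac_integral b \<beta> (\<lambda>y. h z y) t)"

definition nth_deriv :: "nat \<Rightarrow> (real \<Rightarrow> complex) \<Rightarrow> real \<Rightarrow> complex" where
  "nth_deriv n f = ((\<lambda>g x. vector_derivative g (at x)) ^^ n) f"

text \<open>\<^term>\<open>vector_derivative\<close> is unspecified at points of non-differentiability; the next predicate
  says that \<open>nth_deriv n f x\<close> is a genuine \<open>n\<close>-th derivative.\<close>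

primrec nth_differentiable :: "nat \<Rightarrow> (real \<Rightarrow> complex) \<Rightarrow> real \<Rightarrow> bool" where
  "nth_differentiable 0 f x \<longleftrightarrow> True"
| "nth_differentiable (Suc n) f x \<longleftrightarrow>
     (\<forall>\<^sub>F y in nhds x. nth_differentiable n f y) \<and> nth_deriv n f differentiable at x"

definition frac_order :: "complex \<Rightarrow> nat" where
  "frac_order \<alpha> = nat (\<lfloor>Re \<alpha>\<rfloor> + 1)"

definition frac_deriv_potential ::
  "real \<Rightarrow> real \<Rightarrow> complex \<Rightarrow> complex \<Rightarrow> (real \<Rightarrow> real \<Rightarrow> complex) \<Rightarrow> real \<Rightarrow> real \<Rightarrow> complex" where
  "frac_deriv_potential a b \<alpha> \<beta> h =
     frac_integral_z a (of_nat (frac_order \<alpha>) - \<alpha>)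
       (frac_integral_t b (of_nat (frac_order \<beta>) - \<beta>) h)"

text \<open>The operator \<open>\<^sub>tD\<^sup>\<beta> \<^sub>zD\<^sup>\<alpha>\<close> with base points \<open>b\<close> in \<open>t\<close> and \<open>a\<close> in \<open>z\<close>:\<close>

definition frac_deriv2 ::
  "real \<Rightarrow> real \<Rightarrow> complex \<Rightarrow> complex \<Rightarrow> (real \<Rightarrow> real \<Rightarrow> complex) \<Rightarrow> real \<Rightarrow> real \<Rightarrow> complex" where
  "frac_deriv2 a b \<alpha> \<beta> h z t =
     nth_deriv (frac_order \<beta>)
       (\<lambda>t'. nth_deriv (frac_order \<alpha>) (\<lambda>z'. frac_deriv_potential a b \<alpha> \<beta> h z' t') z) t"

text \<open>All the derivatives used in \<open>frac_deriv2 a b \<alpha> \<beta> h z t\<close> exist: the ones in \<open>z\<close> at \<open>(z, t')\<close>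
  for all \<open>t'\<close> near \<open>t\<close>, and then the ones in \<open>t\<close> at \<open>(z, t)\<close>.\<close>

definition frac_deriv2_exists ::
  "real \<Rightarrow> real \<Rightarrow> complex \<Rightarrow> complex \<Rightarrow> (real \<Rightarrow> real \<Rightarrow> complex) \<Rightarrow> real \<Rightarrow> real \<Rightarrow> bool" where
  "frac_deriv2_exists a b \<alpha> \<beta> h z t \<longleftrightarrow>
     (\<forall>\<^sub>F t' in nhds t.
        nth_differentiable (frac_order \<alpha>) (\<lambda>z'. frac_deriv_potential a b \<alpha> \<beta> h z' t') z) \<and>
     nth_differentiable (frac_order \<beta>)
       (\<lambda>t'. nth_deriv (frac_order \<alpha>) (\<lambda>z'. frac_deriv_potential a b \<alpha> \<beta> h z' t') z) t"

definition IK_left_inverse ::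
  "complex \<Rightarrow> complex \<Rightarrow> complex \<Rightarrow> complex \<Rightarrow> complex \<Rightarrow> complex \<Rightarrow> complex \<Rightarrow> complex
     \<Rightarrow> complex \<Rightarrow> complex \<Rightarrow> real \<Rightarrow> real \<Rightarrow> (real \<Rightarrow> real \<Rightarrow> complex) \<Rightarrow> real \<Rightarrow> real \<Rightarrow> complex" where
  "IK_left_inverse \<gamma>1 \<gamma>2 \<gamma>3 p q \<sigma> \<tau> \<upsilon> w1 W a1 b1 \<phi> =
     frac_deriv2 a1 b1 (p + \<sigma>) (q + \<tau>)
       (IK_operator (- \<gamma>1) (- \<gamma>2) (- \<gamma>3) p q \<upsilon> w1 W a1 b1 \<phi>)"

definition IK_left_inverse_exists ::
  "complex \<Rightarrow> complex \<Rightarrow> complex \<Rightarrow> complex \<Rightarrow> complex \<Rightarrow> complex \<Rightarrow> complex \<Rightarrow> complex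
     \<Rightarrow> complex \<Rightarrow> complex \<Rightarrow> real \<Rightarrow> real \<Rightarrow> (real \<Rightarrow> real \<Rightarrow> complex) \<Rightarrow> real \<Rightarrow> real \<Rightarrow> bool" where
  "IK_left_inverse_exists \<gamma>1 \<gamma>2 \<gamma>3 p q \<sigma> \<tau> \<upsilon> w1 W a1 b1 \<phi> =
     frac_deriv2_exists a1 b1 (p + \<sigma>) (q + \<tau>)
       (IK_operator (- \<gamma>1) (- \<gamma>2) (- \<gamma>3) p q \<upsilon> w1 W a1 b1 \<phi>)"

end

theory Submission
  imports Defs
begin

text \<open>Write \<open>e\<^sub>a(x) = x powr (a - 1) / \<Gamma>(a)\<close> for \<open>x > 0\<close> and \<open>e\<^sub>a(x) = 0\<close> otherwise, so that convolution
with \<open>e\<^sub>a\<close> is the Riemann-Liouville integral of order \<open>a\<close>. Multiplied by its two power factors, the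
kernel of the integral operator with parameters \<open>\<gamma>\<^sub>1, \<gamma>\<^sub>2; p, q\<close> is the double series
\<open>\<Sum>\<^sub>l \<Sum>\<^sub>n c(l, n) e\<^sub>p\<^sub>+\<^sub>l(x) e\<^sub>q\<^sub>+\<^sub>\<upsilon>\<^sub>n(y)\<close>, and the operator is convolution with it in the plane. Since
\<open>e\<^sub>a * e\<^sub>b = e\<^sub>a\<^sub>+\<^sub>b\<close> (the complex Beta integral, \<open>convolution_power_kernel\<close>), convolving two such
kernels amounts to multiplying two double power series in the formal variables that raise \<open>l\<close> and
\<open>n\<close>. With \<open>U\<close> and \<open>V\<close> for these variables times \<open>w\<^sub>1\<close> and \<open>W\<close>, the closed form of the series of \<open>c\<close>
is \<open>(1 - V) powr (- \<gamma>\<^sub>2) * (1 + 4 U / (1 - V)) powr (- \<gamma>\<^sub>1 / 2)\<close>, so changing the signs of \<open>\<gamma>\<^sub>1\<close> and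
\<open>\<gamma>\<^sub>2\<close> gives the reciprocal series; on the level of coefficients this is Vandermonde's identity used
twice (\<open>IK_coeff_inverse\<close>). Hence the kernels with parameters \<open>-\<gamma>; p, q\<close> and \<open>\<gamma>; \<sigma>, \<tau>\<close> convolve to
the single product \<open>e\<^sub>p\<^sub>+\<^sub>\<sigma>(x) e\<^sub>q\<^sub>+\<^sub>\<tau>(y)\<close> (\<open>convolution_IK_series\<close>), and the composition of the two
operators is the double fractional integral of orders \<open>p + \<sigma>\<close> and \<open>q + \<tau>\<close>.

The fractional derivative first integrates fractionally up to the integer orders \<open>k\<close> and \<open>s\<close>,
which gives the convolution of \<open>d\<close> with \<open>e\<^sub>k(x) e\<^sub>s(y)\<close>. This identity holds at every point of the
rectangle and not only almost everywhere: the absolute values of all kernels are bounded by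
products of real power kernels, and the exponents add up to \<open>k, s \<ge> 1\<close>, where the power kernels
are locally bounded. It remains to differentiate \<open>k\<close> times in \<open>z\<close> and \<open>s\<close> times in \<open>t\<close>. All
derivatives but the last in each variable are classical; the last ones come from Lebesgue's
differentiation theorem (\<open>AE_primitive_has_vector_derivative\<close>), proved here from Vitali's covering
lemma and the outer regularity of finite Borel measures. The derivatives in \<open>z\<close> have to exist at a
fixed \<open>z\<close> simultaneously for all \<open>t\<close> near a given one, so one null set of \<open>z\<close> must serve
uncountably many functions. It is found from the rational \<open>t\<close>, because the integrals over \<open>y\<close>
differ for neighbouring \<open>t\<close> by at most a difference of values of a continuous monotone function of
\<open>t\<close> (\<open>slice_deriv_at\<close>).\<close>

section \<open>Convolution\<close>

definition convolution :: "('a::euclidean_space \<Rightarrow> complex) \<Rightarrow> ('a \<Rightarrow> complex) \<Rightarrow> 'a \<Rightarrow> complex"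
  where "convolution f g x = (\<integral>u. f (x - u) * g u \<partial>lborel)"

definition nn_convolution :: "('a::euclidean_space \<Rightarrow> ennreal) \<Rightarrow> ('a \<Rightarrow> ennreal) \<Rightarrow> 'a \<Rightarrow> ennreal"
  where "nn_convolution f g x = (\<integral>\<^sup>+u. f (x - u) * g u \<partial>lborel)"

abbreviation enorm :: "('a \<Rightarrow> complex) \<Rightarrow> 'a \<Rightarrow> ennreal"
  where "enorm f \<equiv> (\<lambda>x. ennreal (norm (f x)))"

lemma borel_measurable_convolution [measurable]:
  assumes [measurable]: "f \<in> borel_measurable borel" "g \<in> borel_measurable borel"
  shows "convolution f g \<in> borel_measurable borel"
  unfolding convolution_def[abs_def] by measurable

lemma borel_measurable_nn_convolution [measurable]:
  assumes [measurable]: "f \<in> borel_measurable borel" "g \<in> borel_measurable borel"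
  shows "nn_convolution f g \<in> borel_measurable borel"
  unfolding nn_convolution_def[abs_def] by measurable

lemma nn_integral_lborel_translate:
  fixes f :: "'a::euclidean_space \<Rightarrow> ennreal"
  assumes [measurable]: "f \<in> borel_measurable borel"
  shows "(\<integral>\<^sup>+u. f (u - v) \<partial>lborel) = (\<integral>\<^sup>+u. f u \<partial>lborel)"
proof -
  have "(\<integral>\<^sup>+u. f u \<partial>lborel) = (\<integral>\<^sup>+u. f u \<partial>distr lborel borel ((+) (- v)))"
    by (simp add: lborel_distr_plus)
  also have "\<dots> = (\<integral>\<^sup>+u. f (u - v) \<partial>lborel)"
    by (subst nn_integral_distr) auto
  finally show ?thesis by simp
qed

lemma integral_lborel_translate:
  fixes f :: "'a::euclidean_space \<Rightarrow> complex"
  assumes [measurable]: "f \<in> borel_measurable borel"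
  shows "(\<integral>u. f (u - v) \<partial>lborel) = (\<integral>u. f u \<partial>lborel)"
proof -
  have "(\<integral>u. f u \<partial>lborel) = (\<integral>u. f u \<partial>distr lborel borel ((+) (- v)))"
    by (simp add: lborel_distr_plus)
  also have "\<dots> = (\<integral>u. f (u - v) \<partial>lborel)"
    by (subst integral_distr) auto
  finally show ?thesis by simp
qed

text \<open>Tonelli's theorem and translation invariance. For nonnegative functions there is no convergence
condition, so all finiteness questions below are settled by regrouping on this side.\<close>

lemma nn_convolution_assoc:
  fixes f g h :: "'a::euclidean_space \<Rightarrow> ennreal"
  assumes [measurable]: "f \<in> borel_measurable borel" "g \<in> borel_measurable borel" "h \<in> borel_measurable borel"
  shows "nn_convolution f (nn_convolution g h) x = nn_convolution (nn_convolution f g) h x"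
proof -
  have "nn_convolution f (nn_convolution g h) x =
      (\<integral>\<^sup>+u. \<integral>\<^sup>+v. f (x - u) * (g (u - v) * h v) \<partial>lborel \<partial>lborel)"
    unfolding nn_convolution_def by (subst nn_integral_cmult) auto
  also have "\<dots> = (\<integral>\<^sup>+v. \<integral>\<^sup>+u. f (x - u) * (g (u - v) * h v) \<partial>lborel \<partial>lborel)"
    by (rule lborel_pair.Fubini') measurable
  also have "\<dots> = (\<integral>\<^sup>+v. (\<integral>\<^sup>+u. f (x - u) * g (u - v) \<partial>lborel) * h v \<partial>lborel)"
    by (subst nn_integral_multc[symmetric]) (auto simp: mult.assoc)
  also have "\<dots> = (\<integral>\<^sup>+v. nn_convolution f g (x - v) * h v \<partial>lborel)"
  proof (intro nn_integral_cong arg_cong2[where f="(*)"] refl)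
    fix v
    show "(\<integral>\<^sup>+u. f (x - u) * g (u - v) \<partial>lborel) = nn_convolution f g (x - v)"
      using nn_integral_lborel_translate[of "\<lambda>u. f (x - v - u) * g u" v]
      by (simp add: nn_convolution_def)
  qed
  finally show ?thesis by (simp add: nn_convolution_def)
qed

lemma nn_convolution_mono:
  assumes "\<And>x. f x \<le> f' x" "\<And>x. g x \<le> g' x"
  shows "nn_convolution f g x \<le> nn_convolution f' g' x"
  unfolding nn_convolution_def using assms by (intro nn_integral_mono mult_mono) auto

text \<open>If the integral that defines the convolution diverges, its value is \<open>0\<close> and the bound is trivial.\<close>

lemma enorm_convolution_le:
  assumes [measurable]: "f \<in> borel_measurable borel" "g \<in> borel_measurable borel"
  shows "enorm (convolution f g) x \<le> nn_convolution (enorm f) (enorm g) x"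
proof (cases "integrable lborel (\<lambda>u. f (x - u) * g u)")
  case True
  then show ?thesis
    using integral_norm_bound_ennreal[OF True]
    by (simp add: convolution_def nn_convolution_def norm_mult ennreal_mult)
next
  case False
  then show ?thesis by (simp add: convolution_def not_integrable_integral_eq)
qed

lemma integrable_convolution_integrand:
  assumes [measurable]: "f \<in> borel_measurable borel" "g \<in> borel_measurable borel"
    and "nn_convolution (enorm f) (enorm g) x < \<infinity>"
  shows "integrable lborel (\<lambda>u. f (x - u) * g u)"
  using assms(3) by (intro integrableI_bounded)
    (auto simp: nn_convolution_def norm_mult ennreal_mult)

text \<open>Associativity at a single point. It is needed at points where it is known that the iterated
convolution of the absolute values is finite, and not merely for almost every point.\<close>

lemma convolution_assoc:
  fixes f g h :: "'a::euclidean_space \<Rightarrow> complex"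
  assumes [measurable]: "f \<in> borel_measurable borel" "g \<in> borel_measurable borel" "h \<in> borel_measurable borel"
    and fin: "nn_convolution (enorm f) (nn_convolution (enorm g) (enorm h)) x < \<infinity>"
  shows "convolution f (convolution g h) x = convolution (convolution f g) h x"
proof -
  have int: "integrable (lborel \<Otimes>\<^sub>M lborel) (\<lambda>(u, v). f (x - u) * (g (u - v) * h v))"
  proof (rule integrableI_bounded)
    have "(\<integral>\<^sup>+p. ennreal (norm (case p of (u, v) \<Rightarrow> f (x - u) * (g (u - v) * h v))) \<partial>(lborel \<Otimes>\<^sub>M lborel))
       = (\<integral>\<^sup>+u. \<integral>\<^sup>+v. ennreal (norm (f (x - u))) * (ennreal (norm (g (u - v))) * ennreal (norm (h v))) \<partial>lborel \<partial>lborel)"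
      by (subst lborel.nn_integral_fst[symmetric]) (auto simp: norm_mult ennreal_mult)
    also have "\<dots> = nn_convolution (enorm f) (nn_convolution (enorm g) (enorm h)) x"
      unfolding nn_convolution_def by (subst nn_integral_cmult) auto
    finally show "(\<integral>\<^sup>+p. ennreal (norm (case p of (u, v) \<Rightarrow> f (x - u) * (g (u - v) * h v))) \<partial>(lborel \<Otimes>\<^sub>M lborel)) < \<infinity>"
      using fin by simp
  qed measurable
  have "convolution f (convolution g h) x = (\<integral>u. \<integral>v. f (x - u) * (g (u - v) * h v) \<partial>lborel \<partial>lborel)"
    unfolding convolution_def by simp
  also have "\<dots> = (\<integral>v. \<integral>u. f (x - u) * (g (u - v) * h v) \<partial>lborel \<partial>lborel)"
    using lborel_pair.Fubini_integral[OF int] by simp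
  also have "\<dots> = (\<integral>v. (\<integral>u. f (x - u) * g (u - v) \<partial>lborel) * h v \<partial>lborel)"
    by (subst integral_mult_left_zero[symmetric]) (auto simp: mult.assoc)
  also have "\<dots> = (\<integral>v. convolution f g (x - v) * h v \<partial>lborel)"
  proof (intro Bochner_Integration.integral_cong arg_cong2[where f="(*)"] refl)
    fix v
    show "(\<integral>u. f (x - u) * g (u - v) \<partial>lborel) = convolution f g (x - v)"
      using integral_lborel_translate[of "\<lambda>u. f (x - v - u) * g u" v]
      by (simp add: convolution_def)
  qed
  finally show ?thesis by (simp add: convolution_def)
qed

section \<open>Power kernels and the Beta integral\<close>

text \<open>The kernel of the Riemann-Liouville integral of order \<open>a\<close>, extended by zero to the whole line so
that fractional integrals become convolutions on the line.\<close>

definition power_kernel :: "complex \<Rightarrow> real \<Rightarrow> complex"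
  where "power_kernel a x = (if x > 0 then of_real x powr (a - 1) / Gamma a else 0)"

text \<open>The real majorant of the power kernel, without the Gamma factor.\<close>

definition pos_power :: "real \<Rightarrow> real \<Rightarrow> real"
  where "pos_power a x = (if x > 0 then x powr (a - 1) else 0)"

lemma pos_power_nonneg [simp]: "pos_power a x \<ge> 0"
  by (simp add: pos_power_def)

lemma borel_measurable_pos_power [measurable]: "pos_power a \<in> borel_measurable borel"
  unfolding pos_power_def[abs_def] by measurable

text \<open>In this form the measurability of the complex power is visible.\<close>

lemma power_kernel_exp:
  "power_kernel a x = (if x > 0 then exp ((a - 1) * of_real (ln x)) / Gamma a else 0)"
  by (simp add: power_kernel_def powr_def Ln_of_real)

lemma borel_measurable_power_kernel [measurable]: "power_kernel a \<in> borel_measurable borel"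
  unfolding power_kernel_exp[abs_def] by measurable

lemma norm_power_kernel: "norm (power_kernel a x) = pos_power (Re a) x / norm (Gamma a)"
  by (auto simp: power_kernel_def pos_power_def norm_divide norm_powr_real_powr)

lemma enorm_power_kernel:
  "ennreal (norm (power_kernel a x)) = ennreal (1 / norm (Gamma a)) * ennreal (pos_power (Re a) x)"
  unfolding norm_power_kernel by (subst ennreal_mult[symmetric]) auto

lemma power_kernel_mult:
  assumes "x > 0"
  shows "power_kernel a (x * y) = of_real x powr (a - 1) * power_kernel a y"
proof (cases "y > 0")
  case True
  have "of_real (x * y) powr (a - 1) = complex_of_real x powr (a - 1) * of_real y powr (a - 1)"
    using assms True by (simp add: powr_times_real)
  then show ?thesis using assms True by (simp add: power_kernel_def)
next
  case False
  then show ?thesis using assms by (simp add: power_kernel_def zero_less_mult_iff)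
qed

lemma pos_power_mult:
  assumes "x > 0"
  shows "pos_power a (x * y) = x powr (a - 1) * pos_power a y"
  using assms by (auto simp: pos_power_def zero_less_mult_iff powr_mult)

lemma Gamma_nonzero_Re_pos: "Re a > 0 \<Longrightarrow> Gamma a \<noteq> (0::complex)"
  by (auto simp: Gamma_eq_zero_iff elim!: nonpos_Ints_cases)

text \<open>Euler's integral for the Gamma function, normalised to \<open>1\<close>.\<close>

lemma power_kernel_exp_integral:
  assumes a: "Re a > 0"
  shows "has_bochner_integral lborel (\<lambda>x. power_kernel a x * of_real (exp (- x))) 1"
proof -
  let ?g = "\<lambda>t. complex_of_real t powr (a - 1) / of_real (exp t)"
  let ?f = "\<lambda>x. indicator {0<..} x *\<^sub>R ?g x"
  have eq: "?f x = Gamma a * (power_kernel a x * of_real (exp (- x)))" for x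
    using Gamma_nonzero_Re_pos[OF a]
    by (auto simp: power_kernel_def indicator_def exp_minus divide_inverse exp_of_real[symmetric])
  have [measurable]: "?f \<in> borel_measurable borel"
    unfolding eq by measurable
  have ai: "?g absolutely_integrable_on {0<..}"
    by (rule absolutely_integrable_Gamma_integral'[OF a])
  then have "integrable lebesgue ?f"
    by (simp add: set_integrable_def)
  then have int: "integrable lborel ?f"
    by (subst (asm) integrable_completion) auto
  have "(\<integral>x. ?f x \<partial>lborel) = (\<integral>x. ?f x \<partial>lebesgue)"
    by (rule integral_completion[symmetric]) measurable
  also have "\<dots> = integral {0<..} ?g"
    using set_lebesgue_integral_eq_integral(2)[OF ai] by (simp add: set_lebesgue_integral_def)
  also have "\<dots> = Gamma a"
    by (rule integral_unique[OF Gamma_integral_complex'[OF a]])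
  finally have "has_bochner_integral lborel ?f (Gamma a)"
    using int by (simp add: has_bochner_integral_iff)
  then have "has_bochner_integral lborel (\<lambda>x. inverse (Gamma a) * ?f x) (inverse (Gamma a) * Gamma a)"
    by (rule has_bochner_integral_mult_right)
  moreover have "(\<lambda>x. inverse (Gamma a) * ?f x) = (\<lambda>x. power_kernel a x * of_real (exp (- x)))"
    using Gamma_nonzero_Re_pos[OF a] unfolding eq by auto
  ultimately show ?thesis
    using Gamma_nonzero_Re_pos[OF a] by simp
qed

lemma pos_power_exp_nn_integral:
  assumes a: "a > 0"
  shows "(\<integral>\<^sup>+x. ennreal (pos_power a x) * ennreal (exp (- x)) \<partial>lborel) = ennreal (Gamma a)"
proof -
  have G: "Gamma (complex_of_real a) = complex_of_real (Gamma a)" "Gamma a > 0"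
    using a by (simp_all add: Gamma_complex_of_real Gamma_real_pos)
  have eq: "Re (Gamma a *\<^sub>R (power_kernel (of_real a) x * of_real (exp (- x)))) = pos_power a x * exp (- x)" for x
  proof (cases "x > 0")
    case True
    then have "complex_of_real x powr (of_real a - 1) = of_real (x powr (a - 1))"
      using powr_of_real[of x "a - 1"] by simp
    then have "Gamma a *\<^sub>R (power_kernel (of_real a) x * of_real (exp (- x)))
        = complex_of_real (Gamma a * (x powr (a - 1) / Gamma a * exp (- x)))"
      using G True by (simp add: power_kernel_def scaleR_conv_of_real del: of_real_exp)
    then show ?thesis using G True by (simp add: pos_power_def del: of_real_mult)
  qed (simp add: power_kernel_def pos_power_def)
  have "has_bochner_integral lborel (\<lambda>x. Gamma a *\<^sub>R (power_kernel (of_real a) x * of_real (exp (- x)))) (Gamma a *\<^sub>R 1)"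
    using a by (intro has_bochner_integral_scaleR_right power_kernel_exp_integral) auto
  from has_bochner_integral_Re[OF this]
  have "has_bochner_integral lborel (\<lambda>x. pos_power a x * exp (- x)) (Gamma a)"
    unfolding eq by simp
  then have "(\<integral>\<^sup>+x. ennreal (pos_power a x * exp (- x)) \<partial>lborel) = ennreal (Gamma a)"
    by (intro nn_integral_eq_integral[THEN trans])
      (auto simp: has_bochner_integral_iff)
  then show ?thesis by (simp add: ennreal_mult)
qed

lemma nn_integral_nn_convolution:
  fixes f g :: "'a::euclidean_space \<Rightarrow> ennreal"
  assumes [measurable]: "f \<in> borel_measurable borel" "g \<in> borel_measurable borel"
  shows "(\<integral>\<^sup>+x. nn_convolution f g x \<partial>lborel) = (\<integral>\<^sup>+x. f x \<partial>lborel) * (\<integral>\<^sup>+x. g x \<partial>lborel)"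
proof -
  have "(\<integral>\<^sup>+x. nn_convolution f g x \<partial>lborel) = (\<integral>\<^sup>+u. \<integral>\<^sup>+x. f (x - u) * g u \<partial>lborel \<partial>lborel)"
    unfolding nn_convolution_def by (rule lborel_pair.Fubini') measurable
  also have "\<dots> = (\<integral>\<^sup>+u. (\<integral>\<^sup>+x. f x \<partial>lborel) * g u \<partial>lborel)"
    by (simp add: nn_integral_multc nn_integral_lborel_translate)
  finally show ?thesis by (simp add: nn_integral_cmult)
qed

lemma integral_convolution:
  fixes f g :: "'a::euclidean_space \<Rightarrow> complex"
  assumes f: "integrable lborel f" and g: "integrable lborel g"
  shows "(\<integral>x. convolution f g x \<partial>lborel) = (\<integral>x. f x \<partial>lborel) * (\<integral>x. g x \<partial>lborel)"
proof -
  have [measurable]: "f \<in> borel_measurable borel" "g \<in> borel_measurable borel"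
    using f g by auto
  have fin: "(\<integral>\<^sup>+x. nn_convolution (enorm f) (enorm g) x \<partial>lborel) < \<infinity>"
    using f g by (subst nn_integral_nn_convolution)
      (auto simp: integrable_iff_bounded ennreal_mult_less_top)
  have int: "integrable (lborel \<Otimes>\<^sub>M lborel) (\<lambda>(x, u). f (x - u) * g u)"
  proof (rule integrableI_bounded)
    have "(\<integral>\<^sup>+p. ennreal (norm (case p of (x, u) \<Rightarrow> f (x - u) * g u)) \<partial>(lborel \<Otimes>\<^sub>M lborel))
       = (\<integral>\<^sup>+x. nn_convolution (enorm f) (enorm g) x \<partial>lborel)"
      by (subst lborel.nn_integral_fst[symmetric]) (auto simp: norm_mult ennreal_mult nn_convolution_def[abs_def])
    then show "(\<integral>\<^sup>+p. ennreal (norm (case p of (x, u) \<Rightarrow> f (x - u) * g u)) \<partial>(lborel \<Otimes>\<^sub>M lborel)) < \<infinity>"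
      using fin by simp
  qed measurable
  have "(\<integral>x. convolution f g x \<partial>lborel) = (\<integral>u. \<integral>x. f (x - u) * g u \<partial>lborel \<partial>lborel)"
    unfolding convolution_def using lborel_pair.Fubini_integral[OF int] by simp
  also have "\<dots> = (\<integral>u. (\<integral>x. f x \<partial>lborel) * g u \<partial>lborel)"
    by (simp add: integral_lborel_translate)
  finally show ?thesis by simp
qed

text \<open>The real Beta integral. By scaling, the convolution is a multiple \<open>c\<close> of the power with the sum of
the exponents. Multiplication by \<open>exp (- x)\<close> commutes with convolution, so the constant is found
by integrating both sides against it: the left-hand side gives \<open>\<Gamma>(a) \<Gamma>(b)\<close> and the right-hand side
\<open>c \<Gamma>(a + b)\<close>. In particular \<open>c\<close> is finite.\<close>

lemma nn_convolution_pos_power: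
  assumes a: "a > 0" and b: "b > 0"
  shows "nn_convolution (pos_power a) (pos_power b) x =
    ennreal (Gamma a * Gamma b / Gamma (a + b)) * ennreal (pos_power (a + b) x)"
proof -
  define c where "c = (\<integral>\<^sup>+v. ennreal (pos_power a (1 - v)) * ennreal (pos_power b v) \<partial>lborel)"
  have conv: "nn_convolution (pos_power a) (pos_power b) x = c * ennreal (pos_power (a + b) x)" for x
  proof (cases "x > 0")
    case False
    then have "ennreal (pos_power a (x - u)) * ennreal (pos_power b u) = 0" for u
      by (auto simp: pos_power_def)
    then have "nn_convolution (pos_power a) (pos_power b) x = 0"
      unfolding nn_convolution_def by (simp only: nn_integral_const mult_zero_left)
    with False show ?thesis by (simp add: pos_power_def)
  next
    case True
    have "nn_convolution (pos_power a) (pos_power b) x =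
       ennreal x * (\<integral>\<^sup>+v. ennreal (pos_power a (x * (1 - v))) * ennreal (pos_power b (x * v)) \<partial>lborel)"
      unfolding nn_convolution_def using True
      by (subst nn_integral_real_affine[where c=x and t=0]) (auto simp: right_diff_distrib)
    also have "\<dots> = ennreal x * (\<integral>\<^sup>+v. ennreal (x powr (a - 1) * x powr (b - 1)) *
        (ennreal (pos_power a (1 - v)) * ennreal (pos_power b v)) \<partial>lborel)"
      unfolding pos_power_mult[OF True] by (simp add: ennreal_mult mult_ac)
    also have "\<dots> = ennreal (x * (x powr (a - 1) * x powr (b - 1))) * c"
      unfolding c_def using True by (subst nn_integral_cmult) (auto simp: ennreal_mult mult_ac)
    also have "x * (x powr (a - 1) * x powr (b - 1)) = pos_power (a + b) x"
    proof -
      have "x * (x powr (a - 1) * x powr (b - 1)) = x powr 1 * (x powr (a - 1) * x powr (b - 1))"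
        using True by simp
      also have "\<dots> = x powr (a + b - 1)"
        unfolding powr_add[symmetric] by (simp add: algebra_simps)
      finally show ?thesis using True by (simp add: pos_power_def)
    qed
    finally show ?thesis by (simp add: mult.commute)
  qed
  let ?E = "\<lambda>x. ennreal (exp (- x))"
  have "nn_convolution (\<lambda>x. ennreal (pos_power a x) * ?E x) (\<lambda>x. ennreal (pos_power b x) * ?E x) x
      = c * (ennreal (pos_power (a + b) x) * ?E x)" for x
  proof -
    have "?E (x - u) * ?E u = ?E x" for u
      by (simp add: ennreal_mult[symmetric] exp_add[symmetric])
    then have "ennreal (pos_power a (x - u)) * ?E (x - u) * (ennreal (pos_power b u) * ?E u)
        = ennreal (pos_power a (x - u)) * ennreal (pos_power b u) * ?E x" for u
      by (metis (no_types, lifting) mult.assoc mult.commute)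
    then have "nn_convolution (\<lambda>x. ennreal (pos_power a x) * ?E x) (\<lambda>x. ennreal (pos_power b x) * ?E x) x
      = nn_convolution (pos_power a) (pos_power b) x * ?E x"
      by (simp add: nn_convolution_def nn_integral_multc)
    then show ?thesis by (simp add: conv mult.assoc)
  qed
  then have "c * ennreal (Gamma (a + b)) = ennreal (Gamma a) * ennreal (Gamma b)"
    using nn_integral_nn_convolution[of "\<lambda>x. ennreal (pos_power a x) * ?E x" "\<lambda>x. ennreal (pos_power b x) * ?E x"] a b
    by (simp add: nn_integral_cmult pos_power_exp_nn_integral)
  moreover have G: "Gamma a > 0" "Gamma b > 0" "Gamma (a + b) > 0"
    using a b by (auto intro!: Gamma_real_pos)
  ultimately have "c * (ennreal (Gamma (a + b)) * ennreal (1 / Gamma (a + b)))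
      = ennreal (Gamma a) * ennreal (Gamma b) * ennreal (1 / Gamma (a + b))"
    by (metis mult.assoc)
  then have "c = ennreal (Gamma a * Gamma b / Gamma (a + b))"
    using G by (simp add: ennreal_mult[symmetric])
  with conv show ?thesis by simp
qed

text \<open>The semigroup law of fractional integration, that is, the Beta integral with complex parameters.
The argument is the one for real powers: scaling determines the convolution up to a constant, and
the integral against \<open>exp (- x)\<close>, which is \<open>1\<close> for every power kernel, shows that the constant is
\<open>1\<close>.\<close>

lemma convolution_power_kernel:
  assumes a: "Re a > 0" and b: "Re b > 0"
  shows "convolution (power_kernel a) (power_kernel b) = power_kernel (a + b)"
proof -
  have ab: "Re (a + b) > 0" using a b by simp
  define c where "c = (\<integral>v. power_kernel a (1 - v) * power_kernel b v \<partial>lborel) * Gamma (a + b)"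
  have conv: "convolution (power_kernel a) (power_kernel b) x = c * power_kernel (a + b) x" for x
  proof (cases "x > 0")
    case False
    then have "power_kernel a (x - u) * power_kernel b u = 0" for u
      by (auto simp: power_kernel_def)
    then have "convolution (power_kernel a) (power_kernel b) x = 0"
      unfolding convolution_def by (simp only: Bochner_Integration.integral_zero)
    with False show ?thesis by (simp add: power_kernel_def)
  next
    case True
    have "convolution (power_kernel a) (power_kernel b) x =
       x *\<^sub>R (\<integral>v. power_kernel a (x * (1 - v)) * power_kernel b (x * v) \<partial>lborel)"
      unfolding convolution_def using True
      by (subst lborel_integral_real_affine[where c=x and t=0]) (auto simp: right_diff_distrib)
    also have "\<dots> = x *\<^sub>R (\<integral>v. (of_real x powr (a - 1) * of_real x powr (b - 1)) *
        (power_kernel a (1 - v) * power_kernel b v) \<partial>lborel)"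
      unfolding power_kernel_mult[OF True] by (simp add: mult_ac)
    also have "\<dots> = (of_real x * (of_real x powr (a - 1) * of_real x powr (b - 1))) *
        (\<integral>v. power_kernel a (1 - v) * power_kernel b v \<partial>lborel)"
      by (subst integral_mult_right_zero) (simp add: scaleR_conv_of_real mult.assoc)
    also have "of_real x * (of_real x powr (a - 1) * of_real x powr (b - 1)) = Gamma (a + b) * power_kernel (a + b) x"
    proof -
      have "complex_of_real x * (of_real x powr (a - 1) * of_real x powr (b - 1))
          = of_real x powr 1 * (of_real x powr (a - 1) * of_real x powr (b - 1))"
        using True by simp
      also have "\<dots> = of_real x powr (a + b - 1)"
        unfolding powr_add[symmetric] by (simp add: algebra_simps)
      finally show ?thesis using True Gamma_nonzero_Re_pos[OF ab] by (simp add: power_kernel_def)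
    qed
    finally show ?thesis by (simp add: c_def mult_ac)
  qed
  let ?g = "\<lambda>a x. power_kernel a x * complex_of_real (exp (- x))"
  have "convolution (?g a) (?g b) x = c * ?g (a + b) x" for x
  proof -
    have "complex_of_real (exp (- (x - u))) * of_real (exp (- u)) = of_real (exp (- x))" for u
      by (simp add: of_real_mult[symmetric] exp_add[symmetric] del: of_real_mult)
    then have "?g a (x - u) * ?g b u = power_kernel a (x - u) * power_kernel b u * of_real (exp (- x))" for u
      by (metis (no_types, lifting) mult.assoc mult.commute)
    then have "convolution (?g a) (?g b) x = convolution (power_kernel a) (power_kernel b) x * of_real (exp (- x))"
      unfolding convolution_def integral_mult_left_zero[symmetric] by (intro Bochner_Integration.integral_cong refl) blast
    then show ?thesis by (simp add: conv mult.assoc)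
  qed
  then have "c = 1"
    using integral_convolution[of "?g a" "?g b"] power_kernel_exp_integral[OF a]
      power_kernel_exp_integral[OF b] power_kernel_exp_integral[OF ab]
    by (simp add: has_bochner_integral_iff)
  with conv show ?thesis by (intro ext) simp
qed

section \<open>Products of kernels in two variables\<close>

definition tensor :: "(real \<Rightarrow> complex) \<Rightarrow> (real \<Rightarrow> complex) \<Rightarrow> real \<times> real \<Rightarrow> complex"
  where "tensor f g p = f (fst p) * g (snd p)"

lemma borel_measurable_tensor [measurable]:
  assumes [measurable]: "f \<in> borel_measurable borel" "g \<in> borel_measurable borel"
  shows "tensor f g \<in> borel_measurable borel"
  unfolding tensor_def[abs_def] borel_prod[symmetric] by measurable

lemma nn_convolution_product:
  fixes f g f' g' :: "real \<Rightarrow> ennreal"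
  assumes [measurable]: "f \<in> borel_measurable borel" "g \<in> borel_measurable borel"
    "f' \<in> borel_measurable borel" "g' \<in> borel_measurable borel"
  shows "nn_convolution (\<lambda>p. f (fst p) * g (snd p)) (\<lambda>p. f' (fst p) * g' (snd p)) z
    = nn_convolution f f' (fst z) * nn_convolution g g' (snd z)"
proof -
  have "nn_convolution (\<lambda>p. f (fst p) * g (snd p)) (\<lambda>p. f' (fst p) * g' (snd p)) z =
     (\<integral>\<^sup>+u. f (fst (z - u)) * g (snd (z - u)) * (f' (fst u) * g' (snd u)) \<partial>(lborel \<Otimes>\<^sub>M lborel))"
    by (simp add: nn_convolution_def lborel_prod)
  also have "\<dots> = (\<integral>\<^sup>+x. \<integral>\<^sup>+y. (f (fst z - x) * f' x) * (g (snd z - y) * g' y) \<partial>lborel \<partial>lborel)"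
    by (subst lborel.nn_integral_fst[symmetric]) (auto simp: mult_ac)
  also have "\<dots> = (\<integral>\<^sup>+x. (f (fst z - x) * f' x) * nn_convolution g g' (snd z) \<partial>lborel)"
    by (simp add: nn_integral_cmult nn_convolution_def)
  also have "\<dots> = nn_convolution f f' (fst z) * nn_convolution g g' (snd z)"
    by (simp add: nn_integral_multc nn_convolution_def)
  finally show ?thesis .
qed

lemma convolution_tensor:
  assumes [measurable]: "f \<in> borel_measurable borel" "g \<in> borel_measurable borel"
    "f' \<in> borel_measurable borel" "g' \<in> borel_measurable borel"
    and fin: "nn_convolution (enorm f) (enorm f') (fst z) < \<infinity>" "nn_convolution (enorm g) (enorm g') (snd z) < \<infinity>"
  shows "convolution (tensor f g) (tensor f' g') z = convolution f f' (fst z) * convolution g g' (snd z)"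
proof -
  have "enorm (tensor f g) = (\<lambda>p. enorm f (fst p) * enorm g (snd p))" for f g
    by (auto simp: tensor_def norm_mult ennreal_mult)
  then have "nn_convolution (enorm (tensor f g)) (enorm (tensor f' g')) z < \<infinity>"
    using fin by (simp only:, subst nn_convolution_product) (auto simp: ennreal_mult_less_top)
  then have "integrable lborel (\<lambda>u. tensor f g (z - u) * tensor f' g' u)"
    by (intro integrable_convolution_integrand) auto
  then have int: "integrable (lborel \<Otimes>\<^sub>M lborel) (\<lambda>(x, y). tensor f g (z - (x, y)) * tensor f' g' (x, y))"
    by (simp add: lborel_prod case_prod_unfold)
  have "convolution (tensor f g) (tensor f' g') z
      = (\<integral>(x, y). tensor f g (z - (x, y)) * tensor f' g' (x, y) \<partial>(lborel \<Otimes>\<^sub>M lborel))"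
    by (simp add: convolution_def lborel_prod case_prod_unfold)
  also have "\<dots> = (\<integral>x. \<integral>y. tensor f g (z - (x, y)) * tensor f' g' (x, y) \<partial>lborel \<partial>lborel)"
    by (rule lborel_pair.integral_fst[OF int, symmetric])
  also have "\<dots> = (\<integral>x. \<integral>y. (f (fst z - x) * f' x) * (g (snd z - y) * g' y) \<partial>lborel \<partial>lborel)"
    by (simp add: tensor_def mult_ac)
  also have "\<dots> = convolution f f' (fst z) * convolution g g' (snd z)"
    by (simp only: integral_mult_right_zero integral_mult_left_zero convolution_def)
  finally show ?thesis .
qed

lemma nn_convolution_power_kernel_finite:
  assumes "Re a > 0" "Re b > 0"
  shows "nn_convolution (enorm (power_kernel a)) (enorm (power_kernel b)) x < \<infinity>"
proof -
  have "nn_convolution (enorm (power_kernel a)) (enorm (power_kernel b)) x = ennreal (1 / norm (Gamma a)) * ennreal (1 / norm (Gamma b)) *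
      nn_convolution (pos_power (Re a)) (pos_power (Re b)) x"
    unfolding nn_convolution_def enorm_power_kernel
    by (subst nn_integral_cmult[symmetric]) (auto simp: mult_ac)
  then show ?thesis
    using assms by (simp add: nn_convolution_pos_power ennreal_mult_less_top)
qed

lemma convolution_tensor_power_kernel:
  assumes "Re a > 0" "Re b > 0" "Re c > 0" "Re d > 0"
  shows "convolution (tensor (power_kernel a) (power_kernel b)) (tensor (power_kernel c) (power_kernel d))
    = tensor (power_kernel (a + c)) (power_kernel (b + d))"
proof
  fix z
  have "convolution (tensor (power_kernel a) (power_kernel b)) (tensor (power_kernel c) (power_kernel d)) z
    = convolution (power_kernel a) (power_kernel c) (fst z) * convolution (power_kernel b) (power_kernel d) (snd z)"
    using assms by (intro convolution_tensor nn_convolution_power_kernel_finite) auto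
  then show "convolution (tensor (power_kernel a) (power_kernel b)) (tensor (power_kernel c) (power_kernel d)) z
    = tensor (power_kernel (a + c)) (power_kernel (b + d)) z"
    using assms by (simp add: convolution_power_kernel tensor_def)
qed

section \<open>Coefficients of the Mittag-Leffler series\<close>

text \<open>The integrals \<open>\<integral> (1 - s) powr (x + n v - 1) * s powr (v - 1)\<close> over the unit interval tend to zero
by dominated convergence.\<close>

lemma nn_beta_tendsto_0:
  assumes x: "x > 0" and v: "v > (0::real)"
  shows "(\<lambda>n. nn_convolution (pos_power (x + real n * v)) (pos_power v) 1) \<longlonglongrightarrow> 0"
proof -
  let ?u = "\<lambda>n s. ennreal (pos_power (x + real n * v) (1 - s)) * ennreal (pos_power v s)"
  have "(\<lambda>n. \<integral>\<^sup>+s. ?u n s \<partial>lborel) \<longlonglongrightarrow> (\<integral>\<^sup>+s. 0 \<partial>(lborel :: real measure))"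
  proof (rule nn_integral_dominated_convergence[where w="?u 0"])
    show "AE s in lborel. ?u j s \<le> ?u 0 s" for j
    proof (intro AE_I2)
      fix s
      show "?u j s \<le> ?u 0 s"
        using v by (cases "s > 0") (auto simp: pos_power_def intro!: mult_right_mono ennreal_leI powr_mono')
    qed
    show "(\<integral>\<^sup>+s. ?u 0 s \<partial>lborel) < \<infinity>"
      using nn_convolution_pos_power[OF x v, of 1] by (simp add: nn_convolution_def ennreal_mult_less_top)
    show "AE s in lborel. (\<lambda>i. ?u i s) \<longlonglongrightarrow> 0"
    proof (intro AE_I2)
      fix s
      show "(\<lambda>i. ?u i s) \<longlonglongrightarrow> 0"
      proof (cases "0 < s \<and> s < 1")
        case True
        have "(\<lambda>i. (1 - s) powr (x - 1) * ((1 - s) powr v) ^ i) \<longlonglongrightarrow> (1 - s) powr (x - 1) * 0"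
          using True v by (intro tendsto_mult tendsto_const LIMSEQ_power_zero) (use True v powr_less_mono2[of v "1 - s" 1] in auto)
        moreover have "(1 - s) powr (x - 1) * ((1 - s) powr v) ^ i = pos_power (x + real i * v) (1 - s)" for i
        proof -
          have "((1 - s) powr v) ^ i = (1 - s) powr (real i * v)"
            using True by (simp add: powr_realpow[symmetric] powr_powr mult.commute)
          then show ?thesis using True by (simp add: pos_power_def powr_add[symmetric] algebra_simps)
        qed
        ultimately have "(\<lambda>i. pos_power (x + real i * v) (1 - s) * pos_power v s) \<longlonglongrightarrow> 0 * pos_power v s"
          by (intro tendsto_mult tendsto_const) simp
        then have "(\<lambda>i. ennreal (pos_power (x + real i * v) (1 - s) * pos_power v s)) \<longlonglongrightarrow> ennreal 0"
          by (intro tendsto_ennrealI) simp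
        then show ?thesis by (simp add: ennreal_mult)
      next
        case False
        then have "?u i s = 0" for i by (auto simp: pos_power_def)
        then show ?thesis by (simp only: tendsto_const)
      qed
    qed
  qed measurable
  then show ?thesis by (simp add: nn_convolution_def)
qed

text \<open>The absolute value of a complex Beta integral is at most the Beta integral of the real parts. This
replaces asymptotics of the complex Gamma function: it bounds \<open>\<Gamma>(a) / \<Gamma>(a + b)\<close>.\<close>

lemma norm_Gamma_ratio_le:
  assumes a: "Re a > 0" and b: "Re b > 0"
  shows "ennreal (norm (Gamma a) / norm (Gamma (a + b)))
    \<le> ennreal (1 / norm (Gamma b)) * nn_convolution (pos_power (Re a)) (pos_power (Re b)) 1"
proof -
  have G: "norm (Gamma a) > 0" using Gamma_nonzero_Re_pos[OF a] by simp
  have "ennreal (1 / norm (Gamma (a + b))) = enorm (power_kernel (a + b)) 1"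
    by (simp add: power_kernel_def norm_divide)
  also have "\<dots> \<le> nn_convolution (enorm (power_kernel a)) (enorm (power_kernel b)) 1"
    using enorm_convolution_le[of "power_kernel a" "power_kernel b" 1] by (simp add: convolution_power_kernel[OF a b])
  also have "\<dots> = ennreal (1 / norm (Gamma a)) * ennreal (1 / norm (Gamma b)) *
      nn_convolution (pos_power (Re a)) (pos_power (Re b)) 1"
    unfolding nn_convolution_def enorm_power_kernel
    by (subst nn_integral_cmult[symmetric]) (auto simp: mult_ac)
  finally have "ennreal (norm (Gamma a)) * ennreal (1 / norm (Gamma (a + b)))
     \<le> ennreal (norm (Gamma a)) * (ennreal (1 / norm (Gamma a)) * ennreal (1 / norm (Gamma b)) *
      nn_convolution (pos_power (Re a)) (pos_power (Re b)) 1)"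
    by (rule mult_left_mono) simp
  also have "\<dots> = (ennreal (norm (Gamma a)) * ennreal (1 / norm (Gamma a))) * (ennreal (1 / norm (Gamma b)) *
      nn_convolution (pos_power (Re a)) (pos_power (Re b)) 1)"
    by (simp only: mult.assoc)
  also have "ennreal (norm (Gamma a)) * ennreal (1 / norm (Gamma a)) = 1"
    using G by (subst ennreal_mult[symmetric]) auto
  finally show ?thesis
    by (simp add: ennreal_mult[symmetric])
qed

text \<open>The ratio test; the quotients of consecutive terms are Beta integrals that tend to zero.\<close>

lemma summable_power_div_Gamma:
  assumes q: "Re q > 0" and \<upsilon>: "Re \<upsilon> > 0" and C: "C > 0"
  shows "summable (\<lambda>n. C ^ n / norm (Gamma (q + \<upsilon> * of_nat n)))"
proof -
  define \<rho> where "\<rho> n = norm (Gamma (q + \<upsilon> * of_nat n)) / norm (Gamma (q + \<upsilon> * of_nat n + \<upsilon>))" for n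
  have Re: "Re (q + \<upsilon> * of_nat n) = Re q + real n * Re \<upsilon>" for n by simp
  have pos: "Re (q + \<upsilon> * of_nat n) > 0" for n
    using q \<upsilon> unfolding Re by (intro add_pos_nonneg) auto
  define h where "h n = ennreal (1 / norm (Gamma \<upsilon>)) *
      nn_convolution (pos_power (Re q + real n * Re \<upsilon>)) (pos_power (Re \<upsilon>)) 1" for n
  have le: "ennreal (\<rho> n) \<le> h n" for n
    using norm_Gamma_ratio_le[OF pos \<upsilon>] unfolding \<rho>_def h_def Re .
  have h: "h \<longlonglongrightarrow> 0"
    unfolding h_def using ennreal_tendsto_cmult[OF _ nn_beta_tendsto_0[OF q \<upsilon>]] by simp
  have "(\<lambda>n. ennreal (\<rho> n)) \<longlonglongrightarrow> 0"
    by (rule tendsto_sandwich[OF _ _ tendsto_const h]) (auto intro!: always_eventually le)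
  moreover have "ennreal (1 / (2 * C)) > 0" using C by simp
  ultimately have "\<forall>\<^sub>F n in sequentially. ennreal (\<rho> n) < ennreal (1 / (2 * C))"
    by (rule order_tendstoD(2))
  then obtain N where N: "\<And>n. n \<ge> N \<Longrightarrow> ennreal (\<rho> n) < ennreal (1 / (2 * C))"
    unfolding eventually_sequentially by blast
  show ?thesis
  proof (rule summable_ratio_test[where c="1/2" and N=N])
    fix n assume "n \<ge> N"
    then have "\<rho> n < 1 / (2 * C)"
      using N C by (simp add: \<rho>_def ennreal_less_iff)
    then have *: "C * \<rho> n \<le> 1 / 2" using C by (simp add: field_simps)
    have G: "norm (Gamma (q + \<upsilon> * of_nat n)) > 0" using Gamma_nonzero_Re_pos[OF pos[of n]] by simp
    have "q + \<upsilon> * of_nat (Suc n) = q + \<upsilon> * of_nat n + \<upsilon>" by (simp add: algebra_simps)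
    then have "C ^ Suc n / norm (Gamma (q + \<upsilon> * of_nat (Suc n)))
       = (C * \<rho> n) * (C ^ n / norm (Gamma (q + \<upsilon> * of_nat n)))"
      using G by (simp add: \<rho>_def field_simps)
    also have "\<dots> \<le> 1 / 2 * (C ^ n / norm (Gamma (q + \<upsilon> * of_nat n)))"
      using * C by (intro mult_right_mono) auto
    finally show "norm (C ^ Suc n / norm (Gamma (q + \<upsilon> * of_nat (Suc n))))
       \<le> 1 / 2 * norm (C ^ n / norm (Gamma (q + \<upsilon> * of_nat n)))"
      using C by simp
  qed simp
qed

lemma norm_pochhammer_div_fact_le:
  "norm (pochhammer (a :: complex) l / fact l) \<le> (1 + norm a) ^ l"
proof (induction l)
  case (Suc l)
  have "norm (a + of_nat l) \<le> norm a + real l"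
    by (metis norm_of_nat norm_triangle_ineq)
  also have "\<dots> \<le> (1 + norm a) * (1 + real l)" by (simp add: algebra_simps)
  finally have "norm ((a + of_nat l) / of_nat (Suc l)) \<le> 1 + norm a"
    by (simp add: norm_divide divide_le_eq del: of_nat_Suc) (simp add: algebra_simps)
  then have "norm (pochhammer a l / fact l) * norm ((a + of_nat l) / of_nat (Suc l)) \<le> (1 + norm a) ^ l * (1 + norm a)"
    using Suc.IH by (intro mult_mono) auto
  moreover have "pochhammer a (Suc l) / fact (Suc l) = pochhammer a l / fact l * ((a + of_nat l) / of_nat (Suc l))"
    by (simp add: pochhammer_Suc)
  ultimately show ?case by (simp only: norm_mult power_Suc2)
qed simp

text \<open>With \<open>k + 1\<close> in the place of \<open>z\<close> the left-hand side is \<open>fact n\<close> times a binomial coefficient of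
order \<open>k + n\<close>.\<close>

lemma norm_pochhammer_le:
  assumes "norm z \<le> real (Suc k)"
  shows "norm (pochhammer (z :: complex) n) \<le> fact n * 2 ^ (k + n)"
proof -
  have "norm (pochhammer z n) * fact k \<le> fact (k + n)"
  proof (induction n)
    case (Suc n)
    have "norm (z + of_nat n) \<le> real (Suc k) + real n"
      using assms by (metis add_right_mono norm_of_nat norm_triangle_ineq order_trans)
    with Suc have "(norm (pochhammer z n) * fact k) * norm (z + of_nat n) \<le> fact (k + n) * (real (Suc k) + real n)"
      by (intro mult_mono) auto
    moreover have "fact (k + n) * (real (Suc k) + real n) = fact (k + Suc n)" by (simp add: algebra_simps)
    ultimately show ?case by (simp only: pochhammer_Suc norm_mult mult_ac)
  qed simp
  also have "fact (k + n) = fact n * fact k * real ((k + n) choose n)"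
    using arg_cong[OF binomial_fact_lemma[of n "k + n"], of real] by simp
  also have "\<dots> \<le> fact n * fact k * 2 ^ (k + n)"
  proof -
    have "real ((k + n) choose n) \<le> real (2 ^ (k + n))"
      using binomial_le_pow2[of "k + n" n] by (simp only: of_nat_le_iff)
    then show ?thesis by (intro mult_left_mono) simp_all
  qed
  finally have "norm (pochhammer z n) * fact k \<le> (fact n * 2 ^ (k + n)) * fact k" by (simp add: mult_ac)
  then show ?thesis by simp
qed

text \<open>The coefficients of the series of the kernel with respect to the products of power kernels; the
Gamma functions of the series belong to the power kernels.\<close>

definition IK_coeff :: "complex \<Rightarrow> complex \<Rightarrow> complex \<Rightarrow> complex \<Rightarrow> nat \<Rightarrow> nat \<Rightarrow> complex"
  where "IK_coeff \<gamma>1 \<gamma>2 w1 W l n = (-4 * w1) ^ l * W ^ n * (pochhammer (\<gamma>1 / 2) l / fact l)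
     * (pochhammer (\<gamma>2 + of_nat l) n / fact n)"

text \<open>Geometric growth in both indices, which the reciprocal Gamma functions outweigh.\<close>

lemma norm_IK_coeff_le:
  obtains A B K where "A > 0" "B > 0" "\<And>l n. norm (IK_coeff \<gamma>1 \<gamma>2 w1 W l n) \<le> K * A ^ l * B ^ n"
proof -
  obtain m :: nat where m: "norm \<gamma>2 \<le> real m" using real_arch_simple by blast
  define A B K where "A = 4 * norm w1 * (1 + norm (\<gamma>1 / 2)) * 2 + 1" and "B = norm W * 2 + 1" and "K = (2 ^ m :: real)"
  have "norm (IK_coeff \<gamma>1 \<gamma>2 w1 W l n) \<le> K * A ^ l * B ^ n" for l n
  proof -
    have "norm (\<gamma>2 + of_nat l) \<le> norm \<gamma>2 + real l" by (metis norm_of_nat norm_triangle_ineq)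
    also have "\<dots> \<le> real (Suc (m + l))" using m by simp
    finally have "norm (pochhammer (\<gamma>2 + of_nat l) n) \<le> fact n * 2 ^ (m + l + n)"
      by (rule norm_pochhammer_le)
    then have p2: "norm (pochhammer (\<gamma>2 + of_nat l) n / fact n) \<le> 2 ^ (m + l + n)"
      by (simp add: norm_divide field_simps)
    have "norm (IK_coeff \<gamma>1 \<gamma>2 w1 W l n) = norm ((-4 * w1) ^ l) * norm (W ^ n) *
       norm (pochhammer (\<gamma>1 / 2) l / fact l) * norm (pochhammer (\<gamma>2 + of_nat l) n / fact n)"
      by (simp only: IK_coeff_def norm_mult)
    also have "\<dots> \<le> norm ((-4 * w1) ^ l) * norm (W ^ n) * (1 + norm (\<gamma>1 / 2)) ^ l * 2 ^ (m + l + n)"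
      using p2 norm_pochhammer_div_fact_le[of "\<gamma>1 / 2" l] by (intro mult_mono) (simp_all del: norm_divide)
    also have "\<dots> = K * (4 * norm w1 * (1 + norm (\<gamma>1 / 2)) * 2) ^ l * (norm W * 2) ^ n"
      by (simp add: K_def norm_mult norm_power power_mult_distrib power_add) (simp flip: power_mult_distrib)
    also have "\<dots> \<le> K * A ^ l * B ^ n"
      by (intro mult_mono power_mono) (auto simp: A_def B_def K_def)
    finally show ?thesis .
  qed
  moreover have "A > 0" "B > 0" unfolding A_def B_def by (intro add_nonneg_pos; simp)+
  ultimately show thesis using that by blast
qed

lemma pochhammer_Vandermonde:
  fixes a b :: complex
  shows "(\<Sum>n\<le>N. (pochhammer a n / fact n) * (pochhammer b (N - n) / fact (N - n))) = pochhammer (a + b) N / fact N"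
proof -
  have "(pochhammer a n / fact n) * (pochhammer b (N - n) / fact (N - n))
      = of_nat (N choose n) * pochhammer a n * pochhammer b (N - n) / fact N" if "n \<le> N" for n
    using that by (simp add: binomial_fact)
  then have "(\<Sum>n\<le>N. (pochhammer a n / fact n) * (pochhammer b (N - n) / fact (N - n)))
     = (\<Sum>n\<le>N. of_nat (N choose n) * pochhammer a n * pochhammer b (N - n) / fact N)"
    by (intro sum.cong) auto
  also have "\<dots> = pochhammer (a + b) N / fact N"
    by (simp add: pochhammer_binomial_sum sum_divide_distrib)
  finally show ?thesis .
qed

text \<open>The double power series with these coefficients for \<open>\<gamma>\<close> and \<open>-\<gamma>\<close> are reciprocal to each other. The
sum over \<open>n\<close> is Vandermonde's identity with the parameters \<open>-\<gamma>\<^sub>2 + l\<close> and \<open>\<gamma>\<^sub>2 + (L - l)\<close>; their sum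
\<open>L\<close> does not depend on \<open>l\<close>. So the sum over \<open>l\<close> is again Vandermonde's identity, now with
parameters that add up to zero.\<close>

lemma IK_coeff_inverse:
  "(\<Sum>l\<le>L. \<Sum>n\<le>N. IK_coeff (- \<gamma>1) (- \<gamma>2) w1 W l n * IK_coeff \<gamma>1 \<gamma>2 w1 W (L - l) (N - n))
    = (if L = 0 \<and> N = 0 then 1 else 0)"
proof -
  have "(\<Sum>n\<le>N. IK_coeff (- \<gamma>1) (- \<gamma>2) w1 W l n * IK_coeff \<gamma>1 \<gamma>2 w1 W (L - l) (N - n))
     = (-4 * w1) ^ L * W ^ N * (pochhammer (of_nat L) N / fact N)
        * ((pochhammer (- \<gamma>1 / 2) l / fact l) * (pochhammer (\<gamma>1 / 2) (L - l) / fact (L - l)))" if "l \<le> L" for l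
  proof -
    have "(\<Sum>n\<le>N. IK_coeff (- \<gamma>1) (- \<gamma>2) w1 W l n * IK_coeff \<gamma>1 \<gamma>2 w1 W (L - l) (N - n))
      = (\<Sum>n\<le>N. ((-4 * w1) ^ L * W ^ N *
          ((pochhammer (- \<gamma>1 / 2) l / fact l) * (pochhammer (\<gamma>1 / 2) (L - l) / fact (L - l)))) *
          ((pochhammer (- \<gamma>2 + of_nat l) n / fact n) * (pochhammer (\<gamma>2 + of_nat (L - l)) (N - n) / fact (N - n))))"
    proof (intro sum.cong refl)
      fix n assume "n \<in> {..N}"
      then have "W ^ N = W ^ n * W ^ (N - n)" by (simp add: power_add[symmetric])
      moreover have "(-4 * w1) ^ L = (-4 * w1) ^ l * (-4 * w1) ^ (L - l)"
        using that by (simp only: power_add[symmetric]) simp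
      ultimately show "IK_coeff (- \<gamma>1) (- \<gamma>2) w1 W l n * IK_coeff \<gamma>1 \<gamma>2 w1 W (L - l) (N - n)
        = ((-4 * w1) ^ L * W ^ N *
          ((pochhammer (- \<gamma>1 / 2) l / fact l) * (pochhammer (\<gamma>1 / 2) (L - l) / fact (L - l)))) *
          ((pochhammer (- \<gamma>2 + of_nat l) n / fact n) * (pochhammer (\<gamma>2 + of_nat (L - l)) (N - n) / fact (N - n)))"
        unfolding IK_coeff_def by (simp only: mult_ac)
    qed
    also have "\<dots> = ((-4 * w1) ^ L * W ^ N *
          ((pochhammer (- \<gamma>1 / 2) l / fact l) * (pochhammer (\<gamma>1 / 2) (L - l) / fact (L - l)))) *
          (pochhammer ((- \<gamma>2 + of_nat l) + (\<gamma>2 + of_nat (L - l))) N / fact N)"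
      by (simp only: sum_distrib_left[symmetric] pochhammer_Vandermonde)
    also have "(- \<gamma>2 + of_nat l) + (\<gamma>2 + of_nat (L - l)) = of_nat L"
      using that by (simp add: of_nat_diff)
    finally show ?thesis by (simp only: mult_ac)
  qed
  then have "(\<Sum>l\<le>L. \<Sum>n\<le>N. IK_coeff (- \<gamma>1) (- \<gamma>2) w1 W l n * IK_coeff \<gamma>1 \<gamma>2 w1 W (L - l) (N - n))
     = (\<Sum>l\<le>L. (-4 * w1) ^ L * W ^ N * (pochhammer (of_nat L) N / fact N)
        * ((pochhammer (- \<gamma>1 / 2) l / fact l) * (pochhammer (\<gamma>1 / 2) (L - l) / fact (L - l))))"
    by (intro sum.cong) auto
  also have "\<dots> = (-4 * w1) ^ L * W ^ N * (pochhammer (of_nat L) N / fact N) * (pochhammer (- \<gamma>1 / 2 + \<gamma>1 / 2) L / fact L)"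
    by (simp only: sum_distrib_left[symmetric] pochhammer_Vandermonde)
  also have "\<dots> = (if L = 0 \<and> N = 0 then 1 else 0)"
    by (auto simp: pochhammer_0_left)
  finally show ?thesis .
qed

section \<open>Convolution of two Mittag-Leffler kernels\<close>

abbreviation abs_summable :: "('i \<Rightarrow> 'b :: {banach, second_countable_topology}) \<Rightarrow> bool"
  where "abs_summable f \<equiv> Infinite_Set_Sum.abs_summable_on f UNIV"

text \<open>Fubini's theorem for the product with a counting measure.\<close>

lemma
  fixes f :: "'i::countable \<Rightarrow> 'a \<Rightarrow> complex"
  assumes M: "sigma_finite_measure M"
    and meas [measurable]: "\<And>i. f i \<in> borel_measurable M"
    and bound: "\<And>i x. x \<in> space M \<Longrightarrow> norm (f i x) \<le> B i * w x"
    and B: "abs_summable B" and w: "integrable M w"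
  shows abs_summable_on_integral: "abs_summable (\<lambda>i. integral\<^sup>L M (f i))"
    and integral_infsetsum: "(\<integral>x. infsetsum (\<lambda>i. f i x) UNIV \<partial>M) = infsetsum (\<lambda>i. integral\<^sup>L M (f i)) UNIV"
proof -
  interpret M: sigma_finite_measure M by (rule M)
  interpret C: sigma_finite_measure "count_space (UNIV :: 'i set)"
    by (rule sigma_finite_measure_count_space_countable) simp
  interpret P: pair_sigma_finite "count_space (UNIV :: 'i set)" M ..
  have int: "integrable M (f i)" for i
  proof (rule Bochner_Integration.integrable_bound)
    show "integrable M (\<lambda>x. B i * w x)" using w by simp
    show "AE x in M. norm (f i x) \<le> norm (B i * w x)"
      using bound by (intro AE_I2) (smt (verit) real_norm_def)
  qed measurable
  have norm_le: "(\<integral>x. norm (f i x) \<partial>M) \<le> B i * (\<integral>x. w x \<partial>M)" for i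
  proof -
    have "(\<integral>x. norm (f i x) \<partial>M) \<le> (\<integral>x. B i * w x \<partial>M)"
      using int w bound by (intro integral_mono) auto
    then show ?thesis by simp
  qed
  have summ: "abs_summable (\<lambda>i. B i * (\<integral>x. w x \<partial>M))"
    using B by (intro abs_summable_on_cmult_left)
  have norm_int: "abs_summable (\<lambda>i. \<integral>x. norm (f i x) \<partial>M)"
    by (rule abs_summable_on_comparison_test'[OF summ]) (use norm_le in auto)
  show "abs_summable (\<lambda>i. integral\<^sup>L M (f i))"
    by (rule abs_summable_on_comparison_test'[OF norm_int]) (rule integral_norm_bound)
  have "integrable (count_space UNIV \<Otimes>\<^sub>M M) (\<lambda>(i, x). f i x)"
  proof (rule P.Fubini_integrable)
    show "(\<lambda>(i, x). f i x) \<in> borel_measurable (count_space UNIV \<Otimes>\<^sub>M M)"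
      by (rule measurable_pair_measure_countable1) auto
  qed (use norm_int int in \<open>auto simp: abs_summable_on_def\<close>)
  from P.Fubini_integral[OF this]
  show "(\<integral>x. infsetsum (\<lambda>i. f i x) UNIV \<partial>M) = infsetsum (\<lambda>i. integral\<^sup>L M (f i)) UNIV"
    by (simp add: infsetsum_def)
qed

definition IK_term :: "complex \<Rightarrow> complex \<Rightarrow> complex \<Rightarrow> complex \<Rightarrow> complex \<Rightarrow> complex \<Rightarrow> complex
    \<Rightarrow> nat \<times> nat \<Rightarrow> real \<times> real \<Rightarrow> complex"
  where "IK_term \<gamma>1 \<gamma>2 p q \<upsilon> w1 W i z = IK_coeff \<gamma>1 \<gamma>2 w1 W (fst i) (snd i) *
    tensor (power_kernel (p + of_nat (fst i))) (power_kernel (q + \<upsilon> * of_nat (snd i))) z"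

text \<open>The series of the kernel is in general dominated by a multiple of its weight only on bounded sets.
All points that occur as differences of points of the rectangle and have positive coordinates lie
in such a square, so the kernel may be cut off outside it.\<close>

definition corner_square :: "real \<Rightarrow> (real \<times> real) set" where "corner_square R = {0<..<R} \<times> {0<..<R}"

definition IK_series :: "complex \<Rightarrow> complex \<Rightarrow> complex \<Rightarrow> complex \<Rightarrow> complex \<Rightarrow> complex \<Rightarrow> complex
    \<Rightarrow> real \<Rightarrow> real \<times> real \<Rightarrow> complex"
  where "IK_series \<gamma>1 \<gamma>2 p q \<upsilon> w1 W R z =
    (if z \<in> corner_square R then infsetsum (\<lambda>i. IK_term \<gamma>1 \<gamma>2 p q \<upsilon> w1 W i z) UNIV else 0)"

definition power_weight :: "real \<Rightarrow> real \<Rightarrow> real \<times> real \<Rightarrow> real"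
  where "power_weight p q z = pos_power p (fst z) * pos_power q (snd z)"

lemma power_weight_nonneg [simp]: "power_weight p q z \<ge> 0"
  by (simp add: power_weight_def)

lemma borel_measurable_power_weight [measurable]: "power_weight p q \<in> borel_measurable borel"
  unfolding power_weight_def[abs_def] borel_prod[symmetric] by measurable

lemma corner_square_sets [measurable]: "corner_square R \<in> sets borel"
  unfolding corner_square_def borel_prod[symmetric] by measurable

lemma borel_measurable_IK_term [measurable]: "IK_term \<gamma>1 \<gamma>2 p q \<upsilon> w1 W i \<in> borel_measurable borel"
  unfolding IK_term_def[abs_def] by measurable

text \<open>On the square the factors \<open>x ^ l\<close> and \<open>y powr (\<upsilon> n)\<close> are bounded by powers of \<open>R\<close>, which leaves
the weight of the first term and a summable double sequence.\<close>

lemma IK_term_bound: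
  assumes p: "Re p > 0" and q: "Re q > 0" and \<upsilon>: "Re \<upsilon> > 0" and R: "R > 0"
  obtains M where "abs_summable M" "\<And>i. M i \<ge> 0"
    "\<And>i z. z \<in> corner_square R \<Longrightarrow> norm (IK_term \<gamma>1 \<gamma>2 p q \<upsilon> w1 W i z) \<le> M i * power_weight (Re p) (Re q) z"
proof -
  obtain A B K where AB: "A > 0" "B > 0" "\<And>l n. norm (IK_coeff \<gamma>1 \<gamma>2 w1 W l n) \<le> K * A ^ l * B ^ n"
    using norm_IK_coeff_le by blast
  have "0 \<le> K * A ^ 0 * B ^ 0" using AB(3)[of 0 0] norm_ge_zero order_trans by blast
  then have K: "K \<ge> 0" by simp
  define X where "X l = (A * R) ^ l / norm (Gamma (p + 1 * of_nat l))" for l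
  define Y where "Y n = (B * R powr Re \<upsilon>) ^ n / norm (Gamma (q + \<upsilon> * of_nat n))" for n
  have XY: "X l \<ge> 0" "Y n \<ge> 0" for l n using AB R by (auto simp: X_def Y_def)
  have "abs_summable X" "abs_summable Y"
    unfolding abs_summable_on_nat_iff' using XY AB R p q \<upsilon>
    by (auto simp: abs_of_nonneg X_def Y_def intro!: summable_power_div_Gamma[where \<upsilon>=1, simplified] summable_power_div_Gamma)
  from abs_summable_on_product[OF _ _ this]
  have "abs_summable (\<lambda>(l, n). X l * Y n)" by simp
  then have "abs_summable (\<lambda>i. K * (X (fst i) * Y (snd i)))"
    by (intro abs_summable_on_cmult_right) (simp add: case_prod_unfold)
  moreover have "norm (IK_term \<gamma>1 \<gamma>2 p q \<upsilon> w1 W i z) \<le> K * (X (fst i) * Y (snd i)) * power_weight (Re p) (Re q) z"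
    if z: "z \<in> corner_square R" for i z
  proof -
    obtain l n where i: "i = (l, n)" by (cases i)
    obtain x y where zxy: "z = (x, y)" by (cases z)
    have xy: "0 < x" "x < R" "0 < y" "y < R" using z by (auto simp: corner_square_def zxy)
    have x: "pos_power (Re p + real l) x \<le> R ^ l * pos_power (Re p) x"
    proof -
      have "pos_power (Re p + real l) x = x ^ l * pos_power (Re p) x"
        using xy by (simp add: pos_power_def powr_realpow[symmetric] powr_add[symmetric] algebra_simps)
      also have "\<dots> \<le> R ^ l * pos_power (Re p) x"
        using xy by (intro mult_right_mono power_mono) auto
      finally show ?thesis .
    qed
    have y: "pos_power (Re q + Re \<upsilon> * real n) y \<le> (R powr Re \<upsilon>) ^ n * pos_power (Re q) y"
    proof -
      have "pos_power (Re q + Re \<upsilon> * real n) y = (y powr Re \<upsilon>) ^ n * pos_power (Re q) y"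
        using xy by (simp add: pos_power_def powr_realpow[symmetric] powr_powr powr_add[symmetric] algebra_simps)
      also have "\<dots> \<le> (R powr Re \<upsilon>) ^ n * pos_power (Re q) y"
        using xy \<upsilon> by (intro mult_right_mono power_mono powr_mono2) auto
      finally show ?thesis .
    qed
    have "norm (IK_term \<gamma>1 \<gamma>2 p q \<upsilon> w1 W i z) = norm (IK_coeff \<gamma>1 \<gamma>2 w1 W l n) *
       (pos_power (Re p + real l) x / norm (Gamma (p + of_nat l))) *
       (pos_power (Re q + Re \<upsilon> * real n) y / norm (Gamma (q + \<upsilon> * of_nat n)))"
      by (simp add: IK_term_def i zxy tensor_def norm_mult norm_power_kernel)
    also have "\<dots> \<le> (K * A ^ l * B ^ n) * (R ^ l * pos_power (Re p) x / norm (Gamma (p + of_nat l))) *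
       ((R powr Re \<upsilon>) ^ n * pos_power (Re q) y / norm (Gamma (q + \<upsilon> * of_nat n)))"
      using x y AB K R by (intro mult_mono divide_right_mono) auto
    also have "\<dots> = K * (X (fst i) * Y (snd i)) * power_weight (Re p) (Re q) z"
      by (simp add: X_def Y_def power_weight_def i zxy power_mult_distrib)
    finally show ?thesis .
  qed
  moreover have "K * (X (fst i) * Y (snd i)) \<ge> 0" for i using K XY by simp
  ultimately show thesis by (intro that[of "\<lambda>i. K * (X (fst i) * Y (snd i))"])
qed

lemma borel_measurable_IK_series [measurable]: "IK_series \<gamma>1 \<gamma>2 p q \<upsilon> w1 W R \<in> borel_measurable borel"
proof -
  interpret C: sigma_finite_measure "count_space (UNIV :: (nat \<times> nat) set)"
    by (rule sigma_finite_measure_count_space_countable) simp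
  have "(\<lambda>z. \<integral>i. IK_term \<gamma>1 \<gamma>2 p q \<upsilon> w1 W i z \<partial>count_space UNIV) \<in> borel_measurable borel"
  proof (rule C.borel_measurable_lebesgue_integral)
    show "(\<lambda>(z, i). IK_term \<gamma>1 \<gamma>2 p q \<upsilon> w1 W i z) \<in> borel_measurable (borel \<Otimes>\<^sub>M count_space UNIV)"
      unfolding case_prod_unfold
      by (rule measurable_compose_countable[where f="\<lambda>i x. IK_term \<gamma>1 \<gamma>2 p q \<upsilon> w1 W i (fst x)" and g=snd]) measurable
  qed
  then show ?thesis
    unfolding IK_series_def[abs_def] infsetsum_def by measurable
qed

lemma norm_IK_series_le:
  assumes "Re p > 0" "Re q > 0" "Re \<upsilon> > 0" "R > 0"
  obtains C where "C \<ge> 0" "\<And>z. norm (IK_series \<gamma>1 \<gamma>2 p q \<upsilon> w1 W R z) \<le> C * power_weight (Re p) (Re q) z"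
proof -
  obtain M where M: "abs_summable M" "\<And>i. M i \<ge> 0"
    "\<And>i z. z \<in> corner_square R \<Longrightarrow> norm (IK_term \<gamma>1 \<gamma>2 p q \<upsilon> w1 W i z) \<le> M i * power_weight (Re p) (Re q) z"
    using IK_term_bound[OF assms] by blast
  have C: "infsetsum M UNIV \<ge> 0" using M by (intro infsetsum_nonneg) auto
  have "norm (IK_series \<gamma>1 \<gamma>2 p q \<upsilon> w1 W R z) \<le> infsetsum M UNIV * power_weight (Re p) (Re q) z" for z
  proof (cases "z \<in> corner_square R")
    case True
    have Mw: "abs_summable (\<lambda>i. M i * power_weight (Re p) (Re q) z)"
      using M by (intro abs_summable_on_cmult_left)
    have "abs_summable (\<lambda>i. IK_term \<gamma>1 \<gamma>2 p q \<upsilon> w1 W i z)"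
      by (rule abs_summable_on_comparison_test'[OF Mw]) (rule M(3)[OF True])
    note ts = this
    then have "norm (IK_series \<gamma>1 \<gamma>2 p q \<upsilon> w1 W R z) \<le> infsetsum (\<lambda>i. norm (IK_term \<gamma>1 \<gamma>2 p q \<upsilon> w1 W i z)) UNIV"
      using True by (simp add: IK_series_def norm_infsetsum_bound)
    also have "\<dots> \<le> infsetsum (\<lambda>i. M i * power_weight (Re p) (Re q) z) UNIV"
      using abs_summable_on_normI[OF ts] Mw M(3)[OF True] by (intro infsetsum_mono) auto
    also have "\<dots> = infsetsum M UNIV * power_weight (Re p) (Re q) z"
      using M by (intro infsetsum_cmult_left) auto
    finally show ?thesis .
  qed (use C in \<open>simp add: IK_series_def\<close>)
  with C that show thesis by blast
qed

lemma IK_kernel_eq_IK_series: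
  assumes p: "Re p > 0" and q: "Re q > 0" and \<upsilon>: "Re \<upsilon> > 0"
    and x: "0 < x" "x < R" and y: "0 < y" "y < R"
  shows "of_real y powr (q - 1) * of_real x powr (p - 1) * IK_kernel \<gamma>1 \<gamma>2 \<gamma>3 p q \<upsilon> w1 W x y
    = IK_series \<gamma>1 \<gamma>2 p q \<upsilon> w1 W R (x, y)"
proof -
  define c where "c = of_real y powr (q - 1) * complex_of_real x powr (p - 1)"
  have c0: "c \<noteq> 0" using x y by (simp add: c_def)
  define T where "T l n = (-4) ^ l * pochhammer (\<gamma>1 / 2) l * pochhammer (\<gamma>2 + of_nat l) n
          * (w1 * of_real x) ^ l * (W ^ n * of_real y powr (\<upsilon> * of_nat n))
          / (Gamma (p + of_nat l) * Gamma (q + \<upsilon> * of_nat n) * fact n * fact l)" for l n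
  have R: "R > 0" using x by simp
  obtain M where M: "abs_summable M" "\<And>i. M i \<ge> 0"
    "\<And>i z. z \<in> corner_square R \<Longrightarrow> norm (IK_term \<gamma>1 \<gamma>2 p q \<upsilon> w1 W i z) \<le> M i * power_weight (Re p) (Re q) z"
    using IK_term_bound[OF p q \<upsilon> R] by blast
  have xy: "(x, y) \<in> corner_square R" using x y by (simp add: corner_square_def)
  have "abs_summable (\<lambda>i. M i * power_weight (Re p) (Re q) (x, y))"
    using M by (intro abs_summable_on_cmult_left)
  from abs_summable_on_comparison_test'[OF this M(3)[OF xy]]
  have sF: "abs_summable (\<lambda>i. IK_term \<gamma>1 \<gamma>2 p q \<upsilon> w1 W i (x, y))" by simp
  have FT: "IK_term \<gamma>1 \<gamma>2 p q \<upsilon> w1 W i (x, y) = c * (case i of (l, n) \<Rightarrow> T l n)" for i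
  proof -
    obtain l n where i: "i = (l, n)" by (cases i)
    have "of_real x powr (p + of_nat l - 1) = of_real x powr (p - 1) * of_real x ^ l"
      using x by (simp add: powr_add[of _ "p - 1" "of_nat l", simplified algebra_simps] powr_nat algebra_simps)
    moreover have "of_real y powr (q + \<upsilon> * of_nat n - 1) = of_real y powr (q - 1) * of_real y powr (\<upsilon> * of_nat n)"
      unfolding powr_add[symmetric] by (simp add: algebra_simps)
    moreover have "(- 4 * w1) ^ l = (-4) ^ l * w1 ^ l" by (rule power_mult_distrib)
    ultimately show ?thesis
      using x y by (simp add: IK_term_def i tensor_def power_kernel_def c_def T_def IK_coeff_def power_mult_distrib mult_ac)
  qed
  have sT: "abs_summable (\<lambda>(l, n). T l n)"
  proof -
    have "abs_summable (\<lambda>i. inverse c * IK_term \<gamma>1 \<gamma>2 p q \<upsilon> w1 W i (x, y))"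
      using sF by (intro abs_summable_on_cmult_right)
    then show ?thesis using c0 by (simp add: FT mult.assoc[symmetric])
  qed
  have "infsetsum (\<lambda>(l, n). T l n) UNIV = infsetsum (\<lambda>l. infsetsum (\<lambda>n. T l n) UNIV) UNIV"
    using infsetsum_Sigma'[of UNIV "\<lambda>_. UNIV" T] sT by simp
  also have "\<dots> = (\<Sum>l. infsetsum (\<lambda>n. T l n) UNIV)"
    using abs_summable_on_Sigma_project1'[of T UNIV "\<lambda>_. UNIV"] sT
    by (intro infsetsum_nat') simp
  also have "\<dots> = (\<Sum>l. \<Sum>n. T l n)"
    using abs_summable_on_Sigma_project2[of "\<lambda>(l, n). T l n" UNIV "\<lambda>_. UNIV"] sT
    by (intro suminf_cong infsetsum_nat') simp
  also have "\<dots> = IK_kernel \<gamma>1 \<gamma>2 \<gamma>3 p q \<upsilon> w1 W x y"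
    by (simp add: IK_kernel_def T_def)
  finally have K: "infsetsum (\<lambda>(l, n). T l n) UNIV = IK_kernel \<gamma>1 \<gamma>2 \<gamma>3 p q \<upsilon> w1 W x y" .
  have "IK_series \<gamma>1 \<gamma>2 p q \<upsilon> w1 W R (x, y) = infsetsum (\<lambda>i. c * (case i of (l, n) \<Rightarrow> T l n)) UNIV"
    using xy by (simp add: IK_series_def FT)
  also have "\<dots> = c * infsetsum (\<lambda>(l, n). T l n) UNIV"
    using sT by (intro infsetsum_cmult_right)
  finally show ?thesis by (simp add: K c_def)
qed

text \<open>Multiplication of double series: collecting the pairs of indices by their sum leaves the Cauchy
product of the coefficients, and only its constant term does not vanish.\<close>

lemma infsetsum_collect_by_sum:
  fixes c d :: "nat \<Rightarrow> nat \<Rightarrow> complex" and E :: "nat \<Rightarrow> nat \<Rightarrow> complex"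
  assumes summable: "abs_summable (\<lambda>(i, j). c (fst i) (snd i) * d (fst j) (snd j) * E (fst i + fst j) (snd i + snd j))"
    and inverse: "\<And>L N. (\<Sum>l\<le>L. \<Sum>n\<le>N. c l n * d (L - l) (N - n)) = (if L = 0 \<and> N = 0 then 1 else 0)"
  shows "infsetsum (\<lambda>(i, j). c (fst i) (snd i) * d (fst j) (snd j) * E (fst i + fst j) (snd i + snd j)) UNIV = E 0 0"
proof -
  let ?f = "\<lambda>(i, j). c (fst i) (snd i) * d (fst j) (snd j) * E (fst i + fst j) (snd i + snd j)"
  define S where "S = Sigma (UNIV :: (nat \<times> nat) set) (\<lambda>s. {..fst s} \<times> {..snd s})"
  define h :: "(nat \<times> nat) \<times> (nat \<times> nat) \<Rightarrow> (nat \<times> nat) \<times> (nat \<times> nat)"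
    where "h = (\<lambda>(s, i). (i, (fst s - fst i, snd s - snd i)))"
  have h: "bij_betw h S UNIV"
  proof (rule bij_betw_byWitness[where f'="\<lambda>(i, j). ((fst i + fst j, snd i + snd j), i)"])
  qed (auto simp: h_def S_def)
  have "infsetsum ?f UNIV = infsetsum (\<lambda>si. ?f (h si)) S"
    by (rule infsetsum_reindex_bij_betw[OF h, symmetric])
  also have "\<dots> = infsetsum (\<lambda>(s, i). c (fst i) (snd i) * d (fst s - fst i) (snd s - snd i) * E (fst s) (snd s)) S"
    by (intro infsetsum_cong) (auto simp: h_def S_def)
  also have "\<dots> = infsetsum (\<lambda>s. infsetsum (\<lambda>i. c (fst i) (snd i) * d (fst s - fst i) (snd s - snd i) * E (fst s) (snd s))
      ({..fst s} \<times> {..snd s})) UNIV"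
    unfolding S_def
  proof (rule infsetsum_Sigma'[symmetric])
    have "Infinite_Set_Sum.abs_summable_on (\<lambda>si. ?f (h si)) S"
      using summable by (subst abs_summable_on_reindex_bij_betw[OF h])
    moreover have "Infinite_Set_Sum.abs_summable_on (\<lambda>si. ?f (h si)) S \<longleftrightarrow> Infinite_Set_Sum.abs_summable_on
        (\<lambda>(s, i). c (fst i) (snd i) * d (fst s - fst i) (snd s - snd i) * E (fst s) (snd s)) S"
      by (intro abs_summable_on_cong) (auto simp: h_def S_def)
    ultimately show "Infinite_Set_Sum.abs_summable_on
        (\<lambda>(s, i). c (fst i) (snd i) * d (fst s - fst i) (snd s - snd i) * E (fst s) (snd s))
        (Sigma UNIV (\<lambda>s. {..fst s} \<times> {..snd s}))"
      unfolding S_def by blast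
  qed auto
  also have "\<dots> = infsetsum (\<lambda>s. (if s = (0, 0) then 1 else 0) * E (fst s) (snd s)) UNIV"
  proof (intro infsetsum_cong refl)
    fix s :: "nat \<times> nat"
    have "infsetsum (\<lambda>i. c (fst i) (snd i) * d (fst s - fst i) (snd s - snd i) * E (fst s) (snd s))
      ({..fst s} \<times> {..snd s}) = (\<Sum>l\<le>fst s. \<Sum>n\<le>snd s. c l n * d (fst s - l) (snd s - n)) * E (fst s) (snd s)"
      by (simp add: sum.cartesian_product sum_distrib_right case_prod_unfold)
    also have "\<dots> = (if s = (0, 0) then 1 else 0) * E (fst s) (snd s)"
      by (cases s) (simp add: inverse)
    finally show "infsetsum (\<lambda>i. c (fst i) (snd i) * d (fst s - fst i) (snd s - snd i) * E (fst s) (snd s))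
      ({..fst s} \<times> {..snd s}) = (if s = (0, 0) then 1 else 0) * E (fst s) (snd s)" .
  qed
  also have "\<dots> = infsetsum (\<lambda>s. E (fst s) (snd s)) {(0, 0)}"
    by (rule infsetsum_cong_neutral) auto
  finally show ?thesis by simp
qed

lemma IK_term_eq_0: "\<not> (0 < fst z \<and> 0 < snd z) \<Longrightarrow> IK_term \<gamma>1 \<gamma>2 p q \<upsilon> w1 W i z = 0"
  by (auto simp: IK_term_def tensor_def power_kernel_def)

lemma convolution_IK_term:
  assumes "Re p > 0" "Re q > 0" "Re \<upsilon> > 0" "Re \<sigma> > 0" "Re \<tau> > 0"
  shows "convolution (IK_term \<gamma>1 \<gamma>2 p q \<upsilon> w1 W i) (IK_term \<gamma>1' \<gamma>2' \<sigma> \<tau> \<upsilon> w1 W j) z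
    = IK_coeff \<gamma>1 \<gamma>2 w1 W (fst i) (snd i) * IK_coeff \<gamma>1' \<gamma>2' w1 W (fst j) (snd j) *
      tensor (power_kernel (p + \<sigma> + of_nat (fst i + fst j))) (power_kernel (q + \<tau> + \<upsilon> * of_nat (snd i + snd j))) z"
proof -
  let ?a = "p + of_nat (fst i)" and ?b = "q + \<upsilon> * of_nat (snd i)"
    and ?c = "\<sigma> + of_nat (fst j)" and ?d = "\<tau> + \<upsilon> * of_nat (snd j)"
  have Re: "Re ?a > 0" "Re ?b > 0" "Re ?c > 0" "Re ?d > 0"
    using assms by (auto intro!: add_pos_nonneg)
  have "convolution (IK_term \<gamma>1 \<gamma>2 p q \<upsilon> w1 W i) (IK_term \<gamma>1' \<gamma>2' \<sigma> \<tau> \<upsilon> w1 W j) z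
    = IK_coeff \<gamma>1 \<gamma>2 w1 W (fst i) (snd i) * IK_coeff \<gamma>1' \<gamma>2' w1 W (fst j) (snd j) *
      convolution (tensor (power_kernel ?a) (power_kernel ?b)) (tensor (power_kernel ?c) (power_kernel ?d)) z"
    unfolding convolution_def IK_term_def
    by (subst integral_mult_right_zero[symmetric]) (simp add: mult_ac)
  also have "convolution (tensor (power_kernel ?a) (power_kernel ?b)) (tensor (power_kernel ?c) (power_kernel ?d))
    = tensor (power_kernel (?a + ?c)) (power_kernel (?b + ?d))"
    by (rule convolution_tensor_power_kernel[OF Re])
  also have "?a + ?c = p + \<sigma> + of_nat (fst i + fst j)" by simp
  also have "?b + ?d = q + \<tau> + \<upsilon> * of_nat (snd i + snd j)" by (simp add: algebra_simps)
  finally show ?thesis .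
qed

lemma enorm_power_weight: "ennreal (power_weight p q z) = ennreal (pos_power p (fst z)) * ennreal (pos_power q (snd z))"
  by (simp add: power_weight_def ennreal_mult)

lemma nn_convolution_power_weight:
  assumes "p > 0" "q > 0" "p' > 0" "q' > 0"
  obtains C where "C < \<infinity>" "\<And>z. nn_convolution (power_weight p q) (power_weight p' q') z = C * ennreal (power_weight (p + p') (q + q') z)"
proof -
  let ?C = "ennreal (Gamma p * Gamma p' / Gamma (p + p')) * ennreal (Gamma q * Gamma q' / Gamma (q + q'))"
  have "nn_convolution (power_weight p q) (power_weight p' q') z = ?C * ennreal (power_weight (p + p') (q + q') z)" for z
    unfolding enorm_power_weight
    by (subst nn_convolution_product) (use assms in \<open>simp_all add: nn_convolution_pos_power mult_ac\<close>)
  moreover have "?C < \<infinity>" by (simp add: ennreal_mult_less_top)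
  ultimately show thesis using that by blast
qed

text \<open>Term by term the convolution raises the orders of the power kernels additively; the coefficients
then collapse by \<open>IK_coeff_inverse\<close>. The restriction to the square is harmless: if \<open>z - u\<close> and \<open>u\<close>
have positive coordinates and \<open>z\<close> is in the square, then so are both of them.\<close>

theorem convolution_IK_series:
  assumes p: "Re p > 0" and q: "Re q > 0" and \<upsilon>: "Re \<upsilon> > 0" and \<sigma>: "Re \<sigma> > 0" and \<tau>: "Re \<tau> > 0"
    and z: "z \<in> corner_square R"
  shows "convolution (IK_series (- \<gamma>1) (- \<gamma>2) p q \<upsilon> w1 W R) (IK_series \<gamma>1 \<gamma>2 \<sigma> \<tau> \<upsilon> w1 W R) z
    = tensor (power_kernel (p + \<sigma>)) (power_kernel (q + \<tau>)) z"
proof -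
  have R: "R > 0" using z by (auto simp: corner_square_def)
  let ?F = "IK_term (- \<gamma>1) (- \<gamma>2) p q \<upsilon> w1 W" and ?G = "IK_term \<gamma>1 \<gamma>2 \<sigma> \<tau> \<upsilon> w1 W"
  let ?wF = "power_weight (Re p) (Re q)" and ?wG = "power_weight (Re \<sigma>) (Re \<tau>)"
  obtain M where M: "abs_summable M" "\<And>i. M i \<ge> 0"
    "\<And>i z. z \<in> corner_square R \<Longrightarrow> norm (?F i z) \<le> M i * ?wF z"
    using IK_term_bound[OF p q \<upsilon> R] by blast
  obtain N where N: "abs_summable N" "\<And>i. N i \<ge> 0"
    "\<And>i z. z \<in> corner_square R \<Longrightarrow> norm (?G i z) \<le> N i * ?wG z"
    using IK_term_bound[OF \<sigma> \<tau> \<upsilon> R] by blast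
  have zero: "?F i (z - u) * ?G j u = 0" if "\<not> (z - u \<in> corner_square R \<and> u \<in> corner_square R)" for i j u
  proof (rule ccontr)
    assume "?F i (z - u) * ?G j u \<noteq> 0"
    then have "?F i (z - u) \<noteq> 0" "?G j u \<noteq> 0" by auto
    then have "0 < fst (z - u) \<and> 0 < snd (z - u)" "0 < fst u \<and> 0 < snd u"
      using IK_term_eq_0 by blast+
    then show False using that z by (auto simp: corner_square_def mem_Times_iff)
  qed
  have bound: "norm (?F (fst ij) (z - u) * ?G (snd ij) u) \<le> (M (fst ij) * N (snd ij)) * (?wF (z - u) * ?wG u)" for ij u
  proof (cases "z - u \<in> corner_square R \<and> u \<in> corner_square R")
    case True
    then have "norm (?F (fst ij) (z - u)) * norm (?G (snd ij) u) \<le> (M (fst ij) * ?wF (z - u)) * (N (snd ij) * ?wG u)"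
      using M N by (intro mult_mono) auto
    then show ?thesis by (simp add: norm_mult mult_ac)
  next
    case False
    then show ?thesis unfolding zero[OF False] using M(2) N(2) by simp
  qed
  have prod_sum: "IK_series (- \<gamma>1) (- \<gamma>2) p q \<upsilon> w1 W R (z - u) * IK_series \<gamma>1 \<gamma>2 \<sigma> \<tau> \<upsilon> w1 W R u
     = infsetsum (\<lambda>ij. ?F (fst ij) (z - u) * ?G (snd ij) u) UNIV" for u
  proof (cases "z - u \<in> corner_square R \<and> u \<in> corner_square R")
    case True
    have "abs_summable (\<lambda>i. M i * ?wF (z - u))" "abs_summable (\<lambda>i. N i * ?wG u)"
      using M N by (intro abs_summable_on_cmult_left; simp)+
    with True M(3)[of "z - u"] N(3)[of u] have "abs_summable (\<lambda>i. ?F i (z - u))" "abs_summable (\<lambda>i. ?G i u)"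
      by (auto intro: abs_summable_on_comparison_test')
    from infsetsum_product[OF _ _ this] show ?thesis
      using True by (simp add: IK_series_def case_prod_unfold)
  next
    case False
    then have "IK_series (- \<gamma>1) (- \<gamma>2) p q \<upsilon> w1 W R (z - u) * IK_series \<gamma>1 \<gamma>2 \<sigma> \<tau> \<upsilon> w1 W R u = 0"
      by (auto simp: IK_series_def)
    then show ?thesis unfolding zero[OF False] by simp
  qed
  obtain C where "C < \<infinity>" "\<And>z. nn_convolution ?wF ?wG z = C * ennreal (power_weight (Re p + Re \<sigma>) (Re q + Re \<tau>) z)"
    using nn_convolution_power_weight[OF p q \<sigma> \<tau>] by blast
  then have "nn_convolution ?wF ?wG z < \<infinity>" by (simp add: ennreal_mult_less_top)
  then have w: "integrable lborel (\<lambda>u. ?wF (z - u) * ?wG u)"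
    by (intro integrableI_bounded) (auto simp: nn_convolution_def ennreal_mult)
  have MN: "abs_summable (\<lambda>ij. M (fst ij) * N (snd ij))"
    using abs_summable_on_product[OF _ _ M(1) N(1)] by (simp add: case_prod_unfold)
  have sf: "sigma_finite_measure (lborel :: (real \<times> real) measure)" by standard
  have meas: "(\<lambda>u. ?F (fst ij) (z - u) * ?G (snd ij) u) \<in> borel_measurable lborel" for ij
    by measurable
  note ex = abs_summable_on_integral[OF sf meas bound MN w] integral_infsetsum[OF sf meas bound MN w]
  let ?E = "\<lambda>L N. tensor (power_kernel (p + \<sigma> + of_nat L)) (power_kernel (q + \<tau> + \<upsilon> * of_nat N)) z"
  let ?c = "IK_coeff (- \<gamma>1) (- \<gamma>2) w1 W" and ?d = "IK_coeff \<gamma>1 \<gamma>2 w1 W"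
  have term_conv: "(\<lambda>ij. \<integral>u. ?F (fst ij) (z - u) * ?G (snd ij) u \<partial>lborel)
    = (\<lambda>(i, j). ?c (fst i) (snd i) * ?d (fst j) (snd j) * ?E (fst i + fst j) (snd i + snd j))"
    using convolution_IK_term[OF p q \<upsilon> \<sigma> \<tau>] by (auto simp: fun_eq_iff convolution_def)
  have "convolution (IK_series (- \<gamma>1) (- \<gamma>2) p q \<upsilon> w1 W R) (IK_series \<gamma>1 \<gamma>2 \<sigma> \<tau> \<upsilon> w1 W R) z
     = infsetsum (\<lambda>(i, j). ?c (fst i) (snd i) * ?d (fst j) (snd j) * ?E (fst i + fst j) (snd i + snd j)) UNIV"
    unfolding convolution_def prod_sum ex(2) term_conv ..
  also have "\<dots> = ?E 0 0"
    using ex(1) unfolding term_conv by (intro infsetsum_collect_by_sum IK_coeff_inverse)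
  finally show ?thesis by simp
qed

section \<open>Iterated Lebesgue integrals as convolutions\<close>

lemma lebesgue_integral_AE_eq_lborel:
  fixes f h :: "'a::euclidean_space \<Rightarrow> complex"
  assumes [measurable]: "h \<in> borel_measurable borel" and ae: "AE x in lborel. f x = h x"
  shows "(LINT x|lebesgue. f x) = (LINT x|lborel. h x)"
proof -
  have ae': "AE x in lebesgue. h x = f x"
    using AE_completion[OF ae] by eventually_elim simp
  have h: "h \<in> borel_measurable lebesgue"
    using assms(1) by (intro measurable_completion) simp
  have f: "f \<in> borel_measurable lebesgue"
    by (rule borel_measurable_AE[OF h ae'])
  have "(LINT x|lebesgue. f x) = (LINT x|lebesgue. h x)"
    using ae' by (intro integral_cong_AE f h) auto
  also have "\<dots> = (LINT x|lborel. h x)"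
    using assms(1) by (intro integral_completion) simp
  finally show ?thesis .
qed

text \<open>The integrand of the operators is only known up to a null set of the plane. On almost all lines it
still agrees almost everywhere with the Borel representative, and this suffices for both orders of
integration.\<close>

lemma lebesgue_iterated_integrals:
  fixes g :: "real \<Rightarrow> real \<Rightarrow> complex" and H :: "real \<times> real \<Rightarrow> complex"
  assumes H: "integrable lborel H" and ae: "AE p in lborel. g (fst p) (snd p) = H p"
  shows "(LINT x|lebesgue. LINT y|lebesgue. g x y) = (LINT p|lborel. H p)"
    and "(LINT y|lebesgue. LINT x|lebesgue. g x y) = (LINT p|lborel. H p)"
proof -
  have [measurable]: "H \<in> borel_measurable borel" using H by auto
  have H': "integrable (lborel \<Otimes>\<^sub>M lborel) (\<lambda>(x, y). H (x, y))"
    using H by (simp add: lborel_prod)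
  have ae0: "AE p in lborel \<Otimes>\<^sub>M lborel. g (fst p) (snd p) = H p"
    using ae unfolding lborel_prod .
  have ae1: "AE x in lborel. AE y in lborel. g x y = H (x, y)"
    using lborel_pair.AE_pair[OF ae0] by simp
  have "AE x in lborel. (LINT y|lebesgue. g x y) = (LINT y|lborel. H (x, y))"
    using ae1 by eventually_elim (rule lebesgue_integral_AE_eq_lborel, measurable)
  then have "(LINT x|lebesgue. LINT y|lebesgue. g x y) = (LINT x|lborel. LINT y|lborel. H (x, y))"
    by (intro lebesgue_integral_AE_eq_lborel) measurable
  also have "\<dots> = (LINT p|lborel. H p)"
    using lborel_pair.integral_fst[OF H'] by (simp add: lborel_prod)
  finally show "(LINT x|lebesgue. LINT y|lebesgue. g x y) = (LINT p|lborel. H p)" .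
  have "AE p in distr (lborel \<Otimes>\<^sub>M lborel) (lborel \<Otimes>\<^sub>M lborel) (\<lambda>(x, y). (y, x)). g (fst p) (snd p) = H p"
    unfolding lborel_pair.distr_pair_swap[symmetric] by (rule ae0)
  then have "AE p in lborel \<Otimes>\<^sub>M lborel. g (snd p) (fst p) = H (snd p, fst p)"
    by (auto dest!: AE_distrD[rotated] simp: case_prod_unfold)
  then have ae2: "AE y in lborel. AE x in lborel. g x y = H (x, y)"
    using lborel_pair.AE_pair[of "\<lambda>p. g (snd p) (fst p) = H (snd p, fst p)"] by simp
  have "AE y in lborel. (LINT x|lebesgue. g x y) = (LINT x|lborel. H (x, y))"
    using ae2 by eventually_elim (rule lebesgue_integral_AE_eq_lborel, measurable)
  then have "(LINT y|lebesgue. LINT x|lebesgue. g x y) = (LINT y|lborel. LINT x|lborel. H (x, y))"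
    by (intro lebesgue_integral_AE_eq_lborel) measurable
  also have "\<dots> = (LINT p|lborel. H p)"
    using lborel_pair.integral_snd[OF H'] by (simp add: lborel_prod)
  finally show "(LINT y|lebesgue. LINT x|lebesgue. g x y) = (LINT p|lborel. H p)" .
qed

text \<open>The supports of \<open>K\<close> and \<open>F\<close> encode the limits of integration: only \<open>a1 < \<xi> < z\<close> and \<open>b1 < y < t\<close>
contribute to the convolution at \<open>(z, t)\<close>.\<close>

lemma iterated_integrals_eq_convolution:
  fixes K F :: "real \<times> real \<Rightarrow> complex" and f :: "real \<Rightarrow> real \<Rightarrow> complex"
  assumes meas [measurable]: "K \<in> borel_measurable borel" "F \<in> borel_measurable borel"
    and fin: "nn_convolution (enorm K) (enorm F) (z, t) < \<infinity>"
    and K0: "\<And>x y. K (x, y) \<noteq> 0 \<Longrightarrow> x > 0 \<and> y > 0"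
    and F0: "\<And>x y. F (x, y) \<noteq> 0 \<Longrightarrow> x > a1 \<and> y > b1"
    and f: "AE p in lborel. p \<in> {a1<..<a2} \<times> {b1<..<b2} \<longrightarrow> f (fst p) (snd p) = F p"
    and zt: "z \<le> a2" "t \<le> b2"
  shows "(LINT y:{b1<..<t}|lebesgue. LINT \<xi>:{a1<..<z}|lebesgue. K (z - \<xi>, t - y) * f \<xi> y) = convolution K F (z, t)"
    and "(LINT \<xi>:{a1<..<z}|lebesgue. LINT y:{b1<..<t}|lebesgue. K (z - \<xi>, t - y) * f \<xi> y) = convolution K F (z, t)"
proof -
  define g where "g = (\<lambda>\<xi> y. indicator {b1<..<t} y *\<^sub>R indicator {a1<..<z} \<xi> *\<^sub>R (K (z - \<xi>, t - y) * f \<xi> y))"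
  define H where "H = (\<lambda>p. K ((z, t) - p) * F p)"
  have H: "integrable lborel H"
    unfolding H_def by (rule integrable_convolution_integrand[OF meas fin])
  have ae: "AE p in lborel. g (fst p) (snd p) = H p"
    using f
  proof eventually_elim
    case (elim p)
    then show ?case
      using K0[of "z - fst p" "t - snd p"] F0[of "fst p" "snd p"] zt
      by (cases p) (auto simp: g_def H_def indicator_def)
  qed
  have "(LINT y:{b1<..<t}|lebesgue. LINT \<xi>:{a1<..<z}|lebesgue. K (z - \<xi>, t - y) * f \<xi> y)
      = (LINT y|lebesgue. LINT \<xi>|lebesgue. g \<xi> y)"
    unfolding set_lebesgue_integral_def g_def by (simp del: scaleR_scaleR)
  also have "\<dots> = (LINT p|lborel. H p)" by (rule lebesgue_iterated_integrals(2)[OF H ae])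
  finally show "(LINT y:{b1<..<t}|lebesgue. LINT \<xi>:{a1<..<z}|lebesgue. K (z - \<xi>, t - y) * f \<xi> y) = convolution K F (z, t)"
    by (simp add: convolution_def H_def)
  have "(LINT \<xi>:{a1<..<z}|lebesgue. LINT y:{b1<..<t}|lebesgue. K (z - \<xi>, t - y) * f \<xi> y)
      = (LINT \<xi>|lebesgue. LINT y|lebesgue. g \<xi> y)"
    unfolding set_lebesgue_integral_def g_def
    by (simp add: scaleR_left_commute[of "indicator {b1<..<t} _"] del: scaleR_scaleR)
  also have "\<dots> = (LINT p|lborel. H p)" by (rule lebesgue_iterated_integrals(1)[OF H ae])
  finally show "(LINT \<xi>:{a1<..<z}|lebesgue. LINT y:{b1<..<t}|lebesgue. K (z - \<xi>, t - y) * f \<xi> y) = convolution K F (z, t)"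
    by (simp add: convolution_def H_def)
qed

section \<open>Lebesgue's differentiation theorem on the line\<close>

text \<open>The measure with density \<open>g\<close> vanishes on \<open>S\<close>, so by outer regularity \<open>S\<close> has open neighbourhoods
\<open>U\<close> of arbitrarily small measure. Every exceptional point is the centre of a small ball in \<open>U\<close>
whose mass is large compared with its radius; Vitali's covering lemma selects disjoint balls whose
fivefold enlargements still cover the exceptional set, and their total length is controlled by the
mass of \<open>U\<close>.\<close>

lemma negligible_upper_density_off_support:
  fixes g :: "real \<Rightarrow> real"
  assumes g: "integrable lborel g" and nonneg: "\<And>x. g x \<ge> 0"
    and zero: "\<And>x. x \<in> S \<Longrightarrow> g x = 0" and S: "S \<in> sets borel" and \<eta>: "\<eta> > 0"
  shows "negligible {x \<in> S. \<forall>\<delta>>0. \<exists>r>0. r < \<delta> \<and> (LINT u:ball x r|lborel. g u) > \<eta> * r}"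
    (is "negligible ?T")
  unfolding negligible_outer_le
proof (intro allI impI)
  fix e :: real assume e: "e > 0"
  have [measurable]: "g \<in> borel_measurable borel" using g by auto
  define M where "M = density lborel (\<lambda>x. ennreal (g x))"
  have sets_M [measurable_cong]: "sets M = sets borel" by (simp add: M_def)
  have spM: "space M = UNIV" by (simp add: M_def)
  have emM: "emeasure M A = ennreal (LINT u:A|lborel. g u)" if "A \<in> sets borel" for A
  proof -
    have "emeasure M A = (\<integral>\<^sup>+u. ennreal (indicator A u *\<^sub>R g u) \<partial>lborel)"
      using that by (auto simp: M_def emeasure_density indicator_def intro!: nn_integral_cong)
    also have "\<dots> = ennreal (LINT u:A|lborel. g u)"
      unfolding set_lebesgue_integral_def using that g nonneg
      by (intro nn_integral_eq_integral integrable_mult_indicator) auto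
    finally show ?thesis .
  qed
  interpret M: finite_measure M
    by standard (simp add: spM emM)
  have "(LINT u:S|lborel. g u) = 0"
    unfolding set_lebesgue_integral_def
    by (subst Bochner_Integration.integral_cong[where g="\<lambda>_. 0"]) (auto simp: indicator_def zero)
  then have "emeasure M S = 0" using emM[OF S] by simp
  moreover have "emeasure M S = (INF U \<in> {U. S \<subseteq> U \<and> open U}. emeasure M U)"
    by (rule outer_regular) (auto simp: sets_M spM emM S)
  ultimately have "(INF U \<in> {U. S \<subseteq> U \<and> open U}. emeasure M U) < ennreal (\<eta> * e / 10)"
    using \<eta> e by simp
  then obtain U where U: "S \<subseteq> U" "open U" "emeasure M U < ennreal (\<eta> * e / 10)"
    unfolding INF_less_iff by auto
  have "\<exists>r>0. r < 1 \<and> ball x r \<subseteq> U \<and> (LINT u:ball x r|lborel. g u) > \<eta> * r" if xT: "x \<in> ?T" for x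
  proof -
    from xT have "x \<in> U" using U by auto
    then obtain \<delta> where "\<delta> > 0" "ball x \<delta> \<subseteq> U"
      using U(2) open_contains_ball by blast
    moreover obtain r where "r > 0" "r < min 1 \<delta>" "(LINT u:ball x r|lborel. g u) > \<eta> * r"
    proof -
      have "min 1 \<delta> > 0" using \<open>\<delta> > 0\<close> by simp
      moreover have "\<forall>\<delta>>0. \<exists>r>0. r < \<delta> \<and> (LINT u:ball x r|lborel. g u) > \<eta> * r"
        using xT by simp
      ultimately show thesis using that by blast
    qed
    ultimately show ?thesis
      by (intro exI[of _ r]) auto
  qed
  then have "\<forall>x\<in>?T. \<exists>r. 0 < r \<and> r < 1 \<and> ball x r \<subseteq> U \<and> (LINT u:ball x r|lborel. g u) > \<eta> * r"
    by blast
  from bchoice[OF this] obtain r where r: "\<And>x. x \<in> ?T \<Longrightarrow> 0 < r x \<and> r x < 1 \<and> ball x (r x) \<subseteq> U \<and>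
      (LINT u:ball x (r x)|lborel. g u) > \<eta> * r x"
    by blast
  obtain C where C: "countable C" "C \<subseteq> ?T"
     "pairwise (\<lambda>i j. disjnt (ball i (r i)) (ball j (r j))) C"
     "?T \<subseteq> (\<Union>i\<in>C. ball i (5 * r i))"
  proof (rule Vitali_covering_lemma_balls[where S="?T" and K="?T" and a="\<lambda>x. x" and r=r and B=1])
    show "?T \<subseteq> (\<Union>i\<in>?T. ball i (r i))"
    proof
      fix x assume x: "x \<in> ?T"
      then have "x \<in> ball x (r x)" using r[OF x] by simp
      with x show "x \<in> (\<Union>i\<in>?T. ball i (r i))" by blast
    qed
    show "\<And>i. i \<in> ?T \<Longrightarrow> 0 < r i \<and> r i \<le> 1" using r by (meson less_imp_le)
  qed
  have bound: "measure lebesgue (\<Union>i\<in>F. ball i (5 * r i)) \<le> e" if F: "F \<subseteq> C" "finite F" for F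
  proof -
    have FT: "i \<in> ?T" if "i \<in> F" for i using F C that by auto
    have "measure lebesgue (\<Union>i\<in>F. ball i (5 * r i)) \<le> (\<Sum>i\<in>F. measure lebesgue (ball i (5 * r i)))"
      using F by (intro measure_UNION_le) auto
    also have "\<dots> = (\<Sum>i\<in>F. 10 * r i)"
    proof (rule sum.cong)
      fix i assume "i \<in> F"
      then have "r i > 0" using r FT by blast
      then show "measure lebesgue (ball i (5 * r i)) = 10 * r i"
        by (simp add: ball_eq_greaterThanLessThan)
    qed simp
    also have "\<dots> \<le> (\<Sum>i\<in>F. 10 / \<eta> * measure M (ball i (r i)))"
    proof (rule sum_mono)
      fix i assume "i \<in> F"
      then have "(LINT u:ball i (r i)|lborel. g u) > \<eta> * r i" "r i > 0" using r FT by blast+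
      moreover from this have "measure M (ball i (r i)) = (LINT u:ball i (r i)|lborel. g u)"
        using \<eta> by (simp add: measure_def emM) (meson enn2real_ennreal less_imp_le less_trans mult_pos_pos)
      ultimately show "10 * r i \<le> 10 / \<eta> * measure M (ball i (r i))"
        using \<eta> by (simp add: field_simps)
    qed
    also have "\<dots> = 10 / \<eta> * measure M (\<Union>i\<in>F. ball i (r i))"
    proof -
      have "disjoint_family_on (\<lambda>i. ball i (r i)) F"
        using C(3) F(1) by (auto simp: disjoint_family_on_def pairwise_def disjnt_def)
      then show ?thesis using F
        by (subst M.finite_measure_finite_Union) (auto simp: sum_distrib_left sets_M)
    qed
    also have "\<dots> \<le> 10 / \<eta> * measure M U"
    proof -
      have "(\<Union>i\<in>F. ball i (r i)) \<subseteq> U" using r FT by blast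
      then show ?thesis
        using \<eta> U by (intro mult_left_mono M.finite_measure_mono) (auto simp: sets_M)
    qed
    also have "\<dots> \<le> 10 / \<eta> * (\<eta> * e / 10)"
    proof -
      have "measure M U < \<eta> * e / 10"
        using U(3) \<eta> e unfolding M.emeasure_eq_measure by (simp add: ennreal_less_iff)
      then show ?thesis using \<eta> by (intro mult_left_mono) auto
    qed
    also have "\<dots> = e" using \<eta> by simp
    finally show ?thesis .
  qed
  show "\<exists>V. ?T \<subseteq> V \<and> V \<in> lmeasurable \<and> measure lebesgue V \<le> e"
  proof (intro exI conjI)
    have ball: "ball i (5 * r i) \<in> lmeasurable" for i by simp
    show "(\<Union>i\<in>C. ball i (5 * r i)) \<in> lmeasurable"
      by (rule fmeasurable_UN_bound[OF C(1) ball bound])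
    show "measure lebesgue (\<Union>i\<in>C. ball i (5 * r i)) \<le> e"
      by (rule measure_UN_bound[OF C(1) ball bound])
  qed (rule C(4))
qed

text \<open>For a rational \<open>c\<close> the positive part of \<open>f - c\<close> vanishes where \<open>f \<le> c\<close>, so almost everywhere there
its averages tend to zero. If \<open>c\<close> is slightly larger than \<open>f x\<close>, the averages of \<open>f\<close> near \<open>x\<close> are
therefore at most slightly larger than \<open>c\<close>. The cut-off at \<open>N\<close> makes the positive part integrable
also for negative \<open>c\<close>.\<close>

lemma AE_upper_average_le:
  fixes f :: "real \<Rightarrow> real"
  assumes f: "integrable lborel f"
  shows "AE x in lborel. \<forall>\<epsilon>>0. \<exists>\<delta>>0. \<forall>u v. u \<le> x \<longrightarrow> x \<le> v \<longrightarrow> v - u < \<delta> \<longrightarrow>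
     (LINT t:{u..<v}|lborel. f t) \<le> (f x + \<epsilon>) * (v - u)"
proof -
  have [measurable]: "f \<in> borel_measurable borel" using f by auto
  define g where "g N c = (\<lambda>x. if \<bar>x\<bar> < real N then max 0 (f x - c) else 0)" for N c
  define S where "S N c = {x. \<bar>x\<bar> \<ge> real N \<or> f x \<le> c}" for N c
  have [measurable]: "g N c \<in> borel_measurable borel" for N c
    unfolding g_def by measurable
  have g_int: "integrable lborel (g N c)" for N c
  proof (rule Bochner_Integration.integrable_bound)
    show "integrable lborel (\<lambda>x. \<bar>f x\<bar> + \<bar>c\<bar> * indicator {- real N..real N} x)"
      using f by (intro Bochner_Integration.integrable_add integrable_abs integrable_mult_right) auto
  qed (auto simp: g_def indicator_def)
  have neg: "negligible {x \<in> S N c. \<forall>\<delta>>0. \<exists>r>0. r < \<delta> \<and> (LINT u:ball x r|lborel. g N c u) > \<eta> * r}"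
    if "\<eta> > 0" for N c \<eta>
  proof (rule negligible_upper_density_off_support[OF g_int _ _ _ that])
    show "S N c \<in> sets borel"
      unfolding S_def by measurable
  qed (auto simp: g_def S_def)
  have "AE x in lborel. x \<in> S N c \<longrightarrow> (\<exists>\<delta>>0. \<forall>r>0. r < \<delta> \<longrightarrow> (LINT u:ball x r|lborel. g N c u) \<le> \<eta> * r)"
    if "\<eta> > 0" for N c \<eta>
  proof -
    have "AE x in lebesgue. x \<notin> {x \<in> S N c. \<forall>\<delta>>0. \<exists>r>0. r < \<delta> \<and> (LINT u:ball x r|lborel. g N c u) > \<eta> * r}"
      using neg[OF that] by (intro AE_not_in) (simp add: negligible_iff_null_sets)
    then show ?thesis
      unfolding AE_completion_iff not_less[symmetric] mem_Collect_eq by eventually_elim blast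
  qed
  then have "AE x in lborel. \<forall>N. \<forall>k. \<forall>c\<in>\<rat>. x \<in> S N c \<longrightarrow>
     (\<exists>\<delta>>0. \<forall>r>0. r < \<delta> \<longrightarrow> (LINT u:ball x r|lborel. g N c u) \<le> inverse (real (Suc k)) * r)"
    by (intro AE_all_countable[THEN iffD2] AE_ball_countable[THEN iffD2] allI ballI countable_rat) auto
  then show ?thesis
  proof eventually_elim
    case (elim x)
    show ?case
    proof (intro allI impI)
      fix \<epsilon> :: real assume \<epsilon>: "\<epsilon> > 0"
      obtain c where c: "c \<in> \<rat>" "f x < c" "c < f x + \<epsilon> / 2"
        using Rats_dense_in_real[of "f x" "f x + \<epsilon> / 2"] \<epsilon> by auto
      obtain k where k: "inverse (real (Suc k)) < \<epsilon> / 4"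
        using reals_Archimedean[of "\<epsilon> / 4"] \<epsilon> by auto
      obtain N :: nat where N: "\<bar>x\<bar> + 1 < real N" using reals_Archimedean2[of "\<bar>x\<bar> + 1"] by blast
      obtain \<delta> where \<delta>: "\<delta> > 0" "\<And>r. r > 0 \<Longrightarrow> r < \<delta> \<Longrightarrow>
          (LINT u:ball x r|lborel. g N c u) \<le> inverse (real (Suc k)) * r"
      proof -
        have "x \<in> S N c" using c by (simp add: S_def)
        with elim c(1) show thesis using that by blast
      qed
      show "\<exists>\<delta>>0. \<forall>u v. u \<le> x \<longrightarrow> x \<le> v \<longrightarrow> v - u < \<delta> \<longrightarrow>
         (LINT t:{u..<v}|lborel. f t) \<le> (f x + \<epsilon>) * (v - u)"
      proof (intro exI[of _ "min (1/2) (\<delta>/2)"] conjI allI impI)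
        fix u v assume uv: "u \<le> x" "x \<le> v" "v - u < min (1/2) (\<delta>/2)"
        show "(LINT t:{u..<v}|lborel. f t) \<le> (f x + \<epsilon>) * (v - u)"
        proof (cases "u = v")
          case True
          then show ?thesis by (simp add: set_lebesgue_integral_def)
        next
          case False
          with uv have h: "v - u > 0" by auto
          \<comment> \<open>An open ball around \<open>x\<close> that contains the interval; its radius only costs a factor that \<open>k\<close> absorbs.\<close>
          let ?r = "2 * (v - u)"
          have sub: "{u..<v} \<subseteq> ball x ?r" "ball x ?r \<subseteq> {x. \<bar>x\<bar> < real N}"
            using uv N h by (auto simp: dist_real_def)
          have int: "integrable lborel (\<lambda>t. c * indicator {u..<v} t)"
              "integrable lborel (\<lambda>t. indicator (ball x ?r) t *\<^sub>R g N c t)"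
            using h by simp (intro integrable_mult_indicator g_int, simp)
          have "(LINT t:{u..<v}|lborel. f t) \<le> (\<integral>t. c * indicator {u..<v} t + indicator (ball x ?r) t *\<^sub>R g N c t \<partial>lborel)"
            unfolding set_lebesgue_integral_def
          proof (rule integral_mono)
            show "integrable lborel (\<lambda>t. indicator {u..<v} t *\<^sub>R f t)"
              using f by (intro integrable_mult_indicator) auto
            show "integrable lborel (\<lambda>t. c * indicator {u..<v} t + indicator (ball x ?r) t *\<^sub>R g N c t)"
              by (rule Bochner_Integration.integrable_add[OF int])
            show "indicator {u..<v} t *\<^sub>R f t \<le> c * indicator {u..<v} t + indicator (ball x ?r) t *\<^sub>R g N c t" for t
              using sub by (auto simp: indicator_def g_def)
          qed
          also have "\<dots> = c * (v - u) + (LINT t:ball x ?r|lborel. g N c t)"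
            unfolding set_lebesgue_integral_def
            using h by (subst Bochner_Integration.integral_add[OF int]) simp
          also have "\<dots> \<le> (f x + \<epsilon> / 2) * (v - u) + inverse (real (Suc k)) * ?r"
            using \<delta>(2)[of ?r] h uv c by (intro add_mono mult_right_mono) auto
          also have "\<dots> \<le> (f x + \<epsilon> / 2) * (v - u) + \<epsilon> / 4 * ?r"
            using k h by (intro add_left_mono mult_right_mono) auto
          also have "\<dots> = (f x + \<epsilon>) * (v - u)" by (simp add: field_simps)
          finally show ?thesis .
        qed
      qed (use \<delta> in auto)
    qed
  qed
qed

lemma AE_average_real:
  fixes f :: "real \<Rightarrow> real"
  assumes f: "integrable lborel f"
  shows "AE x in lborel. \<forall>\<epsilon>>0. \<exists>\<delta>>0. \<forall>u v. u \<le> x \<longrightarrow> x \<le> v \<longrightarrow> v - u < \<delta> \<longrightarrow>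
     \<bar>(LINT t:{u..<v}|lborel. f t) - (v - u) * f x\<bar> \<le> \<epsilon> * (v - u)"
proof -
  have "integrable lborel (\<lambda>x. - f x)" using f by simp
  from AE_upper_average_le[OF f] AE_upper_average_le[OF this]
  show ?thesis
  proof eventually_elim
    case (elim x)
    show ?case
    proof (intro allI impI)
      fix \<epsilon> :: real assume "\<epsilon> > 0"
      then obtain d1 d2 where d: "d1 > 0" "d2 > 0"
        "\<And>u v. u \<le> x \<Longrightarrow> x \<le> v \<Longrightarrow> v - u < d1 \<Longrightarrow> (LINT t:{u..<v}|lborel. f t) \<le> (f x + \<epsilon>) * (v - u)"
        "\<And>u v. u \<le> x \<Longrightarrow> x \<le> v \<Longrightarrow> v - u < d2 \<Longrightarrow> (LINT t:{u..<v}|lborel. - f t) \<le> (- f x + \<epsilon>) * (v - u)"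
        using elim(1)[rule_format, of \<epsilon>] elim(2)[rule_format, of \<epsilon>] by blast
      show "\<exists>\<delta>>0. \<forall>u v. u \<le> x \<longrightarrow> x \<le> v \<longrightarrow> v - u < \<delta> \<longrightarrow>
         \<bar>(LINT t:{u..<v}|lborel. f t) - (v - u) * f x\<bar> \<le> \<epsilon> * (v - u)"
      proof (intro exI[of _ "min d1 d2"] conjI allI impI)
        fix u v assume "u \<le> x" "x \<le> v" "v - u < min d1 d2"
        with d(3)[of u v] d(4)[of u v]
        show "\<bar>(LINT t:{u..<v}|lborel. f t) - (v - u) * f x\<bar> \<le> \<epsilon> * (v - u)"
          by (simp add: set_lebesgue_integral_def algebra_simps abs_le_iff)
      qed (use d in auto)
    qed
  qed
qed

definition primitive :: "(real \<Rightarrow> complex) \<Rightarrow> real \<Rightarrow> complex"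
  where "primitive f x = (LINT t:{..<x}|lborel. f t)"

lemma primitive_diff:
  fixes f :: "real \<Rightarrow> complex"
  assumes f: "integrable lborel f" and "u \<le> v"
  shows "primitive f v - primitive f u = (LINT t:{u..<v}|lborel. f t)"
proof -
  have "indicator {..<v} t *\<^sub>R f t = indicator {..<u} t *\<^sub>R f t + indicator {u..<v} t *\<^sub>R f t" for t
    using assms(2) by (auto simp: indicator_def)
  then show ?thesis
    unfolding primitive_def set_lebesgue_integral_def using f
    by (simp add: integrable_mult_indicator)
qed

theorem AE_primitive_has_vector_derivative:
  fixes f :: "real \<Rightarrow> complex"
  assumes f: "integrable lborel f"
  shows "AE x in lborel. (primitive f has_vector_derivative f x) (at x)"
proof -
  have "integrable lborel (\<lambda>x. Re (f x))" "integrable lborel (\<lambda>x. Im (f x))"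
    using f by auto
  from AE_average_real[OF this(1)] AE_average_real[OF this(2)]
  show ?thesis
  proof eventually_elim
    case (elim x)
    show ?case
      unfolding has_vector_derivative_def has_derivative_at_alt
    proof (intro conjI allI impI)
      fix \<epsilon> :: real assume "\<epsilon> > 0"
      then have "\<epsilon>/2 > 0" by simp
      then obtain d1 d2 where d: "d1 > 0" "d2 > 0"
        "\<And>u v. u \<le> x \<Longrightarrow> x \<le> v \<Longrightarrow> v - u < d1 \<Longrightarrow>
          \<bar>(LINT t:{u..<v}|lborel. Re (f t)) - (v - u) * Re (f x)\<bar> \<le> \<epsilon>/2 * (v - u)"
        "\<And>u v. u \<le> x \<Longrightarrow> x \<le> v \<Longrightarrow> v - u < d2 \<Longrightarrow>
          \<bar>(LINT t:{u..<v}|lborel. Im (f t)) - (v - u) * Im (f x)\<bar> \<le> \<epsilon>/2 * (v - u)"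
        using elim(1)[rule_format, of "\<epsilon>/2"] elim(2)[rule_format, of "\<epsilon>/2"] by blast
      have *: "norm (primitive f v - primitive f u - (v - u) *\<^sub>R f x) \<le> \<epsilon> * (v - u)"
        if uv: "u \<le> x" "x \<le> v" "v - u < min d1 d2" for u v
      proof -
        let ?I = "LINT t:{u..<v}|lborel. f t"
        have int: "integrable lborel (\<lambda>t. indicator {u..<v} t *\<^sub>R f t)"
          using f by (intro integrable_mult_indicator) auto
        have "Re ?I = (LINT t:{u..<v}|lborel. Re (f t))" "Im ?I = (LINT t:{u..<v}|lborel. Im (f t))"
          unfolding set_lebesgue_integral_def using int by (simp_all flip: integral_Re integral_Im)
        then have "norm (?I - (v - u) *\<^sub>R f x) \<le> \<epsilon>/2 * (v - u) + \<epsilon>/2 * (v - u)"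
          using d(3)[of u v] d(4)[of u v] uv
          by (intro cmod_le[THEN order_trans] add_mono) auto
        moreover have "primitive f v - primitive f u = ?I"
          using f uv by (intro primitive_diff) auto
        ultimately show ?thesis by simp
      qed
      show "\<exists>d>0. \<forall>y. norm (y - x) < d \<longrightarrow>
        norm (primitive f y - primitive f x - (y - x) *\<^sub>R f x) \<le> \<epsilon> * norm (y - x)"
      proof (intro exI[of _ "min d1 d2"] conjI allI impI)
        fix y assume y: "norm (y - x) < min d1 d2"
        show "norm (primitive f y - primitive f x - (y - x) *\<^sub>R f x) \<le> \<epsilon> * norm (y - x)"
        proof (cases "x \<le> y")
          case True
          with *[of x y] y show ?thesis by simp
        next
          case False
          have "primitive f y - primitive f x - (y - x) *\<^sub>R f x = - (primitive f x - primitive f y - (x - y) *\<^sub>R f x)"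
            by (simp add: algebra_simps)
          then have "norm (primitive f y - primitive f x - (y - x) *\<^sub>R f x) = norm (primitive f x - primitive f y - (x - y) *\<^sub>R f x)"
            by (simp only: norm_minus_cancel)
          then show ?thesis using *[of y x] y False by simp
        qed
      qed (use d in auto)
    qed (rule bounded_linear_scaleR_left)
  qed
qed

section \<open>Iterated derivatives of fractional integrals of integer order\<close>

lemma nth_deriv_SucI:
  assumes S: "open S" "x \<in> S"
    and n: "\<And>y. y \<in> S \<Longrightarrow> nth_differentiable n f y \<and> nth_deriv n f y = g y"
    and g: "(g has_vector_derivative v) (at x)"
  shows "nth_differentiable (Suc n) f x \<and> nth_deriv (Suc n) f x = v"
proof -
  have *: "(nth_deriv n f has_vector_derivative v) (at x)"
    using n by (intro has_vector_derivative_transform_within_open[OF g S]) auto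
  moreover have "\<forall>\<^sub>F y in nhds x. nth_differentiable n f y"
    using n S by (auto simp: eventually_nhds)
  ultimately show ?thesis
    using vector_derivative_at[OF *] differentiableI_vector[OF *] by (simp add: nth_deriv_def)
qed

lemma nth_deriv_chain:
  assumes S: "open S"
    and step: "\<And>i y. i < n \<Longrightarrow> y \<in> S \<Longrightarrow> (G i has_vector_derivative G (Suc i) y) (at y)"
    and f: "\<And>y. y \<in> S \<Longrightarrow> f y = G 0 y"
    and x: "x \<in> S"
  shows "nth_differentiable n f x \<and> nth_deriv n f x = G n x"
  using step x
proof (induction n arbitrary: x)
  case 0
  then show ?case using f by (simp add: nth_deriv_def)
next
  case (Suc n)
  show ?case
    by (rule nth_deriv_SucI[where g="G n", OF S \<open>x \<in> S\<close>]) (use Suc in auto)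
qed

lemma convolution_power_kernel_1: "convolution (power_kernel 1) f = primitive f"
proof
  fix x
  have "power_kernel 1 (x - u) * f u = indicator {..<x} u *\<^sub>R f u" for u
    by (auto simp: power_kernel_def indicator_def)
  then show "convolution (power_kernel 1) f x = primitive f x"
    by (simp add: convolution_def primitive_def set_lebesgue_integral_def)
qed

lemma pos_power_mono:
  assumes "c \<ge> 1" "x \<le> y"
  shows "pos_power c x \<le> pos_power c y"
  using assms by (auto simp: pos_power_def intro: powr_mono2)

text \<open>Kernels of order at least one are bounded on bounded sets, and \<open>f\<close> vanishes up to \<open>a\<close>.\<close>

lemma nn_convolution_pos_power_finite:
  fixes f :: "real \<Rightarrow> complex"
  assumes c: "c \<ge> 1" and f: "integrable lborel f" and f0: "\<forall>x\<le>a. f x = 0"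
  shows "nn_convolution (pos_power c) (enorm f) x < \<infinity>"
proof -
  have [measurable]: "f \<in> borel_measurable borel" using f by auto
  have "nn_convolution (pos_power c) (enorm f) x \<le> (\<integral>\<^sup>+u. ennreal (pos_power c (x - a)) * enorm f u \<partial>lborel)"
    unfolding nn_convolution_def
  proof (rule nn_integral_mono)
    fix u
    show "ennreal (pos_power c (x - u)) * enorm f u \<le> ennreal (pos_power c (x - a)) * enorm f u"
      using f0[rule_format, of u] pos_power_mono[OF c, of "x - u" "x - a"]
      by (cases "u \<le> a") (auto intro!: mult_right_mono ennreal_leI)
  qed
  also have "\<dots> = ennreal (pos_power c (x - a)) * (\<integral>\<^sup>+u. enorm f u \<partial>lborel)"
    by (rule nn_integral_cmult) measurable
  also have "\<dots> < \<infinity>"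
    using f by (auto simp: integrable_iff_bounded ennreal_mult_less_top)
  finally show ?thesis .
qed

text \<open>The semigroup law, with the power kernel of order one as the kernel of the primitive.\<close>

lemma convolution_power_kernel_Suc:
  fixes f :: "real \<Rightarrow> complex"
  assumes f: "integrable lborel f" and f0: "\<forall>x\<le>a. f x = 0"
  shows "convolution (power_kernel (of_nat (Suc (Suc n)))) f = primitive (convolution (power_kernel (of_nat (Suc n))) f)"
proof
  fix x
  have [measurable]: "f \<in> borel_measurable borel" using f by auto
  define c where "c = ennreal (1 / norm (Gamma (1::complex))) * ennreal (1 / norm (Gamma (of_nat (Suc n) :: complex)))
     * ennreal (Gamma 1 * Gamma (real (Suc n)) / Gamma (1 + real (Suc n)))"
  have "nn_convolution (enorm (power_kernel 1)) (nn_convolution (enorm (power_kernel (of_nat (Suc n)))) (enorm f)) x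
      = nn_convolution (nn_convolution (enorm (power_kernel 1)) (enorm (power_kernel (of_nat (Suc n))))) (enorm f) x"
    by (rule nn_convolution_assoc) measurable
  also have "nn_convolution (enorm (power_kernel 1)) (enorm (power_kernel (of_nat (Suc n)))) =
     (\<lambda>x. c * ennreal (pos_power (1 + real (Suc n)) x))"
  proof
    fix x
    have "nn_convolution (enorm (power_kernel 1)) (enorm (power_kernel (of_nat (Suc n)))) x
      = ennreal (1 / norm (Gamma (1::complex))) * ennreal (1 / norm (Gamma (of_nat (Suc n) :: complex)))
        * nn_convolution (pos_power 1) (pos_power (real (Suc n))) x"
      unfolding enorm_power_kernel nn_convolution_def
      by (subst nn_integral_cmult[symmetric]) (auto intro!: nn_integral_cong simp: mult_ac simp del: of_nat_Suc)
    then show "nn_convolution (enorm (power_kernel 1)) (enorm (power_kernel (of_nat (Suc n)))) x =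
       c * ennreal (pos_power (1 + real (Suc n)) x)"
      by (subst (asm) nn_convolution_pos_power) (auto simp: c_def mult_ac simp del: of_nat_Suc)
  qed
  also have "nn_convolution (\<lambda>x. c * ennreal (pos_power (1 + real (Suc n)) x)) (enorm f) x
      = c * nn_convolution (pos_power (1 + real (Suc n))) (enorm f) x"
    unfolding nn_convolution_def by (subst nn_integral_cmult[symmetric]) (auto simp: mult_ac)
  also have "\<dots> < \<infinity>"
    using nn_convolution_pos_power_finite[OF _ f f0, of "1 + real (Suc n)" x]
    by (auto simp: c_def ennreal_mult_less_top)
  finally have "convolution (power_kernel 1) (convolution (power_kernel (of_nat (Suc n))) f) x
     = convolution (convolution (power_kernel 1) (power_kernel (of_nat (Suc n)))) f x"
    by (intro convolution_assoc) auto
  also have "convolution (power_kernel 1) (power_kernel (of_nat (Suc n))) = power_kernel (of_nat (Suc (Suc n)))"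
    by (subst convolution_power_kernel) auto
  finally show "convolution (power_kernel (of_nat (Suc (Suc n)))) f x = primitive (convolution (power_kernel (of_nat (Suc n))) f) x"
    by (simp add: convolution_power_kernel_1)
qed

lemma isCont_primitive:
  assumes f: "integrable lborel f"
  shows "isCont (primitive f) x"
  unfolding continuous_at_sequentially
proof (intro allI impI)
  fix y :: "nat \<Rightarrow> real" assume y: "y \<longlonglongrightarrow> x"
  have [measurable]: "f \<in> borel_measurable borel" using f by auto
  show "(primitive f \<circ> y) \<longlonglongrightarrow> primitive f x"
    unfolding primitive_def o_def set_lebesgue_integral_def
  proof (rule integral_dominated_convergence[where w="\<lambda>t. norm (f t)"])
    have "AE t in lborel. t \<noteq> x" by (rule AE_lborel_singleton)
    then show "AE t in lborel. (\<lambda>n. indicator {..<y n} t *\<^sub>R f t) \<longlonglongrightarrow> indicator {..<x} t *\<^sub>R f t"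
    proof eventually_elim
      case (elim t)
      then consider "t < x" | "x < t" by linarith
      then show ?case
      proof cases
        case 1
        then have "\<forall>\<^sub>F n in sequentially. t < y n" using y by (intro order_tendstoD)
        then show ?thesis using 1 by (intro tendsto_eventually) (auto elim!: eventually_mono)
      next
        case 2
        then have "\<forall>\<^sub>F n in sequentially. y n < t" using y by (intro order_tendstoD)
        then show ?thesis using 2 by (intro tendsto_eventually) (auto elim!: eventually_mono)
      qed
    qed
  qed (use f in \<open>auto simp: indicator_def\<close>)
qed

text \<open>Since \<open>g\<close> vanishes up to \<open>a\<close>, the integral over a half-line is one over a bounded interval, to
which the fundamental theorem of calculus applies.\<close>

lemma primitive_has_vector_derivative_continuous:
  assumes g: "\<And>x. isCont g x" and g0: "\<forall>x\<le>a. g x = 0"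
  shows "(primitive g has_vector_derivative g x) (at x)"
proof -
  define a' where "a' = min a x - 1"
  have cont: "continuous_on A g" for A using g by (intro continuous_at_imp_continuous_on) auto
  have eq: "primitive g y = integral {a'..y} g" for y
  proof -
    have int: "set_integrable lborel {a'..y} g"
      by (rule borel_integrable_atLeastAtMost'[OF cont])
    have [measurable]: "g \<in> borel_measurable borel"
      by (rule borel_measurable_continuous_onI[OF cont])
    have "AE t in lborel. t \<noteq> y" by (rule AE_lborel_singleton)
    then have "AE t in lborel. indicator {..<y} t *\<^sub>R g t = indicator {a'..y} t *\<^sub>R g t"
      by eventually_elim (auto simp: indicator_def a'_def intro!: g0[rule_format])
    then have "primitive g y = (LINT t:{a'..y}|lborel. g t)"
      unfolding primitive_def set_lebesgue_integral_def by (intro integral_cong_AE) auto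
    also have "\<dots> = integral {a'..y} g"
      by (rule set_borel_integral_eq_integral(2)[OF int])
    finally show ?thesis .
  qed
  have "((\<lambda>u. integral {a'..u} g) has_vector_derivative g x) (at x within {a'..x + 1})"
    by (rule integral_has_vector_derivative[OF cont]) (auto simp: a'_def)
  moreover have "at x within {a'..x + 1} = at x"
    by (rule at_within_interior) (auto simp: a'_def)
  ultimately show ?thesis by (simp add: eq[abs_def])
qed

lemma convolution_power_kernel_eq_0:
  assumes "\<forall>x\<le>a. f x = 0" "x \<le> a"
  shows "convolution (power_kernel c) f x = 0"
proof -
  have "power_kernel c (x - u) * f u = 0" for u
    using assms by (cases "u \<le> a") (auto simp: power_kernel_def)
  then show ?thesis unfolding convolution_def by (simp only: Bochner_Integration.integral_zero)
qed

lemma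
  fixes f :: "real \<Rightarrow> complex"
  assumes f: "integrable lborel f" and f0: "\<forall>x\<le>a. f x = 0"
  shows isCont_convolution_power_kernel: "isCont (convolution (power_kernel (of_nat (Suc n))) f) x"
    and convolution_power_kernel_has_vector_derivative:
      "(convolution (power_kernel (of_nat (Suc (Suc n)))) f has_vector_derivative
          convolution (power_kernel (of_nat (Suc n))) f x) (at x)"
proof -
  have deriv: "(convolution (power_kernel (of_nat (Suc (Suc n)))) f has_vector_derivative
          convolution (power_kernel (of_nat (Suc n))) f x) (at x)"
    if "\<And>x. isCont (convolution (power_kernel (of_nat (Suc n))) f) x" for n x
    unfolding convolution_power_kernel_Suc[OF f f0]
    by (rule primitive_has_vector_derivative_continuous[OF that])
      (intro allI impI convolution_power_kernel_eq_0[OF f0])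
  have cont: "isCont (convolution (power_kernel (of_nat (Suc n))) f) x" for n x
  proof (induction n arbitrary: x)
    case 0
    show ?case using isCont_primitive[OF f] by (simp add: convolution_power_kernel_1)
  next
    case (Suc n)
    then show ?case using deriv has_vector_derivative_continuous by blast
  qed
  show "isCont (convolution (power_kernel (of_nat (Suc n))) f) x" by (rule cont)
  show "(convolution (power_kernel (of_nat (Suc (Suc n)))) f has_vector_derivative
          convolution (power_kernel (of_nat (Suc n))) f x) (at x)"
    by (rule deriv) (rule cont)
qed

text \<open>The first \<open>n - 1\<close> derivatives exist everywhere and lower the order of the power kernel down to
one. The last step, from the primitive of \<open>f\<close> to \<open>f\<close>, is possible at points where the primitive is
differentiable.\<close>

lemma nth_deriv_convolution_power_kernel:
  fixes f :: "real \<Rightarrow> complex"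
  assumes f: "integrable lborel f" and f0: "\<forall>x\<le>a. f x = 0"
    and S: "open S" "x \<in> S" and n: "n > 0"
    and \<phi>: "\<And>y. y \<in> S \<Longrightarrow> \<phi> y = convolution (power_kernel (of_nat n)) f y"
    and v: "(primitive f has_vector_derivative v) (at x)"
  shows "nth_differentiable n \<phi> x \<and> nth_deriv n \<phi> x = v"
proof -
  obtain m where m: "n = Suc m" using n by (cases n) auto
  define G where "G i = convolution (power_kernel (of_nat (Suc (m - i)))) f" for i
  have "nth_differentiable m \<phi> y \<and> nth_deriv m \<phi> y = G m y" if "y \<in> S" for y
  proof (rule nth_deriv_chain[OF S(1) _ _ that])
    fix i y assume "i < m"
    then have "m - i = Suc (m - Suc i)" by simp
    then show "(G i has_vector_derivative G (Suc i) y) (at y)"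
      unfolding G_def using convolution_power_kernel_has_vector_derivative[OF f f0, of "m - Suc i" y] by simp
  qed (simp add: \<phi> m G_def)
  moreover have "G m = primitive f" by (simp add: G_def convolution_power_kernel_1)
  ultimately show ?thesis
    unfolding m by (intro nth_deriv_SucI[OF S _ v]) auto
qed

section \<open>Differentiation of double integrals\<close>

text \<open>The \<open>s\<close>-fold integral up to \<open>t\<close> of the restriction of \<open>D\<close> to the vertical line through \<open>x\<close>; the
parameter \<open>t\<close> comes first because this is differentiated as a function of \<open>x\<close>.\<close>

definition slice_integral :: "nat \<Rightarrow> (real \<times> real \<Rightarrow> complex) \<Rightarrow> real \<Rightarrow> real \<Rightarrow> complex"
  where "slice_integral s D t x = convolution (power_kernel (of_nat s)) (\<lambda>y. D (x, y)) t"

lemma power_kernel_of_nat: "power_kernel (of_nat s) x = of_real (pos_power (real s) x / Gamma (real s))"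
proof (cases "x > 0")
  case True
  have "complex_of_real x powr (of_nat s - 1) = of_real (x powr (real s - 1))"
    using True powr_of_real[of x "real s - 1"] by simp
  then show ?thesis using True
    by (simp add: power_kernel_def pos_power_def Gamma_complex_of_real[symmetric])
qed (simp add: power_kernel_def pos_power_def)

text \<open>The power kernels of positive integer order are real, nonnegative and increasing.\<close>

lemma norm_power_kernel_of_nat_diff:
  assumes "s > 0" "x \<le> y"
  shows "norm (power_kernel (of_nat s) y - power_kernel (of_nat s) x)
    = norm (power_kernel (of_nat s) y) - norm (power_kernel (of_nat s) x)"
proof -
  have G: "Gamma (real s) > 0" using assms by (intro Gamma_real_pos) auto
  have "pos_power (real s) x \<le> pos_power (real s) y" using assms by (intro pos_power_mono) auto
  then show ?thesis
    using G unfolding power_kernel_of_nat of_real_diff[symmetric] norm_of_real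
    by (simp add: abs_of_nonneg divide_right_mono)
qed

lemma norm_power_kernel_of_nat_mono:
  assumes "s > 0" "x \<le> y"
  shows "norm (power_kernel (of_nat s) x) \<le> norm (power_kernel (of_nat s) y)"
  using norm_power_kernel_of_nat_diff[OF assms] norm_ge_zero[of "power_kernel (of_nat s) y - power_kernel (of_nat s) x"]
  by linarith

locale integrable_on_quadrant =
  fixes D :: "real \<times> real \<Rightarrow> complex" and a b :: real
  assumes D: "integrable lborel D" and D0: "\<And>x y. x \<le> a \<or> y \<le> b \<Longrightarrow> D (x, y) = 0"
begin

lemma borel_D [measurable]: "D \<in> borel_measurable borel"
  using D by auto

lemma D_pair: "integrable (lborel \<Otimes>\<^sub>M lborel) D"
  using D by (simp add: lborel_prod)

lemma AE_slice_integrable: "AE x in lborel. integrable lborel (\<lambda>y. D (x, y))"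
  using lborel_pair.AE_integrable_fst'[OF D_pair] .

lemma bounded_mult_integrable:
  assumes [measurable]: "k \<in> borel_measurable borel" and "\<And>y. y \<ge> b \<Longrightarrow> norm (k y :: complex) \<le> C"
  shows "integrable (lborel \<Otimes>\<^sub>M lborel) (\<lambda>(x, y). k y * D (x, y))"
proof (rule Bochner_Integration.integrable_bound)
  show "integrable (lborel \<Otimes>\<^sub>M lborel) (\<lambda>p. C * norm (D p))"
    using D_pair by (intro integrable_mult_right integrable_norm)
  show "AE p in lborel \<Otimes>\<^sub>M lborel. norm (case p of (x, y) \<Rightarrow> k y * D (x, y)) \<le> norm (C * norm (D p))"
  proof (intro AE_I2, clarify)
    fix x y
    show "norm (k y * D (x, y)) \<le> norm (C * norm (D (x, y)))"
    proof (cases "y \<ge> b")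
      case True
      then have "norm (k y) * norm (D (x, y)) \<le> C * norm (D (x, y))"
        using assms(2) by (intro mult_right_mono) auto
      then show ?thesis by (simp add: norm_mult)
    qed (simp add: D0)
  qed
qed measurable

lemma integrable_slice_integral:
  assumes "s > 0"
  shows "integrable lborel (slice_integral s D t)"
proof -
  have "integrable (lborel \<Otimes>\<^sub>M lborel) (\<lambda>(x, y). power_kernel (of_nat s) (t - y) * D (x, y))"
    using assms by (intro bounded_mult_integrable[where C="norm (power_kernel (of_nat s) (t - b))"])
      (auto intro: norm_power_kernel_of_nat_mono)
  from lborel_pair.integrable_fst[OF this]
  show ?thesis by (simp add: slice_integral_def[abs_def] convolution_def)
qed

lemma slice_integral_eq_0: "x \<le> a \<Longrightarrow> slice_integral s D t x = 0"
  by (simp add: slice_integral_def convolution_def D0)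

lemma slice_kernel_integrable:
  assumes x: "integrable lborel (\<lambda>y. D (x, y))" and s: "s > 0"
  shows "integrable lborel (\<lambda>y. power_kernel (of_nat s) (t - y) * D (x, y))"
proof (rule Bochner_Integration.integrable_bound)
  show "integrable lborel (\<lambda>y. norm (power_kernel (of_nat s) (t - b)) * norm (D (x, y)))"
    using x by (intro integrable_mult_right integrable_norm)
  have "norm (power_kernel (of_nat s) (t - y) * D (x, y)) \<le> norm (power_kernel (of_nat s) (t - b)) * norm (D (x, y))" for y
    using s D0[of x y] norm_power_kernel_of_nat_mono[of s "t - y" "t - b"]
    by (cases "y \<le> b") (auto simp: norm_mult intro!: mult_right_mono)
  then show "AE y in lborel. norm (power_kernel (of_nat s) (t - y) * D (x, y))
     \<le> norm (norm (power_kernel (of_nat s) (t - b)) * norm (D (x, y)))"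
    by simp
qed measurable

lemma abs_quadrant: "integrable_on_quadrant (\<lambda>p. of_real (norm (D p))) a b"
  by standard (use D D0 in auto)

abbreviation "abs_slice_integral s t x \<equiv> slice_integral s (\<lambda>p. of_real (norm (D p))) t x"

text \<open>By monotonicity of the power kernel the modulus of continuity in \<open>t\<close> is bounded, for all \<open>t\<close>
between \<open>r\<close> and \<open>r'\<close> at once, by an increment of the slice integrals of the absolute value of \<open>D\<close>.\<close>

lemma norm_slice_integral_diff_le:
  assumes x: "integrable lborel (\<lambda>y. D (x, y))" and s: "s > 0" and t: "r \<le> t" "t \<le> r'"
  shows "norm (slice_integral s D t x - slice_integral s D r x) \<le> Re (abs_slice_integral s r' x - abs_slice_integral s r x)"
proof -
  interpret abs: integrable_on_quadrant "\<lambda>p. of_real (norm (D p))" a b by (rule abs_quadrant)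
  have nx: "integrable lborel (\<lambda>y. complex_of_real (norm (D (x, y))))"
    using x by simp
  let ?k = "\<lambda>t y. power_kernel (of_nat s) (t - y)"
  note i = slice_kernel_integrable[OF x s] abs.slice_kernel_integrable[OF nx s]
  have "slice_integral s D t x - slice_integral s D r x = (\<integral>y. ?k t y * D (x, y) - ?k r y * D (x, y) \<partial>lborel)"
    using i by (simp add: slice_integral_def convolution_def)
  also have "norm \<dots> \<le> (\<integral>y. norm (?k t y * D (x, y) - ?k r y * D (x, y)) \<partial>lborel)"
    by (rule integral_norm_bound)
  also have "\<dots> \<le> (\<integral>y. Re (?k r' y * of_real (norm (D (x, y))) - ?k r y * of_real (norm (D (x, y)))) \<partial>lborel)"
  proof (rule integral_mono)
    fix y
    have "norm (?k t y * D (x, y) - ?k r y * D (x, y)) = norm (?k t y - ?k r y) * norm (D (x, y))"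
      by (simp add: norm_mult[symmetric] algebra_simps)
    also have "\<dots> \<le> norm (?k r' y - ?k r y) * norm (D (x, y))"
      using s t norm_power_kernel_of_nat_mono[of s "t - y" "r' - y"]
      by (intro mult_right_mono) (auto simp: norm_power_kernel_of_nat_diff)
    also have "norm (?k r' y - ?k r y) = Re (?k r' y - ?k r y)"
    proof -
      have "Re (?k u y) = norm (?k u y)" for u
        using s by (simp add: power_kernel_of_nat norm_divide Gamma_real_pos abs_of_nonneg less_imp_le)
      then show ?thesis using s t by (simp add: norm_power_kernel_of_nat_diff)
    qed
    also have "\<dots> * norm (D (x, y)) = Re (?k r' y * of_real (norm (D (x, y))) - ?k r y * of_real (norm (D (x, y))))"
      by (simp add: algebra_simps)
    finally show "norm (?k t y * D (x, y) - ?k r y * D (x, y))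
      \<le> Re (?k r' y * of_real (norm (D (x, y))) - ?k r y * of_real (norm (D (x, y))))" .
  qed (intro integrable_norm integrable_Re Bochner_Integration.integrable_diff i)+
  also have "\<dots> = Re (abs_slice_integral s r' x - abs_slice_integral s r x)"
    using i by (subst integral_Re) (auto simp: slice_integral_def convolution_def)
  finally show ?thesis .
qed

text \<open>Differentiability of the primitives at \<open>z\<close> passes from rational \<open>t\<close> to all \<open>t\<close>. For rational
\<open>r < t < r'\<close> the increments of the primitives for \<open>t\<close> and \<open>r\<close> differ by at most the difference of
the increments for \<open>r'\<close> and \<open>r\<close> of the primitives that belong to the absolute value of \<open>D\<close>. The
latter are differentiable at \<open>z\<close>, and their derivatives for \<open>r\<close> and \<open>r'\<close> are close to each other
because the slice integral at \<open>z\<close> is continuous in \<open>t\<close>.\<close>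

lemma slice_deriv_at:
  assumes s: "s > 0" and z: "integrable lborel (\<lambda>y. D (z, y))"
    and G: "\<And>r. r \<in> \<rat> \<Longrightarrow> (primitive (slice_integral s D r) has_vector_derivative slice_integral s D r z) (at z)"
    and A: "\<And>r. r \<in> \<rat> \<Longrightarrow> (primitive (abs_slice_integral s r) has_vector_derivative abs_slice_integral s r z) (at z)"
  shows "(primitive (slice_integral s D t) has_vector_derivative slice_integral s D t z) (at z)"
  unfolding has_vector_derivative_def has_derivative_at_alt
proof (intro conjI allI impI)
  interpret abs: integrable_on_quadrant "\<lambda>p. of_real (norm (D p))" a b by (rule abs_quadrant)
  fix \<epsilon> :: real assume \<epsilon>: "\<epsilon> > 0"
  let ?P = primitive and ?G = "slice_integral s D" and ?A = "abs_slice_integral s"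
  have nz: "integrable lborel (\<lambda>y. complex_of_real (norm (D (z, y))))" using z by simp
  obtain s' where s': "s = Suc s'" using s by (cases s) auto
  have "isCont (\<lambda>r. ?A r z) t"
    unfolding slice_integral_def s'
    by (rule isCont_convolution_power_kernel[OF nz, of b]) (simp add: D0)
  then obtain d where d: "d > 0" "\<And>r. \<bar>r - t\<bar> < d \<Longrightarrow> norm (?A r z - ?A t z) < \<epsilon> / 10"
    unfolding continuous_at_eps_delta dist_norm using \<epsilon> by (metis divide_pos_pos real_norm_def zero_less_numeral)
  \<comment> \<open>The error splits into five parts: three from the derivatives at \<open>r\<close> and \<open>r'\<close>, and two from
  the values at \<open>z\<close>. Each is bounded by a fifth of \<open>\<epsilon>\<close>.\<close>
  obtain r where r: "r \<in> \<rat>" "t - d < r" "r < t" using Rats_dense_in_real[of "t - d" t] d by auto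
  obtain r' where r': "r' \<in> \<rat>" "t < r'" "r' < t + d" using Rats_dense_in_real[of t "t + d"] d by auto
  have Az: "norm (?A r' z - ?A r z) \<le> \<epsilon> / 5"
    using d(2)[of r] d(2)[of r'] r r' norm_triangle_ineq4[of "?A r' z - ?A t z" "?A r z - ?A t z"] by auto
  define q where "q f c y = norm (?P f y - ?P f z - (y - z) *\<^sub>R c)" for f c y
  have ex: "\<exists>d>0. \<forall>y. norm (y - z) < d \<longrightarrow> q f c y \<le> \<epsilon> / 5 * norm (y - z)"
    if "(?P f has_vector_derivative c) (at z)" for f c
  proof -
    have "\<forall>e>0. \<exists>d>0. \<forall>y. norm (y - z) < d \<longrightarrow> q f c y \<le> e * norm (y - z)"
      using that unfolding has_vector_derivative_def has_derivative_at_alt q_def by blast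
    from this[rule_format, of "\<epsilon> / 5"] \<epsilon> show ?thesis by simp
  qed
  obtain d1 where d1: "d1 > 0" "\<And>y. norm (y - z) < d1 \<Longrightarrow> q (?G r) (?G r z) y \<le> \<epsilon> / 5 * norm (y - z)"
    using ex[OF G[OF r(1)]] by blast
  obtain d2 where d2: "d2 > 0" "\<And>y. norm (y - z) < d2 \<Longrightarrow> q (?A r) (?A r z) y \<le> \<epsilon> / 5 * norm (y - z)"
    using ex[OF A[OF r(1)]] by blast
  obtain d3 where d3: "d3 > 0" "\<And>y. norm (y - z) < d3 \<Longrightarrow> q (?A r') (?A r' z) y \<le> \<epsilon> / 5 * norm (y - z)"
    using ex[OF A[OF r'(1)]] by blast
  have Gi: "integrable lborel (?G u)" for u using integrable_slice_integral[OF s] .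
  have Ai: "integrable lborel (?A u)" for u using abs.integrable_slice_integral[OF s] .
  have incr0: "norm ((?P (?G t) v - ?P (?G t) u) - (?P (?G r) v - ?P (?G r) u))
      \<le> norm ((?P (?A r') v - ?P (?A r') u) - (?P (?A r) v - ?P (?A r) u))" if "u \<le> v" for u v
  proof -
    let ?I = "\<lambda>f x. indicator {u..<v} x *\<^sub>R (f x :: complex)"
    have ii: "integrable lborel (?I (?G w))" "integrable lborel (?I (?A w))" for w
      using Gi Ai by (intro integrable_mult_indicator; simp)+
    have "(?P (?G t) v - ?P (?G t) u) - (?P (?G r) v - ?P (?G r) u) = (\<integral>x. ?I (?G t) x - ?I (?G r) x \<partial>lborel)"
      using ii by (simp add: primitive_diff[OF Gi that] set_lebesgue_integral_def)
    also have "norm \<dots> \<le> (\<integral>x. norm (?I (?G t) x - ?I (?G r) x) \<partial>lborel)"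
      by (rule integral_norm_bound)
    also have "\<dots> \<le> (\<integral>x. Re (?I (?A r') x - ?I (?A r) x) \<partial>lborel)"
    proof (rule integral_mono_AE)
      show "AE x in lborel. norm (?I (?G t) x - ?I (?G r) x) \<le> Re (?I (?A r') x - ?I (?A r) x)"
        using AE_slice_integrable
      proof eventually_elim
        case (elim x)
        from norm_slice_integral_diff_le[OF elim s, of r t r'] r r'
        show ?case by (auto simp: indicator_def)
      qed
    qed (intro integrable_norm integrable_Re Bochner_Integration.integrable_diff ii)+
    also have "\<dots> = Re (\<integral>x. ?I (?A r') x - ?I (?A r) x \<partial>lborel)"
      using ii by (intro integral_Re) auto
    also have "\<dots> \<le> norm (\<integral>x. ?I (?A r') x - ?I (?A r) x \<partial>lborel)" by (rule complex_Re_le_cmod)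
    also have "(\<integral>x. ?I (?A r') x - ?I (?A r) x \<partial>lborel)
        = (?P (?A r') v - ?P (?A r') u) - (?P (?A r) v - ?P (?A r) u)"
      using ii by (simp add: primitive_diff[OF Ai that] set_lebesgue_integral_def)
    finally show ?thesis .
  qed
  have incr: "norm ((?P (?G t) y - ?P (?G t) z) - (?P (?G r) y - ?P (?G r) z))
      \<le> norm ((?P (?A r') y - ?P (?A r') z) - (?P (?A r) y - ?P (?A r) z))" for y
  proof (cases "z \<le> y")
    case False
    have sw: "norm ((a - b) - (c - d)) = norm ((b - a) - (d - c))" for a b c d :: complex
      using norm_minus_cancel[of "(a - b) - (c - d)"] by (simp add: algebra_simps)
    show ?thesis
      unfolding sw[of "?P (?G t) y"] sw[of "?P (?A r') y"] using False by (intro incr0) simp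
  qed (rule incr0)
  show "\<exists>d>0. \<forall>y. norm (y - z) < d \<longrightarrow>
      norm (?P (?G t) y - ?P (?G t) z - (y - z) *\<^sub>R ?G t z) \<le> \<epsilon> * norm (y - z)"
  proof (intro exI[of _ "min d1 (min d2 d3)"] conjI allI impI)
    fix y assume y: "norm (y - z) < min d1 (min d2 d3)"
    let ?h = "norm (y - z)"
    have 1: "norm ((y - z) *\<^sub>R (?A r' z - ?A r z)) \<le> \<epsilon> / 5 * ?h"
      using mult_right_mono[OF Az, of ?h] by (simp add: mult.commute)
    have 2: "norm ((y - z) *\<^sub>R (?G t z - ?G r z)) \<le> \<epsilon> / 5 * ?h"
    proof -
      have "norm (?G t z - ?G r z) \<le> Re (?A r' z - ?A r z)"
        using norm_slice_integral_diff_le[OF z s, of r t r'] r r' by auto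
      also have "\<dots> \<le> \<epsilon> / 5" using Az complex_Re_le_cmod order_trans by blast
      finally show ?thesis using mult_right_mono[of "norm (?G t z - ?G r z)" "\<epsilon> / 5" ?h] by (simp add: mult.commute)
    qed
    have 3: "q (?G r) (?G r z) y \<le> \<epsilon> / 5 * ?h" "q (?A r) (?A r z) y \<le> \<epsilon> / 5 * ?h"
        "q (?A r') (?A r' z) y \<le> \<epsilon> / 5 * ?h"
      using d1(2) d2(2) d3(2) y by auto
    have tri: "norm (a + b - c) \<le> norm a + norm b + norm c" for a b c :: complex
      by (metis add_right_mono norm_triangle_ineq norm_triangle_ineq4 order_trans)
    have "norm ((?P (?A r') y - ?P (?A r') z) - (?P (?A r) y - ?P (?A r) z))
       \<le> norm ((y - z) *\<^sub>R (?A r' z - ?A r z)) + q (?A r') (?A r' z) y + q (?A r) (?A r z) y"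
      unfolding q_def by (rule order_trans[OF _ tri]) (simp add: algebra_simps)
    then have 4: "norm ((?P (?G t) y - ?P (?G t) z) - (?P (?G r) y - ?P (?G r) z)) \<le> 3 * (\<epsilon> / 5 * ?h)"
      using incr[of y] 1 3 by linarith
    have "norm (?P (?G t) y - ?P (?G t) z - (y - z) *\<^sub>R ?G t z)
      \<le> norm ((?P (?G t) y - ?P (?G t) z) - (?P (?G r) y - ?P (?G r) z))
        + q (?G r) (?G r z) y + norm ((y - z) *\<^sub>R (?G t z - ?G r z))"
      unfolding q_def by (rule order_trans[OF _ tri]) (simp add: algebra_simps)
    also have "\<dots> \<le> \<epsilon> * ?h" using 2 3 4 by simp
    finally show "norm (?P (?G t) y - ?P (?G t) z - (y - z) *\<^sub>R ?G t z) \<le> \<epsilon> * ?h" .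
  qed (use d1 d2 d3 in auto)
qed (rule bounded_linear_scaleR_left)

text \<open>The exceptional sets for rational \<open>t\<close> are countably many null sets, and \<open>slice_deriv_at\<close> covers
all other \<open>t\<close> outside their union.\<close>

lemma AE_slice_deriv:
  assumes s: "s > 0"
  shows "AE z in lborel. \<forall>t. (primitive (slice_integral s D t) has_vector_derivative slice_integral s D t z) (at z)"
proof -
  interpret abs: integrable_on_quadrant "\<lambda>p. of_real (norm (D p))" a b by (rule abs_quadrant)
  have "AE z in lborel. \<forall>r\<in>\<rat>. (primitive (slice_integral s D r) has_vector_derivative slice_integral s D r z) (at z)"
    by (intro AE_ball_countable[THEN iffD2] countable_rat ballI AE_primitive_has_vector_derivative
       integrable_slice_integral s)
  moreover have "AE z in lborel. \<forall>r\<in>\<rat>. (primitive (abs_slice_integral s r) has_vector_derivative abs_slice_integral s r z) (at z)"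
    by (intro AE_ball_countable[THEN iffD2] countable_rat ballI AE_primitive_has_vector_derivative
       abs.integrable_slice_integral s)
  ultimately show ?thesis
    using AE_slice_integrable
  proof eventually_elim
    case (elim z)
    show ?case
      using slice_deriv_at[OF s elim(3) elim(1)[rule_format] elim(2)[rule_format]] by blast
  qed
qed

end

lemma AE_lborel_fst:
  assumes "AE x in (lborel :: real measure). P x"
  shows "AE p in (lborel :: (real \<times> real) measure). P (fst p)"
proof -
  from assms obtain N where N: "N \<in> null_sets lborel" "{x \<in> space lborel. \<not> P x} \<subseteq> N"
    unfolding eventually_ae_filter by auto
  have [measurable]: "N \<in> sets borel" using N by auto
  have "AE p in lborel \<Otimes>\<^sub>M (lborel :: real measure). fst p \<notin> N"
  proof (rule lborel_pair.AE_pair_measure)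
    show "AE x in lborel. AE y in (lborel :: real measure). fst (x, y) \<notin> N"
      using AE_not_in[OF N(1)] by eventually_elim simp
  qed measurable
  then have "AE p in (lborel :: (real \<times> real) measure). fst p \<notin> N"
    unfolding lborel_prod .
  then show ?thesis by eventually_elim (use N in auto)
qed

text \<open>Differentiability expressed by countably many conditions, so that the set of points where it holds
is measurable.\<close>

definition rational_quotients_tend :: "(real \<Rightarrow> complex) \<Rightarrow> real \<Rightarrow> complex \<Rightarrow> bool"
  where "rational_quotients_tend F t v \<longleftrightarrow> (\<forall>k. \<exists>m. \<forall>q :: rat. \<bar>of_rat q\<bar> < inverse (real (Suc m)) \<longrightarrow>
     norm (F (t + of_rat q) - F t - of_rat q *\<^sub>R v) \<le> inverse (real (Suc k)) * \<bar>of_rat q\<bar>)"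

lemma has_vector_derivative_iff_rational_quotients:
  assumes cont: "\<And>x. isCont F x"
  shows "(F has_vector_derivative v) (at t) \<longleftrightarrow> rational_quotients_tend F t v"
proof
  assume "(F has_vector_derivative v) (at t)"
  then have *: "\<exists>d>0. \<forall>y. norm (y - t) < d \<longrightarrow> norm (F y - F t - (y - t) *\<^sub>R v) \<le> e * norm (y - t)"
    if "e > 0" for e
    using that unfolding has_vector_derivative_def has_derivative_at_alt by blast
  show "rational_quotients_tend F t v"
    unfolding rational_quotients_tend_def
  proof
    fix k
    obtain d where d: "d > 0"
      "\<And>y. norm (y - t) < d \<Longrightarrow> norm (F y - F t - (y - t) *\<^sub>R v) \<le> inverse (real (Suc k)) * norm (y - t)"
      using *[of "inverse (real (Suc k))"] by auto
    obtain m where "inverse (real (Suc m)) < d" using reals_Archimedean[OF d(1)] by blast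
    then have "norm (F (t + of_rat q) - F t - of_rat q *\<^sub>R v) \<le> inverse (real (Suc k)) * \<bar>of_rat q\<bar>"
      if "\<bar>of_rat q\<bar> < inverse (real (Suc m))" for q
      using d(2)[of "t + of_rat q"] that by simp
    then show "\<exists>m. \<forall>q. \<bar>of_rat q\<bar> < inverse (real (Suc m)) \<longrightarrow>
        norm (F (t + of_rat q) - F t - of_rat q *\<^sub>R v) \<le> inverse (real (Suc k)) * \<bar>of_rat q\<bar>"
      by blast
  qed
next
  assume R: "rational_quotients_tend F t v"
  show "(F has_vector_derivative v) (at t)"
    unfolding has_vector_derivative_def has_derivative_at_alt
  proof (intro conjI allI impI)
    fix e :: real assume "e > 0"
    then obtain k where k: "inverse (real (Suc k)) < e" using reals_Archimedean by blast
    obtain m where m: "\<And>q. \<bar>of_rat q\<bar> < inverse (real (Suc m)) \<Longrightarrow>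
        norm (F (t + of_rat q) - F t - of_rat q *\<^sub>R v) \<le> inverse (real (Suc k)) * \<bar>of_rat q\<bar>"
      using R unfolding rational_quotients_tend_def by blast
    define \<psi> where "\<psi> h = inverse (real (Suc k)) * \<bar>h\<bar> - norm (F (t + h) - F t - h *\<^sub>R v)" for h
    have \<psi>: "\<psi> h \<ge> 0" if h: "\<bar>h\<bar> < inverse (real (Suc m))" for h
    proof (rule ccontr)
      assume "\<not> \<psi> h \<ge> 0"
      have "isCont (\<lambda>h. F (t + h)) h"
        by (rule isCont_o2[OF _ cont]) (intro continuous_intros)
      then have "isCont \<psi> h" unfolding \<psi>_def by (intro continuous_intros)
      then have "(\<psi> \<longlongrightarrow> \<psi> h) (at h)" by (simp add: isCont_def)
      then have "\<forall>\<^sub>F x in at h. \<psi> x < 0" using \<open>\<not> \<psi> h \<ge> 0\<close> by (intro order_tendstoD) auto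
      then obtain d where d: "d > 0" "\<And>x. x \<noteq> h \<Longrightarrow> \<bar>x - h\<bar> < d \<Longrightarrow> \<psi> x < 0"
        unfolding eventually_at by (auto simp: dist_real_def)
      have "h < min (h + d) (inverse (real (Suc m)))" using h d by auto
      then obtain x where x: "x \<in> \<rat>" "h < x" "x < min (h + d) (inverse (real (Suc m)))"
        using Rats_dense_in_real by blast
      then obtain q where q: "x = of_rat q" by (auto elim: Rats_cases)
      have "\<bar>x\<bar> < inverse (real (Suc m))" using x h by auto
      then have "\<psi> x \<ge> 0" using m[of q] unfolding \<psi>_def q by simp
      then show False using d(2)[of x] x by auto
    qed
    show "\<exists>d>0. \<forall>y. norm (y - t) < d \<longrightarrow> norm (F y - F t - (y - t) *\<^sub>R v) \<le> e * norm (y - t)"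
    proof (intro exI[of _ "inverse (real (Suc m))"] conjI allI impI)
      fix y assume "norm (y - t) < inverse (real (Suc m))"
      then have "norm (F y - F t - (y - t) *\<^sub>R v) \<le> inverse (real (Suc k)) * norm (y - t)"
        using \<psi>[of "y - t"] by (simp add: \<psi>_def)
      also have "\<dots> \<le> e * norm (y - t)" using k by (intro mult_right_mono) auto
      finally show "norm (F y - F t - (y - t) *\<^sub>R v) \<le> e * norm (y - t)" .
    qed simp
  qed (rule bounded_linear_scaleR_left)
qed

context integrable_on_quadrant
begin

text \<open>Lebesgue's theorem on each line gives a null set on almost every line. These combine to a null set
of the plane because the condition on rational difference quotients defines a measurable set.\<close>

lemma AE_slice_primitive_deriv:
  "AE p in lborel. (primitive (\<lambda>y. D (fst p, y)) has_vector_derivative D p) (at (snd p))"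
proof -
  have eq: "primitive (\<lambda>y. D (x, y)) t = (LINT y|lborel. (if y < t then D (x, y) else 0))" for x t
    unfolding primitive_def set_lebesgue_integral_def
    by (intro Bochner_Integration.integral_cong) auto
  have [measurable]: "D \<in> borel_measurable (borel \<Otimes>\<^sub>M borel)"
    using borel_D by (simp add: borel_prod)
  have meas: "Measurable.pred (borel \<Otimes>\<^sub>M borel)
    (\<lambda>p. rational_quotients_tend (primitive (\<lambda>y. D (fst p, y))) (snd p) (D p))"
    unfolding rational_quotients_tend_def eq by measurable
  have "AE p in lborel \<Otimes>\<^sub>M lborel. rational_quotients_tend (primitive (\<lambda>y. D (fst p, y))) (snd p) (D p)"
  proof (rule lborel_pair.AE_pair_measure)
    show "AE x in lborel. AE y in lborel.
        rational_quotients_tend (primitive (\<lambda>y'. D (fst (x, y), y'))) (snd (x, y)) (D (x, y))"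
      using AE_slice_integrable
    proof eventually_elim
      case (elim x)
      from AE_primitive_has_vector_derivative[OF elim]
      show ?case
        by eventually_elim (simp add: has_vector_derivative_iff_rational_quotients[OF isCont_primitive[OF elim]])
    qed
  qed (use meas in \<open>simp add: space_pair_measure pred_def\<close>)
  then have "AE p in lborel. rational_quotients_tend (primitive (\<lambda>y. D (fst p, y))) (snd p) (D p)"
    unfolding lborel_prod .
  with AE_lborel_fst[OF AE_slice_integrable] show ?thesis
    by eventually_elim (simp add: has_vector_derivative_iff_rational_quotients isCont_primitive)
qed

lemma convolution_tensor_eq_iterated:
  assumes "k > 0" "s > 0"
  shows "convolution (tensor (power_kernel (of_nat k)) (power_kernel (of_nat s))) D (z, t)
    = convolution (power_kernel (of_nat k)) (slice_integral s D t) z"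
proof -
  let ?k = "power_kernel (of_nat k)" and ?s = "power_kernel (of_nat s)"
  have "integrable (lborel \<Otimes>\<^sub>M lborel) (\<lambda>(x, y). ?k (z - x) * (?s (t - y) * D (x, y)))"
  proof (rule Bochner_Integration.integrable_bound)
    let ?C = "norm (?k (z - a)) * norm (?s (t - b))"
    show "integrable (lborel \<Otimes>\<^sub>M lborel) (\<lambda>p. ?C * norm (D p))"
      using D_pair by (intro integrable_mult_right integrable_norm)
    show "AE p in lborel \<Otimes>\<^sub>M lborel. norm (case p of (x, y) \<Rightarrow> ?k (z - x) * (?s (t - y) * D (x, y))) \<le> norm (?C * norm (D p))"
    proof (intro AE_I2, clarify)
      fix x y
      show "norm (?k (z - x) * (?s (t - y) * D (x, y))) \<le> norm (?C * norm (D (x, y)))"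
      proof (cases "x \<le> a \<or> y \<le> b")
        case False
        then have "norm (?k (z - x)) * norm (?s (t - y)) * norm (D (x, y)) \<le> ?C * norm (D (x, y))"
          using assms by (intro mult_right_mono mult_mono norm_power_kernel_of_nat_mono) auto
        then show ?thesis by (simp add: norm_mult mult.assoc)
      qed (simp add: D0)
    qed
  qed measurable
  then have "(\<integral>x. \<integral>y. ?k (z - x) * (?s (t - y) * D (x, y)) \<partial>lborel \<partial>lborel)
      = (\<integral>(x, y). ?k (z - x) * (?s (t - y) * D (x, y)) \<partial>(lborel \<Otimes>\<^sub>M lborel))"
    by (rule lborel_pair.integral_fst)
  then show ?thesis
    by (simp add: convolution_def tensor_def slice_integral_def lborel_prod case_prod_unfold mult.assoc)
qed

text \<open>Differentiating \<open>k\<close> times in the first variable yields the slice integral for every \<open>t'\<close>; it is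
then differentiated \<open>s\<close> times in the second variable.\<close>

theorem AE_mixed_deriv:
  assumes k: "k > 0" and s: "s > 0"
    and \<Phi>: "\<And>z t. z \<in> {a<..<a2} \<Longrightarrow> t \<in> {b<..<b2} \<Longrightarrow>
      \<Phi> z t = convolution (tensor (power_kernel (of_nat k)) (power_kernel (of_nat s))) D (z, t)"
  shows "AE p in lborel. p \<in> {a<..<a2} \<times> {b<..<b2} \<longrightarrow>
    (\<forall>\<^sub>F t' in nhds (snd p). nth_differentiable k (\<lambda>z'. \<Phi> z' t') (fst p)) \<and>
    nth_differentiable s (\<lambda>t'. nth_deriv k (\<lambda>z'. \<Phi> z' t') (fst p)) (snd p) \<and>
    nth_deriv s (\<lambda>t'. nth_deriv k (\<lambda>z'. \<Phi> z' t') (fst p)) (snd p) = D p"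
  using AE_slice_primitive_deriv AE_lborel_fst[OF AE_slice_integrable] AE_lborel_fst[OF AE_slice_deriv[OF s]]
proof eventually_elim
  case (elim p)
  show ?case
  proof
    assume p: "p \<in> {a<..<a2} \<times> {b<..<b2}"
    have z: "nth_differentiable k (\<lambda>z'. \<Phi> z' t') (fst p) \<and>
        nth_deriv k (\<lambda>z'. \<Phi> z' t') (fst p) = slice_integral s D t' (fst p)"
      if t': "t' \<in> {b<..<b2}" for t'
    proof (rule nth_deriv_convolution_power_kernel[OF integrable_slice_integral[OF s] _ _ _ k _ elim(3)[rule_format]])
      show "\<forall>x\<le>a. slice_integral s D t' x = 0" by (simp add: slice_integral_eq_0)
      show "open {a<..<a2}" by simp
      show "fst p \<in> {a<..<a2}" using p by auto
      show "\<Phi> y t' = convolution (power_kernel (of_nat k)) (slice_integral s D t') y" if "y \<in> {a<..<a2}" for y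
        using \<Phi>[OF that t'] convolution_tensor_eq_iterated[OF k s] by simp
    qed
    have "nth_differentiable s (\<lambda>t'. nth_deriv k (\<lambda>z'. \<Phi> z' t') (fst p)) (snd p) \<and>
      nth_deriv s (\<lambda>t'. nth_deriv k (\<lambda>z'. \<Phi> z' t') (fst p)) (snd p) = D p"
    proof (rule nth_deriv_convolution_power_kernel[OF elim(2) _ _ _ s _ elim(1)])
      show "\<forall>y\<le>b. D (fst p, y) = 0" by (simp add: D0)
      show "open {b<..<b2}" by simp
      show "snd p \<in> {b<..<b2}" using p by auto
    qed (use z in \<open>auto simp: slice_integral_def\<close>)
    moreover have "\<forall>\<^sub>F t' in nhds (snd p). t' \<in> {b<..<b2}"
      using p by (intro eventually_nhds_in_open) auto
    then have "\<forall>\<^sub>F t' in nhds (snd p). nth_differentiable k (\<lambda>z'. \<Phi> z' t') (fst p)"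
      by eventually_elim (use z in auto)
    ultimately show "(\<forall>\<^sub>F t' in nhds (snd p). nth_differentiable k (\<lambda>z'. \<Phi> z' t') (fst p)) \<and>
      nth_differentiable s (\<lambda>t'. nth_deriv k (\<lambda>z'. \<Phi> z' t') (fst p)) (snd p) \<and>
      nth_deriv s (\<lambda>t'. nth_deriv k (\<lambda>z'. \<Phi> z' t') (fst p)) (snd p) = D p"
      by blast
  qed
qed

end

section \<open>The integral operators as convolutions\<close>

definition supported_beyond :: "real \<Rightarrow> real \<Rightarrow> (real \<times> real \<Rightarrow> complex) \<Rightarrow> bool"
  where "supported_beyond a b F \<longleftrightarrow> (\<forall>x y. F (x, y) \<noteq> 0 \<longrightarrow> a < x \<and> b < y)"

text \<open>Causality: the operators at a point depend only on values to the lower left of it.\<close>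

lemma supported_beyond_convolution:
  assumes K: "supported_beyond 0 0 K" and F: "supported_beyond a b F"
  shows "supported_beyond a b (convolution K F)"
  unfolding supported_beyond_def
proof (intro allI impI)
  fix x y assume *: "convolution K F (x, y) \<noteq> 0"
  show "a < x \<and> b < y"
  proof (rule ccontr)
    assume n: "\<not> (a < x \<and> b < y)"
    have "K ((x, y) - u) * F u = 0" for u
    proof (rule ccontr)
      assume "K ((x, y) - u) * F u \<noteq> 0"
      then have "0 < x - fst u \<and> 0 < y - snd u" "a < fst u \<and> b < snd u"
        using K F unfolding supported_beyond_def by (cases u; force)+
      with n show False by auto
    qed
    then have "convolution K F (x, y) = 0"
      unfolding convolution_def by (simp only: Bochner_Integration.integral_zero)
    with * show False by simp
  qed
qed

lemma supported_beyond_tensor: "supported_beyond 0 0 (tensor (power_kernel a) (power_kernel b))"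
  by (auto simp: supported_beyond_def tensor_def power_kernel_def)

lemma supported_beyond_IK_series: "supported_beyond 0 0 (IK_series \<gamma>1 \<gamma>2 p q \<upsilon> w1 W R)"
  by (auto simp: supported_beyond_def IK_series_def corner_square_def)

lemma lebesgue_borel_representative:
  fixes f :: "'a::euclidean_space \<Rightarrow> complex"
  assumes "f \<in> borel_measurable lebesgue"
  obtains g where "g \<in> borel_measurable borel" "AE x in lborel. f x = g x"
proof -
  have "(\<lambda>x. Re (f x)) \<in> borel_measurable lebesgue" "(\<lambda>x. Im (f x)) \<in> borel_measurable lebesgue"
    using assms by measurable
  from this[THEN completion_ex_borel_measurable_real]
  obtain u v where uv [measurable]: "u \<in> borel_measurable lborel" "v \<in> borel_measurable lborel"
    and ae: "AE x in lborel. Re (f x) = u x" "AE x in lborel. Im (f x) = v x"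
    by blast
  have "(\<lambda>x. Complex (u x) (v x)) \<in> borel_measurable borel"
    unfolding Complex_eq using uv by measurable
  moreover have "AE x in lborel. f x = Complex (u x) (v x)"
    using ae by eventually_elim (simp add: complex_eq_iff)
  ultimately show thesis using that by blast
qed

lemma IK_operator_eq_convolution:
  assumes p: "Re p > 0" and q: "Re q > 0" and \<upsilon>: "Re \<upsilon> > 0"
    and R: "a2 - a1 \<le> R" "b2 - b1 \<le> R"
    and zt: "(z, t) \<in> {a1<..<a2} \<times> {b1<..<b2}"
    and F [measurable]: "F \<in> borel_measurable borel" and F0: "supported_beyond a1 b1 F"
    and f: "AE p in lborel. p \<in> {a1<..<a2} \<times> {b1<..<b2} \<longrightarrow> f (fst p) (snd p) = F p"
    and fin: "nn_convolution (enorm (IK_series \<gamma>1 \<gamma>2 p q \<upsilon> w1 W R)) (enorm F) (z, t) < \<infinity>"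
  shows "IK_operator \<gamma>1 \<gamma>2 \<gamma>3 p q \<upsilon> w1 W a1 b1 f z t = convolution (IK_series \<gamma>1 \<gamma>2 p q \<upsilon> w1 W R) F (z, t)"
proof -
  let ?K = "IK_series \<gamma>1 \<gamma>2 p q \<upsilon> w1 W R"
  have "of_real (t - y) powr (q - 1) * of_real (z - \<xi>) powr (p - 1)
        * IK_kernel \<gamma>1 \<gamma>2 \<gamma>3 p q \<upsilon> w1 W (z - \<xi>) (t - y) = ?K (z - \<xi>, t - y)"
    if "\<xi> \<in> {a1<..<z}" "y \<in> {b1<..<t}" for \<xi> y
    by (rule IK_kernel_eq_IK_series[OF p q \<upsilon>]) (use that zt R in auto)
  then have "IK_operator \<gamma>1 \<gamma>2 \<gamma>3 p q \<upsilon> w1 W a1 b1 f z t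
      = (LINT y:{b1<..<t}|lebesgue. LINT \<xi>:{a1<..<z}|lebesgue. ?K (z - \<xi>, t - y) * f \<xi> y)"
    unfolding IK_operator_def set_lebesgue_integral_def
    by (auto intro!: Bochner_Integration.integral_cong simp: indicator_def simp del: of_real_diff)
  also have "\<dots> = convolution ?K F (z, t)"
    using supported_beyond_IK_series F0 zt unfolding supported_beyond_def
    by (intro iterated_integrals_eq_convolution(1)[OF _ F fin _ _ f]) auto
  finally show ?thesis .
qed

lemma frac_deriv_potential_eq_convolution:
  assumes zt: "(z, t) \<in> {a1<..<a2} \<times> {b1<..<b2}"
    and \<kappa>: "\<kappa> = of_nat (frac_order \<alpha>) - \<alpha>" and \<mu>: "\<mu> = of_nat (frac_order \<beta>) - \<beta>"
    and F [measurable]: "F \<in> borel_measurable borel" and F0: "supported_beyond a1 b1 F"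
    and f: "AE p in lborel. p \<in> {a1<..<a2} \<times> {b1<..<b2} \<longrightarrow> f (fst p) (snd p) = F p"
    and fin: "nn_convolution (enorm (tensor (power_kernel \<kappa>) (power_kernel \<mu>))) (enorm F) (z, t) < \<infinity>"
  shows "frac_deriv_potential a1 b1 \<alpha> \<beta> f z t
    = convolution (tensor (power_kernel \<kappa>) (power_kernel \<mu>)) F (z, t)"
proof -
  let ?J = "tensor (power_kernel \<kappa>) (power_kernel \<mu>)"
  have "frac_deriv_potential a1 b1 \<alpha> \<beta> f z t
    = (LINT \<xi>:{a1<..<z}|lebesgue. of_real (z - \<xi>) powr (\<kappa> - 1) *
        ((LINT y:{b1<..<t}|lebesgue. of_real (t - y) powr (\<mu> - 1) * f \<xi> y) / Gamma \<mu>)) / Gamma \<kappa>"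
    unfolding frac_deriv_potential_def frac_integral_z_def frac_integral_t_def frac_integral_def \<kappa>[symmetric] \<mu>[symmetric] ..
  also have "\<dots> = (LINT \<xi>:{a1<..<z}|lebesgue. LINT y:{b1<..<t}|lebesgue. ?J (z - \<xi>, t - y) * f \<xi> y)"
  proof -
    have inner: "(LINT y:{b1<..<t}|lebesgue. ?J (z - \<xi>, t - y) * f \<xi> y)
        = of_real (z - \<xi>) powr (\<kappa> - 1) *
        ((LINT y:{b1<..<t}|lebesgue. of_real (t - y) powr (\<mu> - 1) * f \<xi> y) / Gamma \<mu>) / Gamma \<kappa>"
      if "\<xi> < z" for \<xi>
    proof -
      have "indicator {b1<..<t} y *\<^sub>R (?J (z - \<xi>, t - y) * f \<xi> y)
         = (of_real (z - \<xi>) powr (\<kappa> - 1) / (Gamma \<mu> * Gamma \<kappa>)) *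
           (indicator {b1<..<t} y *\<^sub>R (of_real (t - y) powr (\<mu> - 1) * f \<xi> y))" for y
        using that by (auto simp: indicator_def tensor_def power_kernel_def simp del: of_real_diff)
      then show ?thesis
        unfolding set_lebesgue_integral_def by (simp only: integral_mult_right_zero) simp
    qed
    have "indicator {a1<..<z} \<xi> *\<^sub>R (LINT y:{b1<..<t}|lebesgue. ?J (z - \<xi>, t - y) * f \<xi> y)
      = indicator {a1<..<z} \<xi> *\<^sub>R (of_real (z - \<xi>) powr (\<kappa> - 1) *
        ((LINT y:{b1<..<t}|lebesgue. of_real (t - y) powr (\<mu> - 1) * f \<xi> y) / Gamma \<mu>)) / Gamma \<kappa>" for \<xi>
      using inner[of \<xi>] by (auto simp: indicator_def simp del: of_real_diff)
    then show ?thesis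
      unfolding set_lebesgue_integral_def[of lebesgue "{a1<..<z}"] by (simp del: of_real_diff)
  qed
  also have "\<dots> = convolution ?J F (z, t)"
    using supported_beyond_tensor F0 zt unfolding supported_beyond_def
    by (intro iterated_integrals_eq_convolution(2)[OF _ F fin _ _ f]) auto
  finally show ?thesis .
qed

text \<open>The constant may depend on \<open>K\<close> but only the exponents of the weight matter for finiteness.\<close>

definition dominated_by_weight :: "(real \<times> real \<Rightarrow> complex) \<Rightarrow> real \<Rightarrow> real \<Rightarrow> bool"
  where "dominated_by_weight K c d \<longleftrightarrow> (\<exists>C. \<forall>z. norm (K z) \<le> C * power_weight c d z)"

lemma dominated_by_weight_tensor:
  "dominated_by_weight (tensor (power_kernel a) (power_kernel b)) (Re a) (Re b)"
  unfolding dominated_by_weight_def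
  by (rule exI[of _ "1 / (norm (Gamma a) * norm (Gamma b))"])
    (simp add: tensor_def norm_mult norm_power_kernel power_weight_def)

lemma dominated_by_weight_IK_series:
  assumes "Re p > 0" "Re q > 0" "Re \<upsilon> > 0" "R > 0"
  shows "dominated_by_weight (IK_series \<gamma>1 \<gamma>2 p q \<upsilon> w1 W R) (Re p) (Re q)"
  using norm_IK_series_le[OF assms] unfolding dominated_by_weight_def by blast

lemma dominated_by_weightE:
  assumes "dominated_by_weight K c d"
  obtains C where "\<And>z. ennreal (norm (K z)) \<le> ennreal \<bar>C\<bar> * ennreal (power_weight c d z)"
proof -
  obtain C where C: "\<And>z. norm (K z) \<le> C * power_weight c d z"
    using assms by (auto simp: dominated_by_weight_def)
  have "ennreal (norm (K z)) \<le> ennreal \<bar>C\<bar> * ennreal (power_weight c d z)" for z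
  proof -
    have "norm (K z) \<le> \<bar>C\<bar> * power_weight c d z"
      using C[of z] by (rule order_trans) (intro mult_right_mono, auto)
    then show ?thesis by (simp add: ennreal_mult[symmetric] ennreal_leI)
  qed
  then show thesis using that by blast
qed

lemma nn_convolution_dominated:
  assumes K: "dominated_by_weight K c d" and [measurable]: "K \<in> borel_measurable borel" "G \<in> borel_measurable borel"
    and fin: "nn_convolution (power_weight c d) G z < \<infinity>"
  shows "nn_convolution (enorm K) G z < \<infinity>"
proof -
  obtain C where le: "\<And>z. ennreal (norm (K z)) \<le> ennreal \<bar>C\<bar> * ennreal (power_weight c d z)"
    using dominated_by_weightE[OF K] by blast
  have "nn_convolution (enorm K) G z \<le> (\<integral>\<^sup>+u. ennreal \<bar>C\<bar> * (ennreal (power_weight c d (z - u)) * G u) \<partial>lborel)"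
    unfolding nn_convolution_def mult.assoc[symmetric] by (intro nn_integral_mono mult_right_mono le) simp
  also have "\<dots> = ennreal \<bar>C\<bar> * nn_convolution (power_weight c d) G z"
    unfolding nn_convolution_def by (rule nn_integral_cmult) measurable
  also have "\<dots> < \<infinity>" using fin by (simp add: ennreal_mult_less_top)
  finally show ?thesis .
qed

text \<open>A dominated kernel can be absorbed into the weight, at the price of adding the exponents. Applied
repeatedly, this reduces the finiteness of a multiple convolution to that of a single one.\<close>

lemma nn_convolution_weight_absorb:
  assumes K: "dominated_by_weight K c d" and [measurable]: "K \<in> borel_measurable borel" "G \<in> borel_measurable borel"
    and pos: "\<alpha> > 0" "\<beta> > 0" "c > 0" "d > 0"
    and fin: "nn_convolution (power_weight (\<alpha> + c) (\<beta> + d)) G z < \<infinity>"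
  shows "nn_convolution (power_weight \<alpha> \<beta>) (nn_convolution (enorm K) G) z < \<infinity>"
proof -
  obtain C where le: "\<And>z. ennreal (norm (K z)) \<le> ennreal \<bar>C\<bar> * ennreal (power_weight c d z)"
    using dominated_by_weightE[OF K] by blast
  obtain C' where C': "C' < \<infinity>"
    "\<And>z. nn_convolution (power_weight \<alpha> \<beta>) (power_weight c d) z = C' * ennreal (power_weight (\<alpha> + c) (\<beta> + d) z)"
    using nn_convolution_power_weight[OF pos] by blast
  have "nn_convolution (power_weight \<alpha> \<beta>) (nn_convolution (enorm K) G) z
    = nn_convolution (nn_convolution (power_weight \<alpha> \<beta>) (enorm K)) G z"
    by (rule nn_convolution_assoc) measurable
  also have "\<dots> \<le> nn_convolution (\<lambda>z. ennreal \<bar>C\<bar> * C' * ennreal (power_weight (\<alpha> + c) (\<beta> + d) z)) G z"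
  proof (rule nn_convolution_mono)
    fix z
    have "nn_convolution (power_weight \<alpha> \<beta>) (enorm K) z
      \<le> nn_convolution (power_weight \<alpha> \<beta>) (\<lambda>z. ennreal \<bar>C\<bar> * ennreal (power_weight c d z)) z"
      by (intro nn_convolution_mono le) simp
    also have "\<dots> = ennreal \<bar>C\<bar> * nn_convolution (power_weight \<alpha> \<beta>) (power_weight c d) z"
      unfolding nn_convolution_def by (subst nn_integral_cmult[symmetric]) (auto simp: mult_ac)
    finally show "nn_convolution (power_weight \<alpha> \<beta>) (enorm K) z \<le> ennreal \<bar>C\<bar> * C' * ennreal (power_weight (\<alpha> + c) (\<beta> + d) z)"
      by (simp add: C'(2) mult.assoc)
  qed simp
  also have "\<dots> = ennreal \<bar>C\<bar> * C' * nn_convolution (power_weight (\<alpha> + c) (\<beta> + d)) G z"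
    unfolding nn_convolution_def by (subst nn_integral_cmult[symmetric]) (auto simp: mult_ac)
  also have "\<dots> < \<infinity>"
    using fin C' by (simp add: ennreal_mult_less_top)
  finally show ?thesis .
qed

text \<open>The weight \<open>power_weight 1 1\<close> is the indicator function of the open positive quadrant.\<close>

lemma AE_finite_of_nn_convolution_weight_1:
  assumes [measurable]: "G \<in> borel_measurable borel"
    and fin: "nn_convolution (power_weight 1 1) G (x, y) < \<infinity>"
  shows "AE u in lborel. fst u < x \<and> snd u < y \<longrightarrow> G u < \<infinity>"
proof -
  have "AE u in lborel. ennreal (power_weight 1 1 ((x, y) - u)) * G u \<noteq> \<infinity>"
    using fin unfolding nn_convolution_def by (intro nn_integral_PInf_AE) auto
  then show ?thesis
    by eventually_elim (auto simp: power_weight_def pos_power_def less_top)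
qed

context integrable_on_quadrant
begin

text \<open>With exponents at least one the weight is increasing in both coordinates. So on the support of \<open>D\<close>
the weight of \<open>z - u\<close> is at most that of \<open>z - (a, b)\<close>. This gives finiteness at every point.\<close>

lemma nn_convolution_weight_finite:
  assumes "\<alpha> \<ge> 1" "\<beta> \<ge> 1"
  shows "nn_convolution (power_weight \<alpha> \<beta>) (enorm D) z < \<infinity>"
proof -
  have "nn_convolution (power_weight \<alpha> \<beta>) (enorm D) z
     \<le> (\<integral>\<^sup>+u. ennreal (power_weight \<alpha> \<beta> (z - (a, b))) * enorm D u \<partial>lborel)"
    unfolding nn_convolution_def
  proof (rule nn_integral_mono)
    fix u
    show "ennreal (power_weight \<alpha> \<beta> (z - u)) * enorm D u \<le> ennreal (power_weight \<alpha> \<beta> (z - (a, b))) * enorm D u"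
    proof (cases "fst u \<le> a \<or> snd u \<le> b")
      case True
      then have "D u = 0" using D0[of "fst u" "snd u"] by simp
      then show ?thesis by simp
    next
      case False
      then have "power_weight \<alpha> \<beta> (z - u) \<le> power_weight \<alpha> \<beta> (z - (a, b))"
        unfolding power_weight_def using assms by (intro mult_mono pos_power_mono) auto
      then show ?thesis by (intro mult_right_mono ennreal_leI) auto
    qed
  qed
  also have "\<dots> = ennreal (power_weight \<alpha> \<beta> (z - (a, b))) * (\<integral>\<^sup>+u. enorm D u \<partial>lborel)"
    by (rule nn_integral_cmult) measurable
  also have "\<dots> < \<infinity>"
    using D by (auto simp: integrable_iff_bounded ennreal_mult_less_top)
  finally show ?thesis .
qed

end

section \<open>The left inverse\<close>

text \<open>The convolutions of \<open>d\<close> with the first kernel, and then with the second one, converge absolutely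
almost everywhere in the rectangle. The threefold convolution that includes the kernel \<open>J\<close> of the
fractional integrals converges absolutely at every point. So the potential of the fractional
derivative is computed exactly, by regrouping the convolutions, and \<open>AE_mixed_deriv\<close> applies.\<close>

theorem theorem63:
  fixes p q \<upsilon> \<sigma> \<tau> w1 w2 \<gamma>1 \<gamma>2 \<gamma>3 W :: complex
    and a1 a2 b1 b2 :: real
    and d \<phi> :: "real \<Rightarrow> real \<Rightarrow> complex"
  assumes "Re p > 0" and "Re q > 0" and "Re \<upsilon> > 0" and "Re \<sigma> > 0" and "Re \<tau> > 0"
    and "a1 < a2" and "b1 < b2"
    and "is_power_value w2 \<upsilon> W"
    and "(\<lambda>(z, t). d z t) absolutely_integrable_on ({a1<..<a2} \<times> {b1<..<b2})"
    and "AE (z, t) in lebesgue. (z, t) \<in> {a1<..<a2} \<times> {b1<..<b2} \<longrightarrow>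
           \<phi> z t = IK_operator \<gamma>1 \<gamma>2 \<gamma>3 \<sigma> \<tau> \<upsilon> w1 W a1 b1 d z t"
  shows "AE (z, t) in lebesgue. (z, t) \<in> {a1<..<a2} \<times> {b1<..<b2} \<longrightarrow>
           IK_left_inverse_exists \<gamma>1 \<gamma>2 \<gamma>3 p q \<sigma> \<tau> \<upsilon> w1 W a1 b1 \<phi> z t \<and>
           IK_left_inverse \<gamma>1 \<gamma>2 \<gamma>3 p q \<sigma> \<tau> \<upsilon> w1 W a1 b1 \<phi> z t = d z t"
proof -
  note pq = assms(1,2) and \<upsilon> = assms(3) and \<sigma>\<tau> = assms(4,5)
  define Q where "Q = {a1<..<a2} \<times> {b1<..<b2}"
  have [measurable]: "Q \<in> sets borel"
    unfolding Q_def borel_prod[symmetric] by measurable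
  define R where "R = max (a2 - a1) (b2 - b1)"
  have R: "a2 - a1 \<le> R" "b2 - b1 \<le> R" "R > 0" using assms(6,7) by (auto simp: R_def)

  \<comment> \<open>A Borel representative of \<open>d\<close>, extended by zero outside the rectangle.\<close>
  obtain D where D: "integrable_on_quadrant D a1 b1" and Dd: "AE x in lborel. x \<in> Q \<longrightarrow> d (fst x) (snd x) = D x"
  proof -
    let ?f = "\<lambda>x. indicator Q x *\<^sub>R d (fst x) (snd x)"
    have int: "integrable lebesgue ?f"
      using assms(9) by (simp add: set_integrable_def Q_def case_prod_unfold)
    then obtain g where g [measurable]: "g \<in> borel_measurable borel" and ae: "AE x in lborel. ?f x = g x"
      using lebesgue_borel_representative[OF borel_measurable_integrable] by blast
    define D where "D x = indicator Q x *\<^sub>R g x" for x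
    have [measurable]: "D \<in> borel_measurable borel" unfolding D_def by measurable
    have ae': "AE x in lborel. ?f x = D x"
      using ae by eventually_elim (auto simp: D_def indicator_def split: if_splits)
    have "integrable lebesgue D"
    proof (rule integrable_cong_AE_imp[OF int])
      show "D \<in> borel_measurable lebesgue" by (intro measurable_completion) simp
      show "AE x in lebesgue. ?f x = D x" using ae' by (rule AE_completion)
    qed
    then have "integrable lborel D" by (subst (asm) integrable_completion) auto
    then have "integrable_on_quadrant D a1 b1"
      by unfold_locales (auto simp: D_def Q_def)
    moreover have "AE x in lborel. x \<in> Q \<longrightarrow> d (fst x) (snd x) = D x"
      using ae' by eventually_elim auto
    ultimately show thesis using that by blast
  qed
  interpret integrable_on_quadrant D a1 b1 by (rule D)
  have suppD: "supported_beyond a1 b1 D"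
    unfolding supported_beyond_def using D0 by (meson not_le)

  define k s where "k = frac_order (p + \<sigma>)" and "s = frac_order (q + \<tau>)"
  define \<kappa> \<mu> where "\<kappa> = of_nat k - (p + \<sigma>)" and "\<mu> = of_nat s - (q + \<tau>)"
  have order: "frac_order \<alpha> > 0" "Re (of_nat (frac_order \<alpha>) - \<alpha>) > 0" if "Re \<alpha> > 0" for \<alpha>
  proof -
    have "\<lfloor>Re \<alpha>\<rfloor> \<ge> 0" using that by simp
    then have "real (frac_order \<alpha>) = of_int \<lfloor>Re \<alpha>\<rfloor> + 1" "frac_order \<alpha> > 0"
      by (simp_all add: frac_order_def)
    then show "frac_order \<alpha> > 0" "Re (of_nat (frac_order \<alpha>) - \<alpha>) > 0"
      using floor_correct[of "Re \<alpha>"] by auto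
  qed
  have ks: "k > 0" "s > 0" and \<kappa>\<mu>: "Re \<kappa> > 0" "Re \<mu> > 0"
    using order[of "p + \<sigma>"] order[of "q + \<tau>"] pq \<sigma>\<tau> unfolding k_def s_def \<kappa>_def \<mu>_def by auto
  define J where "J = tensor (power_kernel \<kappa>) (power_kernel \<mu>)"
  define Km where "Km = IK_series (- \<gamma>1) (- \<gamma>2) p q \<upsilon> w1 W R"
  define Kp where "Kp = IK_series \<gamma>1 \<gamma>2 \<sigma> \<tau> \<upsilon> w1 W R"
  have [measurable]: "J \<in> borel_measurable borel" "Km \<in> borel_measurable borel" "Kp \<in> borel_measurable borel"
    unfolding J_def Km_def Kp_def by measurable
  have dom: "dominated_by_weight J (Re \<kappa>) (Re \<mu>)" "dominated_by_weight Km (Re p) (Re q)"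
    "dominated_by_weight Kp (Re \<sigma>) (Re \<tau>)"
    unfolding J_def Km_def Kp_def
    using dominated_by_weight_tensor dominated_by_weight_IK_series pq \<sigma>\<tau> \<upsilon> R by blast+
  let ?G1 = "nn_convolution (enorm Kp) (enorm D)"
  let ?G2 = "nn_convolution (enorm Km) ?G1"
  have absorb1: "nn_convolution (power_weight \<alpha> \<beta>) ?G1 z < \<infinity>"
    if "\<alpha> > 0" "\<beta> > 0" "\<alpha> + Re \<sigma> \<ge> 1" "\<beta> + Re \<tau> \<ge> 1" for \<alpha> \<beta> z
    using that \<sigma>\<tau> by (intro nn_convolution_weight_absorb[OF dom(3)] nn_convolution_weight_finite) auto
  have absorb2: "nn_convolution (power_weight \<alpha> \<beta>) ?G2 z < \<infinity>"
    if "\<alpha> > 0" "\<beta> > 0" "\<alpha> + Re p + Re \<sigma> \<ge> 1" "\<beta> + Re q + Re \<tau> \<ge> 1" for \<alpha> \<beta> z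
    using that pq by (intro nn_convolution_weight_absorb[OF dom(2)] absorb1) auto
  have fin1: "AE u in lborel. u \<in> Q \<longrightarrow> ?G1 u < \<infinity>"
    using AE_finite_of_nn_convolution_weight_1[OF _ absorb1[of 1 1 "(a2, b2)"]] \<sigma>\<tau>
    by (auto simp: Q_def elim!: eventually_mono)
  have fin2: "AE u in lborel. u \<in> Q \<longrightarrow> ?G2 u < \<infinity>"
    using AE_finite_of_nn_convolution_weight_1[OF _ absorb2[of 1 1 "(a2, b2)"]] pq \<sigma>\<tau>
    by (auto simp: Q_def elim!: eventually_mono)
  \<comment> \<open>The exponents of the three kernels add up to \<open>k\<close> and \<open>s\<close>, which are at least one.\<close>
  have "Re \<kappa> + Re p + Re \<sigma> = real k" "Re \<mu> + Re q + Re \<tau> = real s"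
    by (simp_all add: \<kappa>_def \<mu>_def)
  then have fin3: "nn_convolution (enorm J) ?G2 z < \<infinity>" for z
    using ks \<kappa>\<mu> by (intro nn_convolution_dominated[OF dom(1)] absorb2) auto

  define \<Phi> where "\<Phi> = convolution Kp D"
  have [measurable]: "\<Phi> \<in> borel_measurable borel" unfolding \<Phi>_def by measurable
  have supp\<Phi>: "supported_beyond a1 b1 \<Phi>"
    unfolding \<Phi>_def Kp_def by (intro supported_beyond_convolution supported_beyond_IK_series suppD)
  have \<Phi>_le: "enorm \<Phi> u \<le> ?G1 u" for u
    unfolding \<Phi>_def by (rule enorm_convolution_le) measurable
  have \<phi>\<Phi>: "AE x in lborel. x \<in> Q \<longrightarrow> \<phi> (fst x) (snd x) = \<Phi> x"
  proof -
    have "AE x in lborel. x \<in> Q \<longrightarrow> \<phi> (fst x) (snd x) = IK_operator \<gamma>1 \<gamma>2 \<gamma>3 \<sigma> \<tau> \<upsilon> w1 W a1 b1 d (fst x) (snd x)"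
      using assms(10) unfolding AE_completion_iff Q_def by (simp add: case_prod_unfold mem_Times_iff)
    with fin1 show ?thesis
    proof eventually_elim
      case (elim x)
      have "IK_operator \<gamma>1 \<gamma>2 \<gamma>3 \<sigma> \<tau> \<upsilon> w1 W a1 b1 d (fst x) (snd x) = \<Phi> x" if "x \<in> Q"
        using IK_operator_eq_convolution[OF \<sigma>\<tau> \<upsilon> R(1,2) _ _ suppD Dd[unfolded Q_def], of "fst x" "snd x" \<gamma>1 \<gamma>2 w1 W]
          that elim by (simp add: Q_def \<Phi>_def Kp_def)
      with elim show ?case by simp
    qed
  qed

  define h where "h = IK_operator (- \<gamma>1) (- \<gamma>2) (- \<gamma>3) p q \<upsilon> w1 W a1 b1 \<phi>"
  define H where "H = convolution Km \<Phi>"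
  have [measurable]: "H \<in> borel_measurable borel" unfolding H_def by measurable
  have suppH: "supported_beyond a1 b1 H"
    unfolding H_def Km_def by (intro supported_beyond_convolution supported_beyond_IK_series supp\<Phi>)
  have H_le: "enorm H u \<le> ?G2 u" for u
  proof -
    have "enorm H u \<le> nn_convolution (enorm Km) (enorm \<Phi>) u"
      unfolding H_def by (rule enorm_convolution_le) measurable
    also have "\<dots> \<le> ?G2 u" by (intro nn_convolution_mono \<Phi>_le order_refl)
    finally show ?thesis .
  qed
  have hH: "AE x in lborel. x \<in> Q \<longrightarrow> h (fst x) (snd x) = H x"
    using fin2
  proof eventually_elim
    case (elim x)
    show ?case
    proof
      assume x: "x \<in> Q"
      have "nn_convolution (enorm Km) (enorm \<Phi>) x \<le> ?G2 x" by (intro nn_convolution_mono \<Phi>_le order_refl)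
      also have "\<dots> < \<infinity>" using elim x by simp
      finally show "h (fst x) (snd x) = H x"
        using IK_operator_eq_convolution[OF pq \<upsilon> R(1,2) _ _ supp\<Phi> \<phi>\<Phi>[unfolded Q_def], of "fst x" "snd x" "- \<gamma>1" "- \<gamma>2" w1 W]
          x by (simp add: Q_def h_def H_def Km_def)
    qed
  qed

  define P where "P = frac_deriv_potential a1 b1 (p + \<sigma>) (q + \<tau>) h"
  have P: "P z t = convolution J H (z, t)" if zt: "(z, t) \<in> Q" for z t
  proof -
    have "nn_convolution (enorm J) (enorm H) (z, t) \<le> nn_convolution (enorm J) ?G2 (z, t)"
      by (intro nn_convolution_mono H_le order_refl)
    also have "\<dots> < \<infinity>" by (rule fin3)
    finally show ?thesis
      unfolding P_def J_def using zt
      by (intro frac_deriv_potential_eq_convolution[OF _ _ _ _ suppH hH[unfolded Q_def]])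
        (auto simp: Q_def \<kappa>_def \<mu>_def k_def s_def)
  qed

  have JH: "convolution J H z = convolution (tensor (power_kernel (of_nat k)) (power_kernel (of_nat s))) D z"
    if z: "z \<in> Q" for z
  proof -
    define M where "M = convolution Km Kp"
    have [measurable]: "M \<in> borel_measurable borel" unfolding M_def by measurable
    have "AE u in lborel. enorm J (z - u) * ?G2 u \<noteq> \<infinity>"
      using fin3[of z] unfolding nn_convolution_def[of "enorm J"] by (intro nn_integral_PInf_AE) auto
    \<comment> \<open>Finiteness at \<open>z\<close> forces finiteness of the inner convolution wherever the outer kernel is not
    zero, so there the two kernels of the operators can be convolved first.\<close>
    then have "AE u in lborel. J (z - u) * H u = J (z - u) * convolution M D u"
    proof eventually_elim
      case (elim u)
      show ?case
      proof (cases "J (z - u) = 0")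
        case False
        then have "?G2 u < \<infinity>" using elim by (auto simp: less_top ennreal_mult_eq_top_iff)
        then have "H u = convolution M D u"
          unfolding H_def \<Phi>_def M_def by (intro convolution_assoc) auto
        then show ?thesis by simp
      qed simp
    qed
    then have "convolution J H z = convolution J (convolution M D) z"
      unfolding convolution_def[of J] by (intro integral_cong_AE) measurable
    also have "\<dots> = convolution (convolution J M) D z"
    proof (rule convolution_assoc)
      have "nn_convolution (enorm J) (nn_convolution (enorm M) (enorm D)) z
        \<le> nn_convolution (enorm J) (nn_convolution (nn_convolution (enorm Km) (enorm Kp)) (enorm D)) z"
        unfolding M_def by (intro nn_convolution_mono enorm_convolution_le order_refl) measurable
      also have "nn_convolution (nn_convolution (enorm Km) (enorm Kp)) (enorm D) = ?G2"
        by (rule ext, rule nn_convolution_assoc[symmetric]) measurable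
      finally show "nn_convolution (enorm J) (nn_convolution (enorm M) (enorm D)) z < \<infinity>"
        using fin3[of z] by (rule le_less_trans)
    qed measurable
    also have "\<dots> = convolution (tensor (power_kernel (of_nat k)) (power_kernel (of_nat s))) D z"
    proof -
      let ?T = "tensor (power_kernel (p + \<sigma>)) (power_kernel (q + \<tau>))"
      \<comment> \<open>Beyond the square the cut-off makes \<open>M\<close> differ from \<open>?T\<close>, but such points do not contribute below.\<close>
      have MT: "M w = ?T w" if "\<not> (0 < fst w \<and> 0 < snd w) \<or> w \<in> corner_square R" for w
        using that
      proof
        assume w: "\<not> (0 < fst w \<and> 0 < snd w)"
        have "supported_beyond 0 0 M"
          unfolding M_def Km_def Kp_def by (intro supported_beyond_convolution supported_beyond_IK_series)
        with w supported_beyond_tensor show ?thesis unfolding supported_beyond_def by (metis prod.collapse)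
      next
        assume "w \<in> corner_square R"
        then show ?thesis
          unfolding M_def Km_def Kp_def by (rule convolution_IK_series[OF pq \<upsilon> \<sigma>\<tau>])
      qed
      have "convolution J M v = tensor (power_kernel (of_nat k)) (power_kernel (of_nat s)) v"
        if v: "fst v < R" "snd v < R" for v
      proof -
        have "J (v - w) * M w = J (v - w) * ?T w" for w
        proof (cases "J (v - w) = 0")
          case False
          then have "0 < fst (v - w) \<and> 0 < snd (v - w)"
            using supported_beyond_tensor unfolding supported_beyond_def J_def by (metis prod.collapse)
          then have "\<not> (0 < fst w \<and> 0 < snd w) \<or> w \<in> corner_square R"
            using v by (auto simp: corner_square_def mem_Times_iff)
          then show ?thesis by (simp add: MT)
        qed simp
        then have "convolution J M v = convolution J ?T v"
          unfolding convolution_def by (simp only:)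
        also have "\<dots> = tensor (power_kernel (\<kappa> + (p + \<sigma>))) (power_kernel (\<mu> + (q + \<tau>))) v"
          unfolding J_def using \<kappa>\<mu> pq \<sigma>\<tau> by (subst convolution_tensor_power_kernel) auto
        finally show ?thesis by (simp add: \<kappa>_def \<mu>_def)
      qed
      moreover have "fst (z - u) < R \<and> snd (z - u) < R" if "D u \<noteq> 0" for u
        using that suppD[unfolded supported_beyond_def, rule_format, of "fst u" "snd u"] z R
        by (auto simp: Q_def)
      ultimately have "convolution J M (z - u) * D u
          = tensor (power_kernel (of_nat k)) (power_kernel (of_nat s)) (z - u) * D u" for u
        by (cases "D u = 0") auto
      then show ?thesis unfolding convolution_def[of _ D] by (simp only:)
    qed
    finally show ?thesis .
  qed

  have "AE x in lborel. x \<in> {a1<..<a2} \<times> {b1<..<b2} \<longrightarrow>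
    (\<forall>\<^sub>F t' in nhds (snd x). nth_differentiable k (\<lambda>z'. P z' t') (fst x)) \<and>
    nth_differentiable s (\<lambda>t'. nth_deriv k (\<lambda>z'. P z' t') (fst x)) (snd x) \<and>
    nth_deriv s (\<lambda>t'. nth_deriv k (\<lambda>z'. P z' t') (fst x)) (snd x) = D x"
    using P JH by (intro AE_mixed_deriv[OF ks]) (auto simp: Q_def)
  with Dd have "AE x in lborel. x \<in> Q \<longrightarrow>
      IK_left_inverse_exists \<gamma>1 \<gamma>2 \<gamma>3 p q \<sigma> \<tau> \<upsilon> w1 W a1 b1 \<phi> (fst x) (snd x) \<and>
      IK_left_inverse \<gamma>1 \<gamma>2 \<gamma>3 p q \<sigma> \<tau> \<upsilon> w1 W a1 b1 \<phi> (fst x) (snd x) = d (fst x) (snd x)"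
  proof eventually_elim
    case (elim x)
    then show ?case
      unfolding IK_left_inverse_exists_def IK_left_inverse_def frac_deriv2_exists_def frac_deriv2_def
        h_def[symmetric] P_def[symmetric] k_def[symmetric] s_def[symmetric]
      by (simp add: Q_def)
  qed
  then show ?thesis
    unfolding AE_completion_iff by (simp add: Q_def case_prod_unfold mem_Times_iff)
qed

end
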